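(* Let $q\in\mathbf{C}$, $|q|>1$, and let $(\Lambda_1,\dots,\Lambda_m)$ be an ordered partition of a divisor $\Lambda$, i.e. $\Lambda=\Lambda_1+\cdots+\Lambda_m$ with each $\Lambda_i$ a divisor of degree $\ge1$. Put $\Lambda_{\ge i}=\sum_{j\ge i}\Lambda_j$ and $\Lambda_{\le i}=\sum_{j\le i}\Lambda_j$. Let $\mathbb{E}^\Lambda_{(\Lambda_1,\dots,\Lambda_m)}$ be the set of functions that are analytic in a punctured neighborhood of $0$, have $q$-Gevrey order $|\Lambda|$ at $0$ and, for $i=1,\dots,m$, have $q$-Gevrey order $|\Lambda_{\ge i+1}|$ over $\Lambda_{\ge i}/\Lambda_{\ge i+1}$ at $0$. Then $$\mathbb{E}^\Lambda_{(\Lambda_1,\dots,\Lambda_m)}=\mathbb{E}_0^{\Lambda_m}+\theta_{\Lambda_{\ge m}}\mathbb{E}_0^{\Lambda_{m-1}}+\cdots+\theta_{\Lambda_{\ge2}}\mathbb{E}_0^{\Lambda_1}.$$ In other words, writing $\mathbb{O}^\Lambda_{(\Lambda_1,\dots,\Lambda_m)}:=\bigl(\tfrac1{\theta_\Lambda}\mathbb{E}^\Lambda_{(\Lambda_1,\dots,\Lambda_m)}\bigr)\cap\mathbb{B}^\Lambda$, one has $$\mathbb{O}^\Lambda_{(\Lambda_1,\dots,\Lambda_m)}=\mathbb{A}_q^{\Lambda_1}+\frac1{\theta_{\Lambda_{\le1}}}\mathbb{A}_q^{\Lambda_2}+\cdots+\frac1{\theta_{\Lambda_{\le m-1}}}\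mathbb{A}_q^{\Lambda_m}.$$
   Context: Functions are considered as germs at $0$. For $\lambda\in\mathbf{C}^*$, $[\lambda]=\lambda q^{\mathbf{Z}}$. A divisor is a finite formal sum $\Lambda=\sum_i\nu_i[\lambda_i]$ ($\nu_i\in\mathbf{N}$, distinct $[\lambda_i]$), $|\Lambda|=\sum\nu_i$; $\Lambda_{\ge m+1}$ is the null divisor. $d_q(z,[\lambda])=\inf_{\xi\in[\lambda]}|1-z/\xi|$, $d_q(z,\Lambda)=\prod_i d_q(z,[\lambda_i])^{\nu_i}$, $S(\Lambda,\epsilon;R)=\{z\in\mathbf{C}^*:d_q(z,\Lambda)>\epsilon,|z|<R\}$. $\theta(z)=\sum_{n\in\mathbf{Z}}q^{-n(n-1)/2}z^n$, $\theta_\Lambda(z)=\prod_i\theta(-z/\lambda_i)^{\nu_i}$ (with a fixed choice of representatives $\lambda_i$), $e(z)=\sum_{n\in\mathbf{Z}}|q|^{-n(n-1)/2}|z|^n$. $F$, analytic in a punctured neighborhood of $0$, has $q$-Gevrey order $k$ at $0$ if there are $C,\mu,R>0$ with $|F(z)|\le C\,e(\mu z)^k$ for $0<|z|<R$. If $\Lambda'=\sum\nu'_i[\lambda_i]$, $\Lambda=\sum\nu_i[\lambda_i]$ with $0\le\nu_i'\le\nu_i$, $F$ has $q$-Gevrey order $k$ over $\Lambda/\Lambda'$ at $0$ if for all $i$ and $\nu'_i\le j<\nu_i$ there are $C,A>0$ with $|F^{(j)}(\lambda_iq^{-n})|\le CA^n|q|^{kn^2/2}$ for all large $n$. $\mathbb{E}_0^\Lambda$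 is the set of $F$ analytic in a punctured neighborhood of $0$, of $q$-Gevrey order $|\Lambda|$ at $0$ and of $q$-Gevrey order $0$ over $\Lambda$ (i.e. over $\Lambda/$null divisor) at $0$. $\mathbb{B}^\Lambda$: functions $f$ analytic on some $S(\Lambda,0;R)$ with $\sup_{S(\Lambda,\epsilon;r)}|f|<\infty$ for all $\epsilon>0$, $0<r<R$. $\mathbb{A}_q^\Lambda$: the $f\in\mathbb{B}^\Lambda$ for which there are $\sum a_nz^n\in\mathbf{C}[[z]]$ and $C,A>0$ such that, for some small enough $R>0$, for all $\epsilon>0$, $N\ge0$, $z\in S(\Lambda,\epsilon;R)$: $|f(z)-\sum_{n<N}a_nz^n|<\frac C\epsilon A^N|q|^{N^2/(2|\Lambda|)}|z|^N$. *)

theory Defs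
  imports "HOL-Complex_Analysis.Complex_Analysis" "HOL-Library.Multiset"
begin

text \<open>
  A divisor is a finite multiset of \<open>q\<close>-spirals: the multiplicity of \<open>[\<lambda>]\<close> is its count, the
  degree is the size of the multiset, and sums of divisors are sums of multisets.
\<close>

definition spiral :: "complex \<Rightarrow> complex \<Rightarrow> complex set" where
  "spiral q l = range (\<lambda>n::int. l * q powi n)"

definition q_divisor :: "complex \<Rightarrow> complex set multiset \<Rightarrow> bool" where
  "q_divisor q \<Lambda> \<longleftrightarrow> set_mset \<Lambda> \<subseteq> spiral q ` (- {0})"

definition dist_spiral :: "complex \<Rightarrow> complex set \<Rightarrow> real" where
  "dist_spiral z s = (INF \<xi>\<in>s. norm (1 - z / \<xi>))"

definition dist_div :: "complex \<Rightarrow> complex set multiset \<Rightarrow> real" where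
  "dist_div z \<Lambda> = (\<Prod>s\<in>#\<Lambda>. dist_spiral z s)"

definition sector :: "complex set multiset \<Rightarrow> real \<Rightarrow> real \<Rightarrow> complex set" where
  "sector \<Lambda> \<epsilon> R = {z. z \<noteq> 0 \<and> dist_div z \<Lambda> > \<epsilon> \<and> norm z < R}"

text \<open>
  Functions are represented by total functions that matter only on \<open>sector \<Lambda> 0 R\<close> for some
  \<open>R > 0\<close>, that is, near \<open>0\<close> and off \<open>0\<close> and the spirals of \<open>\<Lambda>\<close>. For the null divisor
  \<open>sector {#} 0 R\<close> is the punctured disc of radius \<open>R\<close>.
\<close>

definition germ :: "complex set multiset \<Rightarrow> (complex \<Rightarrow> complex) \<Rightarrow> (complex \<Rightarrow> complex) set" where
  "germ \<Lambda> f = {g. \<exists>R>0. \<forall>z\<in>sector \<Lambda> 0 R. g z = f z}"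

definition theta :: "complex \<Rightarrow> complex \<Rightarrow> complex" where
  "theta q z = (\<Sum>\<^sub>\<infinity>n::int. q powi (- (n * (n - 1) div 2)) * z powi n)"

text \<open>The argument \<open>rep\<close> is the choice of a representative \<open>rep s \<in> s\<close> of each spiral \<open>s\<close>.\<close>

definition theta_div ::
  "complex \<Rightarrow> (complex set \<Rightarrow> complex) \<Rightarrow> complex set multiset \<Rightarrow> complex \<Rightarrow> complex" where
  "theta_div q rep \<Lambda> z = (\<Prod>s\<in>#\<Lambda>. theta q (- z / rep s))"

definition e_fun :: "complex \<Rightarrow> complex \<Rightarrow> real" where
  "e_fun q z = (\<Sum>\<^sub>\<infinity>n::int. norm q powi (- (n * (n - 1) div 2)) * norm z powi n)"

definition analytic_punctured :: "(complex \<Rightarrow> complex) \<Rightarrow> bool" where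
  "analytic_punctured F \<longleftrightarrow> (\<exists>R>0. F analytic_on (ball 0 R - {0}))"

definition gevrey_at_0 :: "complex \<Rightarrow> nat \<Rightarrow> (complex \<Rightarrow> complex) \<Rightarrow> bool" where
  "gevrey_at_0 q k F \<longleftrightarrow>
     (\<exists>C>0. \<exists>\<mu>>0. \<exists>R>0. \<forall>z. 0 < norm z \<and> norm z < R \<longrightarrow>
        norm (F z) \<le> C * e_fun q (complex_of_real \<mu> * z) ^ k)"

text \<open>Order \<open>k\<close> over \<open>\<Lambda>/\<Lambda>'\<close>, where \<open>\<Lambda>' \<subseteq># \<Lambda>\<close> is intended.\<close>

definition gevrey_over ::
  "complex \<Rightarrow> (complex set \<Rightarrow> complex) \<Rightarrow> nat \<Rightarrow> complex set multiset \<Rightarrow> complex set multiset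
    \<Rightarrow> (complex \<Rightarrow> complex) \<Rightarrow> bool" where
  "gevrey_over q rep k \<Lambda> \<Lambda>' F \<longleftrightarrow>
     (\<forall>s\<in>#\<Lambda>. \<forall>j. count \<Lambda>' s \<le> j \<and> j < count \<Lambda> s \<longrightarrow>
        (\<exists>C>0. \<exists>A>0. \<forall>\<^sub>F n in sequentially.
           norm ((deriv ^^ j) F (rep s * q powi (- int n)))
             \<le> C * A ^ n * norm q powr (real k * (real n)\<^sup>2 / 2)))"

definition E0 ::
  "complex \<Rightarrow> (complex set \<Rightarrow> complex) \<Rightarrow> complex set multiset \<Rightarrow> (complex \<Rightarrow> complex) set" where
  "E0 q rep \<Lambda> =
     {F. analytic_punctured F \<and> gevrey_at_0 q (size \<Lambda>) F \<and> gevrey_over q rep 0 \<Lambda> {#} F}"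

definition B_space :: "complex set multiset \<Rightarrow> (complex \<Rightarrow> complex) set" where
  "B_space \<Lambda> =
     {f. \<exists>R>0. f analytic_on sector \<Lambda> 0 R \<and>
           (\<forall>\<epsilon> r. \<epsilon> > 0 \<and> 0 < r \<and> r < R \<longrightarrow> bounded (f ` sector \<Lambda> \<epsilon> r))}"

definition A_space :: "complex \<Rightarrow> complex set multiset \<Rightarrow> (complex \<Rightarrow> complex) set" where
  "A_space q \<Lambda> =
     {f \<in> B_space \<Lambda>. \<exists>a :: nat \<Rightarrow> complex. \<exists>C>0. \<exists>A>0. \<exists>R>0.
        \<forall>\<epsilon>>0. \<forall>N. \<forall>z\<in>sector \<Lambda> \<epsilon> R.
          norm (f z - (\<Sum>n<N. a n * z ^ n))
            < C / \<epsilon> * A ^ N * norm q powr ((real N)\<^sup>2 / (2 * real (size \<Lambda>))) * norm z ^ N}"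

text \<open>Partitions are indexed by \<open>{1..m}\<close>; the values of \<open>L\<close> outside this range are irrelevant.\<close>

definition ordered_partition ::
  "complex \<Rightarrow> nat \<Rightarrow> (nat \<Rightarrow> complex set multiset) \<Rightarrow> complex set multiset \<Rightarrow> bool" where
  "ordered_partition q m L \<Lambda> \<longleftrightarrow>
     1 \<le> m \<and> (\<forall>i\<in>{1..m}. q_divisor q (L i) \<and> 1 \<le> size (L i)) \<and> \<Lambda> = (\<Sum>i=1..m. L i)"

definition div_ge :: "nat \<Rightarrow> (nat \<Rightarrow> complex set multiset) \<Rightarrow> nat \<Rightarrow> complex set multiset" where
  "div_ge m L i = (\<Sum>j=i..m. L j)"

definition div_le :: "(nat \<Rightarrow> complex set multiset) \<Rightarrow> nat \<Rightarrow> complex set multiset" where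
  "div_le L i = (\<Sum>j=1..i. L j)"

definition E_part ::
  "complex \<Rightarrow> (complex set \<Rightarrow> complex) \<Rightarrow> nat \<Rightarrow> (nat \<Rightarrow> complex set multiset)
    \<Rightarrow> complex set multiset \<Rightarrow> (complex \<Rightarrow> complex) set" where
  "E_part q rep m L \<Lambda> =
     {F. analytic_punctured F \<and> gevrey_at_0 q (size \<Lambda>) F \<and>
         (\<forall>i\<in>{1..m}. gevrey_over q rep (size (div_ge m L (i + 1)))
                          (div_ge m L i) (div_ge m L (i + 1)) F)}"

text \<open>
  \<open>B_space \<Lambda>\<close> is a union of classes of \<open>germ \<Lambda>\<close>, so intersecting representatives as below
  agrees with intersecting germs; the value \<open>0\<close> of \<open>F / \<theta>\<^sub>\<Lambda>\<close> at the zeros of \<open>\<theta>\<^sub>\<Lambda>\<close> is not seen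
  by the germ.
\<close>

definition O_part ::
  "complex \<Rightarrow> (complex set \<Rightarrow> complex) \<Rightarrow> nat \<Rightarrow> (nat \<Rightarrow> complex set multiset)
    \<Rightarrow> complex set multiset \<Rightarrow> (complex \<Rightarrow> complex) set" where
  "O_part q rep m L \<Lambda> =
     (\<lambda>F z. 1 / theta_div q rep \<Lambda> z * F z) ` E_part q rep m L \<Lambda> \<inter> B_space \<Lambda>"

end

theory Submission imports Defs
begin

text \<open>
  Up to a constant, \<open>\<theta>(z)\<close> is the Jacobi product, so it vanishes exactly on the spiral \<open>[-1]\<close>, to first
  order. Both \<open>|\<theta>|\<close> and \<open>e\<close> satisfy \<open>h(q z) = |q z| h(z)\<close>, as does the explicit function
  \<open>gauss(z) = |z|\<^sup>1\<^sup>/\<^sup>2 exp (ln\<^sup>2 |z| / (2 ln |q|))\<close>; comparing on the annulus \<open>1 \<le> |z| \<le> |q|\<close> shows that \<open>e(z)\<close> is of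
  the size of \<open>gauss(z)\<close> and \<open>|\<theta>(- z / \<lambda>)|\<close> of the size of \<open>d(z, [\<lambda>]) gauss(z / \<lambda>)\<close>.

  If \<open>F\<close> has order \<open>0\<close> over \<open>\<Lambda>\<close>, the principal parts of \<open>F / \<theta>\<^sub>\<Lambda>\<close> at \<open>\<lambda> q\<^sup>-\<^sup>n\<close> are at most
  \<open>C A\<^sup>n |q| powr (- |\<Lambda>| n\<^sup>2 / 2)\<close> in size. Hence their sum \<open>G\<close> converges, lies in \<open>A\<^sub>q\<^sup>\<Lambda>\<close>, and
  \<open>F = \<theta>\<^sub>\<Lambda> (G + H)\<close> with \<open>H\<close> analytic in a punctured disc. Conversely \<open>\<theta>\<^sub>\<Lambda> f\<close> lies in \<open>E\<^sub>0\<^sup>\<Lambda>\<close> for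
  every \<open>f\<close> in \<open>A\<^sub>q\<^sup>\<Lambda>\<close>: compare \<open>f\<close> near \<open>\<lambda> q\<^sup>-\<^sup>n\<close> with its expansion truncated at \<open>N = n |\<Lambda>|\<close>. Peeling off
  \<open>\<Lambda>\<^sub>m, \<dots>, \<Lambda>\<^sub>1\<close> in turn gives \<open>F / \<theta>\<^sub>\<Lambda> = H + (\<Sum>i. G\<^sub>i / \<theta>\<^sub>i)\<close>, where \<open>\<theta>\<^sub>i\<close> belongs to \<open>\<Lambda>\<^sub>1 + \<dots> + \<Lambda>\<^sub>i\<^sub>-\<^sub>1\<close>. On
  circles that stay away from the spirals \<open>H\<close> has at most polynomial growth, so it has at most a pole at
  \<open>0\<close>, and it is holomorphic at \<open>0\<close> if \<open>F / \<theta>\<^sub>\<Lambda>\<close> is bounded off the spirals.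
\<close>

subsection \<open>Theta function and Jacobi product\<close>

text \<open>The hypothesis controls derivatives along the spirals only beyond the multiplicities in
  the later divisors. As the allowed orders decrease with \<open>i\<close>, these relative
  conditions combine into absolute ones over each \<open>div_ge m L i\<close>. The last one has
  order 0 over \<open>L m\<close>, which dictates where peeling starts. The part removed has order
  \<open>size (L m)\<close> at 0, so Cauchy's estimate gives it all remaining conditions; dividing
  by the theta factor then lowers each order over the spirals by exactly \<open>size (L m)\<close>,
  and the quotient satisfies the hypothesis for the shorter partition.

  Local estimates use the coordinate \<open>w\<close> in \<open>z = l / q ^ n * (1 + w)\<close>, on
  a disc of radius independent of \<open>n\<close>. There a theta product is a constant of known
  order times a power of \<open>w\<close>, up to a zero-free factor with geometrically bounded
  coefficients, so products, quotients and principal parts become sums over Taylor coefficients.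

  Order at 0 controls the remainder: off the spirals the powers of \<open>gauss\<close> in the
  bounds for \<open>F\<close> and for the theta product cancel and leave a power of |z|. The
  remainder joins the summand \<open>i = 1\<close>.\<close>

lemma summable_power_series_ratio:
  fixes c :: "nat \<Rightarrow> 'a::{real_normed_field,banach}"
  assumes "\<And>n. norm (c (Suc n)) \<le> r n * norm (c n)" and "r \<longlonglongrightarrow> 0"
  shows "summable (\<lambda>n. norm (c n * z ^ n))"
proof -
  have "(\<lambda>n. r n * norm z) \<longlonglongrightarrow> 0"
    using tendsto_mult_left_zero[OF assms(2)] .
  then have "\<forall>\<^sub>F n in sequentially. r n * norm z < 1/2"
    by (rule order_tendstoD(2)) simp
  then obtain N where N: "\<And>n. n \<ge> N \<Longrightarrow> r n * norm z < 1/2"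
    by (auto simp: eventually_sequentially)
  show ?thesis
  proof (rule summable_ratio_test[of "1/2" N])
    fix n assume "n \<ge> N"
    have "norm (norm (c (Suc n) * z ^ Suc n)) = norm (c (Suc n)) * norm z * norm z ^ n"
      by (simp add: norm_mult norm_power)
    also have "\<dots> \<le> r n * norm (c n) * norm z * norm z ^ n"
      by (intro mult_right_mono assms) auto
    also have "\<dots> = (r n * norm z) * norm (c n * z ^ n)"
      by (simp add: norm_mult norm_power mult_ac)
    also have "\<dots> \<le> 1/2 * norm (c n * z ^ n)"
      using N[OF \<open>n \<ge> N\<close>] by (intro mult_right_mono) auto
    finally show "norm (norm (c (Suc n) * z ^ Suc n)) \<le> 1/2 * norm (norm (c n * z ^ n))"
      by simp
  qed simp
qed

lemma entire_power_series:
  fixes c :: "nat \<Rightarrow> complex"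
  assumes "\<And>z. summable (\<lambda>n. norm (c n * z ^ n))"
  shows "(\<lambda>z. \<Sum>n. c n * z ^ n) holomorphic_on A"
proof -
  have "\<And>z. summable (\<lambda>n. c n * z ^ n)"
    by (rule summable_norm_cancel) (rule assms)
  from termdiffs_strong_converges_everywhere[OF this]
  show ?thesis
    unfolding holomorphic_on_def field_differentiable_def
    by (blast intro: has_field_derivative_at_within)
qed

text \<open>The type is left general because both series are instances: \<open>theta\<close> over
  the complex numbers and \<open>e_fun\<close> over the reals, at the norms of \<open>q\<close> and
  \<open>z\<close>.\<close>

definition theta_term :: "'a::{real_normed_field,banach} \<Rightarrow> 'a \<Rightarrow> int \<Rightarrow> 'a" where
  "theta_term q z n = q powi (- (n * (n - 1) div 2)) * z powi n"

lemma triangular_int_Suc: "(n + 1) * (n + 1 - 1) div 2 = n * (n - 1) div 2 + (n::int)"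
proof -
  have "(n + 1) * (n + 1 - 1) = n * (n - 1) + n * 2" by (simp add: algebra_simps)
  then show ?thesis by simp
qed

lemma theta_term_Suc:
  assumes "q \<noteq> 0" "z \<noteq> 0"
  shows "theta_term q z (n + 1) = z * q powi (- n) * theta_term q z n"
proof -
  define t where "t = n * (n - 1) div 2"
  have t: "(n + 1) * (n + 1 - 1) div 2 = t + n"
    unfolding t_def by (rule triangular_int_Suc)
  show ?thesis unfolding theta_term_def t t_def[symmetric] using assms
    by (simp add: power_int_add power_int_minus power_int_diff field_simps)
qed

lemma theta_term_scale:
  assumes "q \<noteq> 0" "z \<noteq> 0"
  shows "theta_term q (q * z) n = q * z * theta_term q z (n - 1)"
proof -
  define t where "t = (n - 1) * (n - 1 - 1) div 2"
  have t: "n * (n - 1) div 2 = t + (n - 1)"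
    using triangular_int_Suc[of "n - 1"] unfolding t_def by simp
  show ?thesis unfolding theta_term_def t t_def[symmetric] using assms
    by (simp add: power_int_add power_int_minus power_int_mult_distrib power_int_diff field_simps)
qed

text \<open>The exponent n(n-1)/2 is symmetric under the reflection of \<open>n\<close> to
  \<open>1 - n\<close>, whereas the sign of (-1)^n changes. So the terms of the theta series at -1
  cancel in pairs.\<close>

lemma theta_term_reflect:
  assumes "q \<noteq> 0"
  shows "theta_term q (-1) (1 - n) = - theta_term q (-1) n"
proof -
  have "(1 - n) * (1 - n - 1) = n * (n - 1)" by (simp add: algebra_simps)
  moreover have "(-1::'a) powi (1 - n) = - ((-1) powi n)"
    by (cases "even n") (simp_all add: power_int_minus_left)
  ultimately show ?thesis unfolding theta_term_def
    by (simp only: mult_minus_right)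
qed

text \<open>The Laurent series is cut at exponent 0. Index \<open>n\<close> of
  \<open>theta_coeff2\<close> stands for the exponent -n-1, so the negative half is 1/z times a
  power series in 1/z.\<close>

definition theta_coeff1 :: "'a::{real_normed_field,banach} \<Rightarrow> nat \<Rightarrow> 'a" where
  "theta_coeff1 q n = theta_term q 1 (int n)"

definition theta_coeff2 :: "'a::{real_normed_field,banach} \<Rightarrow> nat \<Rightarrow> 'a" where
  "theta_coeff2 q n = theta_term q 1 (- int n - 1)"

lemma theta_term_1_mult: "theta_term q z n = theta_term q 1 n * z powi n"
  by (simp add: theta_term_def)

lemma theta_coeff1_summable:
  fixes q :: "'a::{real_normed_field,banach}"
  assumes "1 < norm q"
  shows "summable (\<lambda>n. norm (theta_coeff1 q n * z ^ n))"
proof (rule summable_power_series_ratio)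
  have "q \<noteq> 0" using assms by auto
  show "norm (theta_coeff1 q (Suc n)) \<le> (1 / norm q) ^ n * norm (theta_coeff1 q n)" for n
  proof -
    have "theta_coeff1 q (Suc n) = inverse (q ^ n) * theta_coeff1 q n"
      using theta_term_Suc[of q 1 "int n"] \<open>q \<noteq> 0\<close>
      by (simp add: theta_coeff1_def power_int_minus add.commute)
    then show ?thesis
      by (simp add: norm_mult norm_inverse norm_power power_one_over divide_inverse power_inverse)
  qed
  show "(\<lambda>n. (1 / norm q) ^ n) \<longlonglongrightarrow> 0"
    using assms by (intro LIMSEQ_realpow_zero) (auto simp: divide_less_eq)
qed

lemma theta_coeff2_summable:
  fixes q :: "'a::{real_normed_field,banach}"
  assumes "1 < norm q"
  shows "summable (\<lambda>n. norm (theta_coeff2 q n * z ^ n))"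
proof (rule summable_power_series_ratio)
  have "q \<noteq> 0" using assms by auto
  show "norm (theta_coeff2 q (Suc n)) \<le> (1 / norm q) ^ (n + 2) * norm (theta_coeff2 q n)" for n
  proof -
    have *: "theta_term q 1 (- int n - 1) = q powi (int n + 2) * theta_term q 1 (- int (Suc n) - 1)"
      using theta_term_Suc[of q 1 "- int n - 2"] \<open>q \<noteq> 0\<close> by (simp add: algebra_simps minus_diff_commute)
    have "norm (q powi (int n + 2)) = norm q ^ (n + 2)"
      by (simp add: norm_power_int power_int_add power2_eq_square \<open>q \<noteq> 0\<close> norm_mult norm_power)
    then show ?thesis unfolding theta_coeff2_def * using \<open>q \<noteq> 0\<close>
      by (simp add: norm_mult field_simps)
  qed
  have "(\<lambda>n. (1 / norm q) ^ n) \<longlonglongrightarrow> 0"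
    using assms by (intro LIMSEQ_realpow_zero) (auto simp: divide_less_eq)
  then show "(\<lambda>n. (1 / norm q) ^ (n + 2)) \<longlonglongrightarrow> 0"
    by (rule LIMSEQ_ignore_initial_segment)
qed

text \<open>Writing the Laurent series through two entire functions makes holomorphy of
  \<open>theta\<close> immediate; over the reals it gives bounds for \<open>e_fun\<close> by
  monotonicity of the two power series.\<close>

lemma theta_term_has_sum:
  fixes q z :: "'a::{real_normed_field,banach}"
  assumes "1 < norm q" "z \<noteq> 0"
  shows "(theta_term q z has_sum
           (\<Sum>n. theta_coeff1 q n * z ^ n) + (\<Sum>n. theta_coeff2 q n * inverse z ^ n) / z) UNIV"
proof -
  have 1: "((\<lambda>n. theta_coeff1 q n * z ^ n) has_sum (\<Sum>n. theta_coeff1 q n * z ^ n)) UNIV"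
    using theta_coeff1_summable[OF assms(1)] summable_norm_cancel[OF theta_coeff1_summable[OF assms(1)]]
    by (intro norm_summable_imp_has_sum summable_sums)
  have 2: "((\<lambda>n. theta_coeff2 q n * inverse z ^ n) has_sum (\<Sum>n. theta_coeff2 q n * inverse z ^ n)) UNIV"
    using theta_coeff2_summable[OF assms(1)] summable_norm_cancel[OF theta_coeff2_summable[OF assms(1)]]
    by (intro norm_summable_imp_has_sum summable_sums)
  have b1: "bij_betw int UNIV {0..}"
    by (rule bij_betwI[where g = nat]) auto
  have b2: "bij_betw (\<lambda>n. - int n - 1) UNIV {..<0}"
    by (rule bij_betwI[where g = "\<lambda>k. nat (- k - 1)"]) auto
  have A: "(theta_term q z has_sum (\<Sum>n. theta_coeff1 q n * z ^ n)) {0..}"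
    using 1 has_sum_reindex_bij_betw[OF b1, of "theta_term q z"]
    by (simp add: theta_coeff1_def theta_term_1_mult[of q z])
  have "((\<lambda>n. theta_coeff2 q n * inverse z ^ n * (1/z)) has_sum (\<Sum>n. theta_coeff2 q n * inverse z ^ n) * (1/z)) UNIV"
    by (intro has_sum_cmult_left 2)
  also have "(\<lambda>n. theta_coeff2 q n * inverse z ^ n * (1/z)) = (\<lambda>n. theta_term q z (- int n - 1))"
    using assms
    by (auto simp: fun_eq_iff theta_coeff2_def theta_term_1_mult[of q z] power_int_diff power_int_minus field_simps)
  finally have B: "(theta_term q z has_sum (\<Sum>n. theta_coeff2 q n * inverse z ^ n) / z) {..<0}"
    using has_sum_reindex_bij_betw[OF b2, of "theta_term q z"] by simp
  have "{0..} \<union> {..<0} = (UNIV :: int set)" "{0..} \<inter> {..<0} = ({} :: int set)" by auto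
  with has_sum_Un_disjoint[OF A B] show ?thesis by simp
qed

lemma theta_eq_infsum: "theta q z = infsum (theta_term q z) UNIV"
  unfolding theta_def theta_term_def ..

lemma e_fun_eq_infsum: "e_fun q z = infsum (theta_term (norm q) (norm z)) UNIV"
  unfolding e_fun_def theta_term_def ..

lemma theta_scale:
  assumes "q \<noteq> 0" "z \<noteq> 0"
  shows "theta q (q * z) = q * z * theta q z"
proof -
  have b: "bij_betw (\<lambda>n::int. n - 1) UNIV UNIV"
    by (rule bij_betwI[where g = "\<lambda>n. n + 1"]) auto
  have "theta q (q * z) = infsum (\<lambda>n. q * z * theta_term q z (n - 1)) UNIV"
    unfolding theta_eq_infsum by (rule infsum_cong) (rule theta_term_scale[OF assms])
  also have "\<dots> = q * z * infsum (\<lambda>n. theta_term q z (n - 1)) UNIV"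
    by (rule infsum_cmult_right')
  also have "infsum (\<lambda>n. theta_term q z (n - 1)) UNIV = theta q z"
    unfolding theta_eq_infsum by (rule infsum_reindex_bij_betw[OF b])
  finally show ?thesis .
qed

lemma theta_minus_one: "q \<noteq> 0 \<Longrightarrow> theta q (- 1) = 0"
proof -
  assume "q \<noteq> 0"
  have b: "bij_betw (\<lambda>n::int. 1 - n) UNIV UNIV"
    by (rule bij_betwI[where g = "\<lambda>n. 1 - n"]) auto
  have "theta q (- 1) = infsum (\<lambda>n. theta_term q (- 1) (1 - n)) UNIV"
    unfolding theta_eq_infsum by (rule infsum_reindex_bij_betw[OF b, symmetric])
  also have "\<dots> = - theta q (- 1)"
    unfolding theta_eq_infsum theta_term_reflect[OF \<open>q \<noteq> 0\<close>] by (rule infsum_uminus)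
  finally show ?thesis by simp
qed

lemma theta_eq_power_series:
  assumes "1 < norm q" "z \<noteq> 0"
  shows "theta q z = (\<Sum>n. theta_coeff1 q n * z ^ n) + (\<Sum>n. theta_coeff2 q n * inverse z ^ n) / z"
  unfolding theta_eq_infsum using theta_term_has_sum[OF assms] by (rule infsumI)

lemma theta_holomorphic:
  assumes "1 < norm q"
  shows "theta q holomorphic_on - {0}"
proof -
  have 1: "(\<lambda>z. \<Sum>n. theta_coeff1 q n * z ^ n) holomorphic_on - {0}"
    by (intro entire_power_series theta_coeff1_summable assms)
  have "(\<lambda>z. \<Sum>n. theta_coeff2 q n * z ^ n) holomorphic_on inverse ` (- {0})"
    by (intro entire_power_series theta_coeff2_summable assms)
  then have "((\<lambda>z. \<Sum>n. theta_coeff2 q n * z ^ n) \<circ> inverse) holomorphic_on - {0}"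
    by (intro holomorphic_on_compose holomorphic_intros) auto
  with 1 have "(\<lambda>z. (\<Sum>n. theta_coeff1 q n * z ^ n) + (\<Sum>n. theta_coeff2 q n * inverse z ^ n) / z)
      holomorphic_on - {0}"
    by (intro holomorphic_intros) (auto simp: o_def)
  then show ?thesis
    by (rule holomorphic_transform) (use theta_eq_power_series[OF assms] in auto)
qed

text \<open>Otherwise the entire function given by the nonnegative exponents would be minus the part
  with negative exponents, which tends to 0 at infinity. Liouville's theorem would make it 0,
  against its constant term 1. This keeps the factor between \<open>theta\<close> and the Jacobi
  product nonzero.\<close>

lemma theta_nonzero_somewhere:
  assumes "1 < norm q"
  shows "\<exists>z. z \<noteq> 0 \<and> theta q z \<noteq> 0"
proof (rule ccontr)
  assume "\<not> ?thesis"
  then have 0: "theta q z = 0" if "z \<noteq> 0" for z using that by blast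
  define A where "A = (\<lambda>z. \<Sum>n. theta_coeff1 q n * z ^ n)"
  define B where "B = (\<lambda>z. \<Sum>n. theta_coeff2 q n * z ^ n)"
  have "A holomorphic_on UNIV" "B holomorphic_on UNIV" unfolding A_def B_def
    by (intro entire_power_series theta_coeff1_summable theta_coeff2_summable assms)+
  then have "isCont B 0"
    using continuous_on_eq_continuous_at holomorphic_on_imp_continuous_on open_UNIV by blast
  then have "((\<lambda>z. - (B (inverse z) * inverse z)) \<longlongrightarrow> - (B 0 * 0)) at_infinity"
    by (intro tendsto_intros tendsto_inverse_0 isCont_tendsto_compose[of 0 B])
  moreover have "- (B (inverse z) * inverse z) = A z" if "z \<noteq> 0" for z
  proof -
    have "A z + B (inverse z) / z = 0"
      using 0[OF that] theta_eq_power_series[OF assms that] unfolding A_def B_def by simp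
    then have "A z = - (B (inverse z) / z)"
      by (simp only: eq_neg_iff_add_eq_0)
    then show ?thesis by (simp add: divide_inverse)
  qed
  then have "\<forall>\<^sub>F z in at_infinity. - (B (inverse z) * inverse z) = A z"
    by (rule eventually_mono[OF eventually_not_equal_at_infinity[of "0::complex"]])
  ultimately have "(A \<longlongrightarrow> - (B 0 * 0)) at_infinity"
    by (rule Lim_transform_eventually)
  then have "(A \<longlongrightarrow> 0) at_infinity" by simp
  then have "A 0 = 0"
    using Liouville_weak_0 \<open>A holomorphic_on UNIV\<close> by blast
  moreover have "A 0 = 1"
    unfolding A_def by (simp add: theta_coeff1_def theta_term_def)
  ultimately show False by simp
qed

text \<open>The recursion that the functional equation f(z) = (1 + z) f(z/q) imposes on the
  coefficients of a power series with constant term 1.\<close>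

primrec euler_coeff :: "complex \<Rightarrow> nat \<Rightarrow> complex" where
  "euler_coeff q 0 = 1"
| "euler_coeff q (Suc n) = euler_coeff q n * (1 / q) ^ n / (1 - (1 / q) ^ Suc n)"

text \<open>Euler's series for the product of the factors \<open>1 + z / q ^ n\<close>.\<close>

definition euler_fun :: "complex \<Rightarrow> complex \<Rightarrow> complex" where
  "euler_fun q z = (\<Sum>n. euler_coeff q n * z ^ n)"

text \<open>The product side of the Jacobi triple product without its constant factor, the product
  of all 1 - q^(-n) with n \<ge> 1. The estimates are only up to constants, so that factor is never
  computed.\<close>

definition jacobi_prod :: "complex \<Rightarrow> complex \<Rightarrow> complex" where
  "jacobi_prod q z = euler_fun q z * euler_fun q (1 / (q * z))"

lemma eventually_analytic_nhds:
  assumes "f analytic_on {z}"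
  shows "\<forall>\<^sub>F w in nhds z. f analytic_on {w}"
proof -
  obtain S where "open S" "z \<in> S" "f holomorphic_on S"
    using assms analytic_at by blast
  then show ?thesis
    using eventually_nhds_in_open[of S z] by (auto elim!: eventually_mono intro: holomorphic_on_imp_analytic_at)
qed

text \<open>By l'Hopital's rule the quotient has a finite limit at the simple zero of
  \<open>g\<close>, so the singularity is removable.\<close>

lemma remove_sings_quotient_simple_zero:
  assumes "f analytic_on {z}" "g analytic_on {z}" "f z = 0" "g z = 0" "deriv g z \<noteq> 0"
  shows "remove_sings (\<lambda>w. f w / g w) analytic_on {z}"
    and "isolated_singularity_at (\<lambda>w. f w / g w) z"
proof -
  have df: "(f has_field_derivative deriv f z) (at z)" and dg: "(g has_field_derivative deriv g z) (at z)"
    using assms(1,2) analytic_derivI by auto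
  have "((\<lambda>w. (g w - g z) / (w - z)) \<longlongrightarrow> deriv g z) (at z)"
    using dg by (simp add: has_field_derivative_iff)
  then have "\<forall>\<^sub>F w in at z. (g w - g z) / (w - z) \<noteq> 0"
    using assms(5) by (rule tendsto_imp_eventually_ne)
  then have nz: "\<forall>\<^sub>F w in at z. g w \<noteq> 0"
    by eventually_elim (use assms(4) in auto)
  have "\<forall>\<^sub>F w in nhds z. f analytic_on {w}" "\<forall>\<^sub>F w in nhds z. g analytic_on {w}"
    using assms(1,2) eventually_analytic_nhds by blast+
  then have an: "\<forall>\<^sub>F w in at z. f analytic_on {w} \<and> g analytic_on {w}"
    unfolding eventually_at_filter by eventually_elim auto
  have "\<forall>\<^sub>F w in at z. (\<lambda>w. f w / g w) analytic_on {w}"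
    using nz an by eventually_elim (auto intro!: analytic_intros)
  then show iso: "isolated_singularity_at (\<lambda>w. f w / g w) z"
    by (simp add: isolated_singularity_at_altdef)
  show "remove_sings (\<lambda>w. f w / g w) analytic_on {z}"
    by (rule remove_sings_analytic_at[OF iso lhopital_complex_simple[OF df dg assms(3-5) refl]])
qed

section \<open>Zeros of the Euler and Jacobi products, and uniqueness in the functional equation of
  theta\<close>

locale q_theta =
  fixes q :: complex
  assumes q_gt_1: "1 < norm q"
begin

abbreviation "p \<equiv> norm q"

lemma q_nz [simp]: "q \<noteq> 0"
  using q_gt_1 by auto

lemma p_pos [simp]: "0 < p"
  by simp

lemma inv_q_lt_1: "norm (1 / q) < 1"
  using q_gt_1 by (simp add: norm_divide divide_less_eq)

lemma one_minus_inv_q_power: "1 - (1 / q) ^ Suc n \<noteq> 0"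
proof
  assume "1 - (1 / q) ^ Suc n = 0"
  then have "norm ((1 / q) ^ Suc n) = 1" by simp
  moreover have "norm ((1 / q) ^ Suc n) < 1"
    unfolding norm_power using inv_q_lt_1 by (intro power_Suc_less_one) auto
  ultimately show False by simp
qed

lemma euler_summable: "summable (\<lambda>n. norm (euler_coeff q n * z ^ n))"
proof (rule summable_power_series_ratio)
  fix n
  have "1 - norm (1 / q) \<le> 1 - norm ((1 / q) ^ Suc n)"
    using inv_q_lt_1 power_decreasing[of 1 "Suc n" "norm (1 / q)"] unfolding norm_power by simp
  also have "\<dots> \<le> norm (1 - (1 / q) ^ Suc n)"
    by (metis norm_one norm_triangle_ineq2)
  finally have *: "1 - norm (1 / q) \<le> norm (1 - (1 / q) ^ Suc n)" .
  have "norm (euler_coeff q (Suc n)) = norm (1 / q) ^ n * norm (euler_coeff q n) / norm (1 - (1 / q) ^ Suc n)"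
    by (simp add: norm_mult norm_divide norm_power)
  also have "\<dots> \<le> norm (1 / q) ^ n * norm (euler_coeff q n) / (1 - norm (1 / q))"
    using * inv_q_lt_1 one_minus_inv_q_power[of n] by (intro divide_left_mono mult_pos_pos) auto
  finally show "norm (euler_coeff q (Suc n)) \<le> norm (1 / q) ^ n / (1 - norm (1 / q)) * norm (euler_coeff q n)"
    by simp
next
  show "(\<lambda>n. norm (1 / q) ^ n / (1 - norm (1 / q))) \<longlonglongrightarrow> 0"
    using inv_q_lt_1 by (intro tendsto_divide_zero LIMSEQ_realpow_zero) auto
qed

lemma euler_summable': "summable (\<lambda>n. euler_coeff q n * z ^ n)"
  using euler_summable by (rule summable_norm_cancel)

lemma euler_holomorphic: "euler_fun q holomorphic_on A"
  using entire_power_series[OF euler_summable, of A] unfolding euler_fun_def .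

lemma euler_0 [simp]: "euler_fun q 0 = 1"
  by (simp add: euler_fun_def)

lemma euler_scale: "euler_fun q z = (1 + z) * euler_fun q (z / q)"
proof -
  define f where "f n = euler_coeff q n * z ^ n - euler_coeff q n * (z / q) ^ n" for n
  have s: "summable f"
    unfolding f_def by (intro summable_diff euler_summable')
  have "euler_fun q z - euler_fun q (z / q) = suminf f"
    unfolding f_def euler_fun_def by (intro suminf_diff euler_summable')
  also have "\<dots> = (\<Sum>n. f (Suc n))"
    using suminf_split_head[OF s] by (simp add: f_def)
  also have "f (Suc n) = z * (euler_coeff q n * (z / q) ^ n)" for n
  proof -
    have "(z / q) ^ Suc n = (1 / q) ^ Suc n * z ^ Suc n"
      by (simp add: power_divide)
    then have "f (Suc n) = euler_coeff q (Suc n) * (1 - (1 / q) ^ Suc n) * z ^ Suc n"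
      unfolding f_def by (simp only: algebra_simps mult_1_left)
    also have "euler_coeff q (Suc n) * (1 - (1 / q) ^ Suc n) = euler_coeff q n * (1 / q) ^ n"
      using one_minus_inv_q_power[of n] by simp
    finally show ?thesis by (simp add: power_divide)
  qed
  then have "(\<Sum>n. f (Suc n)) = z * euler_fun q (z / q)"
    unfolding euler_fun_def using suminf_mult[OF euler_summable'] by simp
  finally show ?thesis by (simp add: algebra_simps)
qed

lemma euler_iterate: "euler_fun q z = (\<Prod>k<n. 1 + z / q ^ k) * euler_fun q (z / q ^ n)"
proof (induction n)
  case (Suc n)
  show ?case
    using Suc euler_scale[of "z / q ^ n"] by (simp add: field_simps)
qed simp

text \<open>The functional equation moves the argument to z/q^n, close to 0, where the function is
  close to 1. Hence every zero comes from one of the finitely many factors split off.\<close>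

lemma euler_eq_0_iff: "euler_fun q z = 0 \<longleftrightarrow> (\<exists>n. z = - (q ^ n))"
proof
  assume 0: "euler_fun q z = 0"
  have "isCont (euler_fun q) 0"
    using euler_holomorphic[of UNIV] continuous_on_eq_continuous_at holomorphic_on_imp_continuous_on open_UNIV by blast
  moreover have "(\<lambda>n. z * (1 / q) ^ n) \<longlonglongrightarrow> z * 0"
    by (intro tendsto_intros LIMSEQ_power_zero inv_q_lt_1)
  then have "(\<lambda>n. z / q ^ n) \<longlonglongrightarrow> 0"
    by (simp add: power_divide)
  ultimately have "(\<lambda>n. euler_fun q (z / q ^ n)) \<longlonglongrightarrow> euler_fun q 0"
    by (rule isCont_tendsto_compose)
  then have "\<forall>\<^sub>F n in sequentially. euler_fun q (z / q ^ n) \<noteq> 0"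
    by (rule tendsto_imp_eventually_ne) simp
  then obtain n where "euler_fun q (z / q ^ n) \<noteq> 0"
    by (auto simp: eventually_sequentially)
  with 0 euler_iterate[of z n] obtain k where "1 + z / q ^ k = 0"
    by auto
  then have "z = - (q ^ k)" by (simp add: field_simps add_eq_0_iff2)
  then show "\<exists>n. z = - (q ^ n)" ..
next
  assume "\<exists>n. z = - (q ^ n)"
  then obtain n where "z = - (q ^ n)" ..
  then show "euler_fun q z = 0"
    using euler_iterate[of z "Suc n"] by simp
qed

lemma euler_minus_inv_nz: "euler_fun q (- 1 / q) \<noteq> 0"
proof
  assume "euler_fun q (- 1 / q) = 0"
  then obtain n where "- 1 / q = - (q ^ n)" using euler_eq_0_iff by auto
  then have "q ^ Suc n = 1" by (simp add: field_simps)
  then have "p ^ Suc n = 1" by (metis norm_one norm_power)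
  moreover have "p ^ Suc n > 1" using q_gt_1 by (intro one_less_power) auto
  ultimately show False by simp
qed

lemma jacobi_holomorphic: "jacobi_prod q holomorphic_on - {0}"
proof -
  have "(euler_fun q \<circ> (\<lambda>z. 1 / (q * z))) holomorphic_on - {0}"
    by (intro holomorphic_on_compose euler_holomorphic holomorphic_intros) auto
  then show ?thesis
    unfolding jacobi_prod_def by (intro holomorphic_intros euler_holomorphic) (auto simp: o_def)
qed

text \<open>The first Euler factor contributes the exponents n \<ge> 0, the second one the exponents
  n \<le> -1.\<close>

lemma jacobi_eq_0_iff:
  assumes "z \<noteq> 0"
  shows "jacobi_prod q z = 0 \<longleftrightarrow> (\<exists>n::int. z = - (q powi n))"
proof -
  have "1 / (q * z) = - (q ^ n) \<longleftrightarrow> z = - (q powi (- int (Suc n)))" for n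
  proof -
    have *: "q powi (- int (Suc n)) = 1 / q ^ Suc n"
      by (simp only: power_int_minus power_int_of_nat inverse_eq_divide)
    show ?thesis unfolding * using assms by (auto simp: field_simps eq_neg_iff_add_eq_0)
  qed
  then have "jacobi_prod q z = 0 \<longleftrightarrow> (\<exists>n. z = - (q powi int n)) \<or> (\<exists>n. z = - (q powi (- int (Suc n))))"
    unfolding jacobi_prod_def by (simp add: euler_eq_0_iff)
  also have "\<dots> \<longleftrightarrow> (\<exists>n::int. z = - (q powi n))"
    by (metis int_cases2 int_cases)
  finally show ?thesis .
qed

lemma jacobi_scale:
  assumes "z \<noteq> 0"
  shows "jacobi_prod q (q * z) = q * z * jacobi_prod q z"
proof -
  have 1: "euler_fun q (q * z) = (1 + q * z) * euler_fun q z"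
    using euler_scale[of "q * z"] by simp
  have 2: "euler_fun q (1 / (q * z)) = (1 + 1 / (q * z)) * euler_fun q (1 / (q * (q * z)))"
    using euler_scale[of "1 / (q * z)"] by (simp add: mult_ac)
  have h: "1 + q * z = q * z * (1 + 1 / (q * z))"
    using assms by (simp add: field_simps)
  show ?thesis
    unfolding jacobi_prod_def 1 2 h by (simp only: mult_ac)
qed

text \<open>Every orbit under multiplication by \<open>q\<close> meets a fixed compact annulus; this
  reduces statements compatible with the functional equation to compactness. The exponent is minus
  the integer part of the logarithm of |z| to base \<open>p\<close>.\<close>

lemma annulus_reduce:
  assumes "z \<noteq> 0"
  obtains n :: int where "1 \<le> norm (q powi n * z)" "norm (q powi n * z) \<le> p"
proof
  define t where "t = ln (norm z) / ln p"
  have lp: "ln p > 0" using q_gt_1 by simp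
  have z: "norm z = p powr t"
    using assms lp unfolding t_def powr_def by simp
  have *: "norm (q powi (- \<lfloor>t\<rfloor>) * z) = p powr (t - \<lfloor>t\<rfloor>)"
    unfolding norm_mult norm_power_int z
    by (simp add: powr_real_of_int' [symmetric] powr_add[symmetric])
  show "1 \<le> norm (q powi (- \<lfloor>t\<rfloor>) * z)"
    unfolding * using q_gt_1 by (intro ge_one_powr_ge_zero) auto
  have "p powr (t - \<lfloor>t\<rfloor>) \<le> p powr 1"
    using q_gt_1 by (intro powr_mono) linarith+
  then show "norm (q powi (- \<lfloor>t\<rfloor>) * z) \<le> p"
    unfolding * by simp
qed

lemma scale_invariant_powi:
  assumes "\<And>z. z \<noteq> 0 \<Longrightarrow> g (q * z) = g z" "z \<noteq> 0"
  shows "g (q powi n * z) = g z"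
proof (induction n rule: int_induct[where k = 0])
  case (step1 i)
  have "g (q powi (i + 1) * z) = g (q * (q powi i * z))"
    by (simp add: power_int_add mult_ac)
  also have "\<dots> = g z"
    using assms step1 by simp
  finally show ?case .
next
  case (step2 i)
  have "g (q powi i * z) = g (q * (q powi (i - 1) * z))"
    by (simp add: power_int_diff)
  also have "\<dots> = g (q powi (i - 1) * z)"
    using assms by simp
  finally show ?case using step2 by simp
qed simp

text \<open>All values are already taken on the compact annulus, so |g| attains its maximum over the
  connected punctured plane, and the maximum modulus principle applies.\<close>

lemma scale_invariant_constant:
  assumes "g holomorphic_on - {0}" "\<And>z. z \<noteq> 0 \<Longrightarrow> g (q * z) = g z"
  shows "g constant_on - {0}"
proof -
  define K where "K = cball 0 p - ball (0::complex) 1"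
  have "compact K"
    unfolding K_def by (intro compact_diff) auto
  moreover have "1 \<in> K" unfolding K_def using q_gt_1 by simp
  moreover have "K \<subseteq> - {0}" unfolding K_def by auto
  then have "continuous_on K (\<lambda>z. norm (g z))"
    using assms(1) by (intro continuous_on_norm holomorphic_on_imp_continuous_on) (rule holomorphic_on_subset)
  ultimately obtain z0 where z0: "z0 \<in> K" "\<And>z. z \<in> K \<Longrightarrow> norm (g z) \<le> norm (g z0)"
    using continuous_attains_sup[of K] by blast
  have "norm (g z) \<le> norm (g z0)" if z: "z \<noteq> 0" for z
  proof -
    obtain n where "1 \<le> norm (q powi n * z)" "norm (q powi n * z) \<le> p"
      using annulus_reduce[OF z] .
    then have "q powi n * z \<in> K" unfolding K_def by auto
    then show ?thesis
      using z0(2) scale_invariant_powi[of g z n, OF assms(2) z] by metis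
  qed
  then show ?thesis
    using assms(1) z0(1) \<open>K \<subseteq> - {0}\<close>
    by (intro maximum_modulus_principle[where U = "- {0}" and \<xi> = z0])
       (auto intro: connected_punctured_universe)
qed

lemma jacobi_scale_powi:
  assumes "z \<noteq> 0" "\<And>w. w \<noteq> 0 \<Longrightarrow> f (q * w) = q * w * f w"
  shows "f (q powi n * z) = 0 \<longleftrightarrow> f z = 0"
  using scale_invariant_powi[of "\<lambda>z. f z = 0" z n] assms by simp

text \<open>Differentiating the functional equation shows that a common zero of the function and its
  derivative propagates along the spiral. So only -1 has to be examined, where the factor 1 + z
  splits off and leaves a nonzero cofactor.\<close>

lemma jacobi_deriv_nz:
  assumes "z \<noteq> 0" "jacobi_prod q z = 0"
  shows "deriv (jacobi_prod q) z \<noteq> 0"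
proof -
  define f where "f = jacobi_prod q"
  have df: "(f has_field_derivative deriv f z) (at z)" if "z \<noteq> 0" for z
    using jacobi_holomorphic that holomorphic_derivI[of f "- {0}" z] unfolding f_def by auto
  have scale: "q * deriv f (q * z) = q * f z + q * z * deriv f z" if "z \<noteq> 0" for z
  proof -
    have "((\<lambda>z. f (q * z)) has_field_derivative deriv f (q * z) * q) (at z)"
      using that by (intro DERIV_chain2[OF df] derivative_eq_intros) auto
    moreover have "((\<lambda>z. q * z * f z) has_field_derivative (q * f z + q * z * deriv f z)) (at z)"
      using that by (auto intro!: derivative_eq_intros df)
    moreover have "\<forall>\<^sub>F w in nhds z. f (q * w) = q * w * f w"
      using t1_space_nhds[OF that] unfolding f_def by eventually_elim (rule jacobi_scale)
    then have "((\<lambda>z. f (q * z)) has_field_derivative (q * f z + q * z * deriv f z)) (at z)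
        \<longleftrightarrow> ((\<lambda>z. q * z * f z) has_field_derivative (q * f z + q * z * deriv f z)) (at z)"
      by (intro DERIV_cong_ev) auto
    ultimately show ?thesis
      using DERIV_unique by (metis mult.commute)
  qed
  have inv: "(f (q * z) = 0 \<and> deriv f (q * z) = 0) = (f z = 0 \<and> deriv f z = 0)" if "z \<noteq> 0" for z
    using scale[OF that] jacobi_scale[OF that] that unfolding f_def by auto
  have base: "deriv f (- 1) \<noteq> 0"
  proof -
    define R where "R = (\<lambda>z. euler_fun q (z / q) * euler_fun q (1 / (q * z)))"
    have R: "R (- 1) \<noteq> 0" unfolding R_def using euler_minus_inv_nz by simp
    have "(euler_fun q \<circ> (\<lambda>z. z / q)) holomorphic_on - {0}" "(euler_fun q \<circ> (\<lambda>z. 1 / (q * z))) holomorphic_on - {0}"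
      by (intro holomorphic_on_compose euler_holomorphic holomorphic_intros; auto)+
    then have "R holomorphic_on - {0}"
      unfolding R_def by (intro holomorphic_intros) (auto simp: o_def)
    then have dR: "(R has_field_derivative deriv R (-1)) (at (-1))"
      using holomorphic_derivI[of R "- {0}" "-1"] by auto
    have "f = (\<lambda>z. (1 + z) * R z)"
      unfolding f_def R_def jacobi_prod_def fun_eq_iff
      by (intro allI, subst euler_scale) (simp only: mult.assoc)
    moreover have "((\<lambda>z. (1 + z) * R z) has_field_derivative R (- 1)) (at (- 1))"
      by (auto intro!: derivative_eq_intros dR)
    ultimately show ?thesis
      using R DERIV_imp_deriv by metis
  qed
  obtain n where n: "z = q powi n * (- 1)"
    using assms jacobi_eq_0_iff by auto
  show ?thesis
    using scale_invariant_powi[of "\<lambda>z. f z = 0 \<and> deriv f z = 0" "- 1" n, OF inv] base assms(2)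
    unfolding n f_def by simp
qed

lemma jacobi_eventually_nz:
  assumes "z \<noteq> 0"
  shows "\<forall>\<^sub>F w in at z. jacobi_prod q w \<noteq> 0"
proof (cases "jacobi_prod q z = 0")
  case True
  have "((\<lambda>w. (jacobi_prod q w - jacobi_prod q z) / (w - z)) \<longlongrightarrow> deriv (jacobi_prod q) z) (at z)"
    using holomorphic_derivI[OF jacobi_holomorphic, of z] assms by (simp add: has_field_derivative_iff open_Compl)
  then have "\<forall>\<^sub>F w in at z. (jacobi_prod q w - jacobi_prod q z) / (w - z) \<noteq> 0"
    using jacobi_deriv_nz[OF assms True] by (rule tendsto_imp_eventually_ne)
  then show ?thesis
    by eventually_elim (use True in auto)
next
  case False
  have "isCont (jacobi_prod q) z"
    using jacobi_holomorphic assms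
    by (intro analytic_at_imp_isCont holomorphic_on_imp_analytic_at[of _ "- {0}"]) auto
  then show ?thesis
    using False unfolding isCont_def by (intro tendsto_imp_eventually_ne) auto
qed

text \<open>The quotient of the two sides extends to a \<open>q\<close>-periodic function on the punctured plane.\<close>

lemma proportional_jacobi:
  assumes "f holomorphic_on - {0}" "\<And>z. z \<noteq> 0 \<Longrightarrow> f (q * z) = q * z * f z" "f (- 1) = 0"
  shows "\<exists>c. \<forall>z. z \<noteq> 0 \<longrightarrow> f z = c * jacobi_prod q z"
proof -
  define g where "g = remove_sings (\<lambda>w. f w / jacobi_prod q w)"
  have an: "f analytic_on {z}" "jacobi_prod q analytic_on {z}" if "z \<noteq> 0" for z
    using assms(1) jacobi_holomorphic that holomorphic_on_imp_analytic_at[of _ "- {0}"] by auto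
  have f0: "f z = 0" if "z \<noteq> 0" "jacobi_prod q z = 0" for z
  proof -
    obtain n where "z = - (q powi n)" using jacobi_eq_0_iff[of z] \<open>z \<noteq> 0\<close> \<open>jacobi_prod q z = 0\<close> by blast
    then have "z = q powi n * (- 1)" by simp
    then show ?thesis using jacobi_scale_powi[of "-1" f n] assms by simp
  qed
  have g_an: "g analytic_on {z}" if "z \<noteq> 0" for z
  proof (cases "jacobi_prod q z = 0")
    case True
    then show ?thesis unfolding g_def
      by (intro remove_sings_quotient_simple_zero an jacobi_deriv_nz f0 that)
  next
    case False
    then show ?thesis unfolding g_def
      by (intro remove_sings_analytic_on analytic_intros an that) auto
  qed
  then have "g analytic_on - {0}"
    using analytic_on_analytic_at by blast
  then have g_hol: "g holomorphic_on - {0}"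
    by (rule analytic_imp_holomorphic)
  have g_eq: "f z = g z * jacobi_prod q z" if "z \<noteq> 0" for z
  proof (cases "jacobi_prod q z = 0")
    case False
    then have "(\<lambda>w. f w / jacobi_prod q w) analytic_on {z}"
      by (intro analytic_intros an that) auto
    then show ?thesis unfolding g_def using False by simp
  qed (use f0 that in auto)
  have "g (q * z) = g z" if "z \<noteq> 0" for z
  proof -
    \<comment> \<open>At a zero of the product the quotient says nothing directly; there the
      periodicity of \<open>g\<close> follows by continuity from the nearby points, where
      cancellation is allowed.\<close>
    have *: "g (q * w) = g w" if "w \<noteq> 0" "jacobi_prod q w \<noteq> 0" for w
      using g_eq[of w] g_eq[of "q * w"] assms(2)[of w] jacobi_scale[of w] that by auto
    have "\<forall>\<^sub>F w in at z. jacobi_prod q w \<noteq> 0"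
      using that by (rule jacobi_eventually_nz)
    moreover have "\<forall>\<^sub>F w in at z. w \<noteq> 0"
      using that by (intro eventually_neq_at_within)
    ultimately have ev: "\<forall>\<^sub>F w in at z. g (q * w) = g w"
      by eventually_elim (rule *)
    have "isCont (g \<circ> (\<lambda>w. q * w)) z"
      using g_an[of "q * z"] that by (intro continuous_intros analytic_at_imp_isCont) auto
    then have "(\<lambda>w. g (q * w)) \<midarrow>z\<rightarrow> g (q * z)"
      by (simp add: isCont_def o_def)
    then have "g \<midarrow>z\<rightarrow> g (q * z)"
      using Lim_transform_eventually ev by blast
    moreover have "g \<midarrow>z\<rightarrow> g z"
      using g_an[OF that] analytic_at_imp_isCont isCont_def by blast
    ultimately show ?thesis
      using LIM_unique by blast
  qed
  then have "g constant_on - {0}"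
    using g_hol by (intro scale_invariant_constant)
  then obtain c where "\<forall>z\<in>- {0}. g z = c"
    unfolding constant_on_def by blast
  then show ?thesis using g_eq by auto
qed

lemma theta_eq_jacobi: "\<exists>c. c \<noteq> 0 \<and> (\<forall>z. z \<noteq> 0 \<longrightarrow> theta q z = c * jacobi_prod q z)"
proof -
  obtain c where c: "\<And>z. z \<noteq> 0 \<Longrightarrow> theta q z = c * jacobi_prod q z"
    using proportional_jacobi[OF theta_holomorphic[OF q_gt_1] theta_scale theta_minus_one] by auto
  moreover have "c \<noteq> 0"
    using theta_nonzero_somewhere[OF q_gt_1] c by auto
  ultimately show ?thesis by blast
qed

end

subsection \<open>Distance to a divisor and size of theta functions\<close>

lemma dist_spiral_nonneg: "0 \<le> dist_spiral z (spiral q l)"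
  unfolding dist_spiral_def by (intro cINF_greatest) (auto simp: spiral_def)

lemma dist_spiral_le: "\<xi> \<in> s \<Longrightarrow> dist_spiral z s \<le> norm (1 - z / \<xi>)"
  unfolding dist_spiral_def by (intro cINF_lower bdd_belowI2[of _ 0]) auto

lemma spiral_zero: "x \<in> spiral q l \<Longrightarrow> q \<noteq> 0 \<Longrightarrow> l \<noteq> 0 \<Longrightarrow> x \<noteq> 0"
  by (auto simp: spiral_def)

context q_theta
begin

lemma spiral_eq:
  assumes "x \<in> spiral q l"
  shows "spiral q x = spiral q l"
proof -
  obtain m where x: "x = l * q powi m"
    using assms by (auto simp: spiral_def)
  have b: "bij (\<lambda>n::int. n + m)"
    by (rule bij_betwI[where g = "\<lambda>n. n - m"]) auto
  have "spiral q x = (\<lambda>n. l * q powi n) ` range (\<lambda>n. n + m)"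
    unfolding spiral_def x image_image by (simp add: power_int_add mult_ac)
  also have "range (\<lambda>n. n + m) = UNIV"
    using b by (simp add: bij_is_surj)
  finally show ?thesis by (simp add: spiral_def)
qed

lemma dist_spiral_altdef: "dist_spiral z (spiral q l) = (INF n::int. norm (1 - z / (l * q powi n)))"
  unfolding dist_spiral_def spiral_def image_image ..

lemma dist_spiral_unit: "dist_spiral z (spiral q l) = dist_spiral (z / l) (spiral q 1)"
  unfolding dist_spiral_altdef by simp

lemma dist_spiral_scale:
  "dist_spiral (q * z) (spiral q l) = dist_spiral z (spiral q l)"
proof -
  have "norm (1 - (q * z) / (l * q powi (n + 1))) = norm (1 - z / (l * q powi n))" for n
    by (simp add: power_int_add mult_ac)
  moreover have "bij (\<lambda>n::int. n + 1)"
    by (rule bij_betwI[where g = "\<lambda>n. n - 1"]) auto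
  then have "range (\<lambda>n::int. n + 1) = UNIV"
    by (simp add: bij_is_surj)
  then have "dist_spiral (q * z) (spiral q l) = (INF n::int. norm (1 - (q * z) / (l * q powi (n + 1))))"
    unfolding dist_spiral_altdef by (metis (no_types, lifting) image_cong image_image)
  ultimately show ?thesis unfolding dist_spiral_altdef by simp
qed

text \<open>Along the points \<open>l * q ^ n\<close> with \<open>n\<close> tending to infinity the
  distance tends to 1.\<close>

lemma dist_spiral_le_1: "dist_spiral z (spiral q l) \<le> 1"
proof (rule tendsto_lowerbound[of _ _ sequentially])
  have "(\<lambda>n. norm (1 - z / l * (1 / q) ^ n)) \<longlonglongrightarrow> norm (1 - z / l * 0)"
    by (intro tendsto_intros LIMSEQ_power_zero inv_q_lt_1)
  then show "(\<lambda>n. norm (1 - z / l * (1 / q) ^ n)) \<longlonglongrightarrow> 1" by simp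
  show "\<forall>\<^sub>F n in sequentially. dist_spiral z (spiral q l) \<le> norm (1 - z / l * (1 / q) ^ n)"
  proof (intro always_eventually allI)
    fix n
    have "l * q powi int n \<in> spiral q l" unfolding spiral_def by blast
    from dist_spiral_le[OF this, of z]
    show "dist_spiral z (spiral q l) \<le> norm (1 - z / l * (1 / q) ^ n)"
      by (simp add: power_divide)
  qed
qed simp

text \<open>The Gaussian \<open>gauss\<close> satisfies the functional equation of \<open>norm \<circ> theta q\<close> and of \<open>e_fun q\<close>.\<close>

definition gauss :: "complex \<Rightarrow> real" where
  "gauss z = sqrt (norm z) * exp ((ln (norm z))\<^sup>2 / (2 * ln p))"

lemma ln_p_pos: "0 < ln p"
  using q_gt_1 by simp

lemma gauss_pos: "z \<noteq> 0 \<Longrightarrow> 0 < gauss z"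
  by (simp add: gauss_def)

text \<open>The cross term in the square of ln |w| + ln |z| is a power of |z|. This is why the scale
  \<mu> in \<open>e_fun\<close> and the choice of a representative of a spiral change bounds only by
  a constant and a power of |z|.\<close>

lemma gauss_mult:
  assumes "z \<noteq> 0" "w \<noteq> 0"
  shows "gauss (w * z) = gauss w * norm z powr (ln (norm w) / ln p) * gauss z"
proof -
  have "(ln (norm (w * z)))\<^sup>2 / (2 * ln p) =
      (ln (norm w))\<^sup>2 / (2 * ln p) + ln (norm z) * (ln (norm w) / ln p) + (ln (norm z))\<^sup>2 / (2 * ln p)"
    using assms ln_p_pos by (simp add: norm_mult ln_mult power2_sum field_simps)
  then show ?thesis
    using assms unfolding gauss_def
    by (simp add: exp_add real_sqrt_mult norm_mult powr_def mult_ac)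
qed

lemma gauss_scale: "z \<noteq> 0 \<Longrightarrow> gauss (q * z) = p * norm z * gauss z"
proof -
  assume "z \<noteq> 0"
  have "gauss q = exp (ln p / 2) * exp (ln p / 2)"
    using ln_p_pos by (simp add: gauss_def power2_eq_square sqrt_def root_powr_inverse powr_def)
  also have "\<dots> = p" by (simp add: exp_add[symmetric])
  finally show ?thesis
    using gauss_mult[OF \<open>z \<noteq> 0\<close> q_nz] \<open>z \<noteq> 0\<close> ln_p_pos by simp
qed

definition annulus :: "complex set" where
  "annulus = cball 0 p - ball 0 1"

lemma annulus_iff: "z \<in> annulus \<longleftrightarrow> 1 \<le> norm z \<and> norm z \<le> p"
  by (auto simp: annulus_def)

lemma compact_annulus: "compact annulus"
  unfolding annulus_def by (intro compact_diff) auto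

lemma annulus_nonempty: "1 \<in> annulus"
  using q_gt_1 by (simp add: annulus_iff)

lemma continuous_bounds_annulus:
  fixes f :: "complex \<Rightarrow> real"
  assumes "continuous_on annulus f" "\<And>z. z \<in> annulus \<Longrightarrow> 0 < f z"
  obtains c C where "0 < c" "0 < C" "\<And>z. z \<in> annulus \<Longrightarrow> c \<le> f z \<and> f z \<le> C"
proof -
  have "annulus \<noteq> {}" using annulus_nonempty by blast
  obtain x where "x \<in> annulus" "\<And>y. y \<in> annulus \<Longrightarrow> f y \<le> f x"
    using continuous_attains_sup[OF compact_annulus \<open>annulus \<noteq> {}\<close> assms(1)] by blast
  moreover obtain x' where "x' \<in> annulus" "\<And>y. y \<in> annulus \<Longrightarrow> f x' \<le> f y"
    using continuous_attains_inf[OF compact_annulus \<open>annulus \<noteq> {}\<close> assms(1)] by blast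
  ultimately show ?thesis using assms(2) by (intro that[of "f x'" "f x"]) auto
qed

lemma gauss_continuous: "continuous_on (- {0}) gauss"
  unfolding gauss_def using ln_p_pos by (intro continuous_intros) auto

lemma compare_by_scale:
  fixes f g :: "complex \<Rightarrow> real"
  assumes "\<And>z. z \<noteq> 0 \<Longrightarrow> f (q * z) = p * norm z * f z"
    and "\<And>z. z \<noteq> 0 \<Longrightarrow> g (q * z) = p * norm z * g z"
    and "\<And>z. z \<in> annulus \<Longrightarrow> f z \<le> g z" and "z \<noteq> 0"
  shows "f z \<le> g z"
proof -
  obtain n where "1 \<le> norm (q powi n * z)" "norm (q powi n * z) \<le> p"
    using annulus_reduce[OF \<open>z \<noteq> 0\<close>] .
  then have "f (q powi n * z) \<le> g (q powi n * z)"
    using assms(3) by (simp add: annulus_iff)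
  moreover have "(f (q powi n * z) \<le> g (q powi n * z)) = (f z \<le> g z)"
    by (rule scale_invariant_powi[of "\<lambda>z. f z \<le> g z", OF _ \<open>z \<noteq> 0\<close>])
       (simp add: assms(1,2) mult_le_cancel_left_pos)
  ultimately show ?thesis by simp
qed

text \<open>Only the spiral points 1 and \<open>q\<close> can be close to the annulus: for n \<ge> 2
  one has |x/q^n| \<le> 1/p, for n \<le> -1 one has |x/q^n| \<ge> p, and both keep the distance at
  least 1 - 1/p.\<close>

lemma dist_spiral_annulus:
  assumes "x \<in> annulus"
  shows "min (min (norm (1 - x)) (norm (1 - x / q))) (1 - 1 / p) \<le> dist_spiral x (spiral q 1)"
  unfolding dist_spiral_altdef
proof (rule cINF_greatest)
  fix n :: int
  have x: "1 \<le> norm x" "norm x \<le> p" using assms by (auto simp: annulus_iff)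
  have 1: "1 / p < 1" using q_gt_1 by simp
  consider "n = 0" | "n = 1" | "n \<ge> 2" | "n \<le> - 1" by linarith
  then show "min (min (norm (1 - x)) (norm (1 - x / q))) (1 - 1 / p) \<le> norm (1 - x / (1 * q powi n))"
  proof cases
    case 3
    have "p powi 2 \<le> p powi n"
      using 3 q_gt_1 by (intro power_int_increasing) auto
    then have "norm x / p powi n \<le> p / p powi 2"
      using x by (intro frac_le) auto
    also have "\<dots> = 1 / p" by (simp add: power2_eq_square)
    finally have "1 - 1 / p \<le> 1 - norm (x / (1 * q powi n))"
      by (simp add: norm_divide norm_power_int)
    also have "\<dots> \<le> norm (1 - x / (1 * q powi n))"
      by (metis norm_one norm_triangle_ineq2)
    finally show ?thesis by simp
  next
    case 4
    have "p powi n \<le> p powi (- 1)"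
      using 4 q_gt_1 by (intro power_int_increasing) auto
    then have "1 / (1 / p) \<le> norm x / p powi n"
      using x by (intro frac_le) (auto simp: power_int_minus field_simps)
    then have "p - 1 \<le> norm (x / (1 * q powi n)) - 1"
      by (simp add: norm_divide norm_power_int)
    also have "\<dots> \<le> norm (1 - x / (1 * q powi n))"
      by (metis norm_one norm_triangle_ineq3 abs_le_D1 norm_minus_commute)
    finally have "p - 1 \<le> norm (1 - x / (1 * q powi n))" .
    moreover have "1 - 1 / p \<le> p - 1"
      using q_gt_1 1 mult_right_mono[of 1 p "p - 1"] by (simp add: field_simps)
    ultimately show ?thesis by linarith
  qed auto
qed auto

text \<open>The zeros of \<open>theta q (- x)\<close> in the annulus are 1 and \<open>q\<close>.
  Splitting off both linear factors from the first Euler product leaves a function \<open>V\<close>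
  bounded above and away from 0, so the product of the two linear factors remains to be compared
  with the distance.\<close>

lemma theta_bounds_annulus:
  obtains c C where "0 < c" "0 < C"
    "\<And>x. x \<in> annulus \<Longrightarrow> c * dist_spiral x (spiral q 1) \<le> norm (theta q (- x)) \<and>
        norm (theta q (- x)) \<le> C * dist_spiral x (spiral q 1)"
proof -
  obtain c0 where c0: "c0 \<noteq> 0" "\<And>z. z \<noteq> 0 \<Longrightarrow> theta q z = c0 * jacobi_prod q z"
    using theta_eq_jacobi by blast
  define V where "V = (\<lambda>x. c0 * (euler_fun q (- x / q\<^sup>2) * euler_fun q (- 1 / (q * x))))"
  have theta: "theta q (- x) = (1 - x) * (1 - x / q) * V x" if "x \<noteq> 0" for x
  proof -
    have "euler_fun q (- x) = (1 - x) * ((1 - x / q) * euler_fun q (- x / q\<^sup>2))"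
      using euler_scale[of "- x"] euler_scale[of "- x / q"] by (simp add: power2_eq_square)
    then show ?thesis
      using c0(2)[of "- x"] that by (simp add: jacobi_prod_def V_def)
  qed
  have V_cont: "continuous_on annulus (\<lambda>x. norm (V x))"
  proof -
    have "(euler_fun q \<circ> (\<lambda>x. - x / q\<^sup>2)) holomorphic_on - {0}" "(euler_fun q \<circ> (\<lambda>x. - 1 / (q * x))) holomorphic_on - {0}"
      by (intro holomorphic_on_compose euler_holomorphic holomorphic_intros; auto)+
    then have "V holomorphic_on - {0}"
      unfolding V_def by (intro holomorphic_intros) (auto simp: o_def)
    then have "continuous_on annulus V"
      by (rule continuous_on_subset[OF holomorphic_on_imp_continuous_on]) (auto simp: annulus_iff)
    then show ?thesis by (intro continuous_intros)
  qed
  \<comment> \<open>The zeros of the two remaining Euler factors have modulus at least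
    \<open>p\<^sup>2\<close> and at most 1/p respectively, outside the annulus.\<close>
  have V_nz: "norm (V x) > 0" if "x \<in> annulus" for x
  proof -
    have x: "1 \<le> norm x" "norm x \<le> p" using that by (auto simp: annulus_iff)
    have pn: "p ^ n \<ge> 1" for n using q_gt_1 by simp
    have "euler_fun q (- x / q\<^sup>2) \<noteq> 0"
    proof
      assume "euler_fun q (- x / q\<^sup>2) = 0"
      then obtain n where "- x / q\<^sup>2 = - (q ^ n)" using euler_eq_0_iff by auto
      then have "x = q ^ n * q\<^sup>2" by (simp add: field_simps)
      then have "norm x = p ^ n * p\<^sup>2" by (simp add: norm_mult norm_power)
      moreover have "p ^ n * p\<^sup>2 \<ge> 1 * p\<^sup>2" using pn by (intro mult_right_mono) auto
      moreover have "p\<^sup>2 > p" using q_gt_1 by (simp add: power2_eq_square)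
      ultimately show False using x by linarith
    qed
    moreover have "euler_fun q (- 1 / (q * x)) \<noteq> 0"
    proof
      assume "euler_fun q (- 1 / (q * x)) = 0"
      then obtain n where "- 1 / (q * x) = - (q ^ n)" using euler_eq_0_iff by blast
      moreover have "x \<noteq> 0" using x by auto
      ultimately have "1 = q ^ n * (q * x)" by (simp add: field_simps)
      then have "1 = p ^ n * (p * norm x)" by (metis norm_mult norm_one norm_power)
      moreover have "p ^ n * (p * norm x) \<ge> 1 * (p * 1)"
        using pn x by (intro mult_mono) auto
      ultimately show False using q_gt_1 by simp
    qed
    ultimately show ?thesis using c0(1) by (simp add: V_def)
  qed
  obtain v V' where v: "0 < v" "0 < V'" "\<And>z. z \<in> annulus \<Longrightarrow> v \<le> norm (V z) \<and> norm (V z) \<le> V'"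
    using continuous_bounds_annulus[OF V_cont V_nz] by blast
  define \<delta> where "\<delta> = 1 - 1 / p"
  have \<delta>: "0 < \<delta>" "\<delta> < 1" using q_gt_1 by (auto simp: \<delta>_def)
  have "(p - 1) / (2 * p) * v * dist_spiral x (spiral q 1) \<le> norm (theta q (- x)) \<and>
        norm (theta q (- x)) \<le> 2 * (1 + p) / \<delta> * V' * dist_spiral x (spiral q 1)"
    if xa: "x \<in> annulus" for x
  proof -
    have x: "1 \<le> norm x" "norm x \<le> p" "x \<noteq> 0" using xa by (auto simp: annulus_iff)
    define X where "X = norm (1 - x)"
    define Y where "Y = norm (1 - x / q)"
    define d where "d = dist_spiral x (spiral q 1)"
    have "1 * q powi 0 \<in> spiral q 1" "1 * q powi 1 \<in> spiral q 1"
      unfolding spiral_def by blast+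
    then have d1: "d \<le> X" "d \<le> Y"
      unfolding d_def X_def Y_def using dist_spiral_le[of _ "spiral q 1" x] by fastforce+
    have d2: "min (min X Y) \<delta> \<le> d"
      unfolding d_def X_def Y_def \<delta>_def by (rule dist_spiral_annulus[OF xa])
    have d0: "0 \<le> d" unfolding d_def by (rule dist_spiral_nonneg)
    have "X \<le> 1 + p" unfolding X_def using x norm_triangle_ineq4[of 1 x] by simp
    have "norm (x / q) \<le> 1" using x by (simp add: norm_divide divide_le_eq)
    then have "Y \<le> 2" unfolding Y_def using norm_triangle_ineq4[of 1 "x / q"] by simp
    have XY0: "0 \<le> X" "0 \<le> Y" by (auto simp: X_def Y_def)
    \<comment> \<open>The distance is at least the minimum of \<open>X\<close>, \<open>Y\<close> and
      \<delta>, so the product is bounded by a multiple of each of the three.\<close>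
    have up: "X * Y \<le> 2 * (1 + p) / \<delta> * d"
    proof -
      have C1: "2 * (1 + p) \<le> 2 * (1 + p) / \<delta>"
        using \<delta> q_gt_1 by (simp add: le_divide_eq mult_left_le)
      have "X * Y \<le> X * 2" using XY0 \<open>Y \<le> 2\<close> by (intro mult_left_mono) auto
      also have "\<dots> \<le> X * (2 * (1 + p) / \<delta>)"
        using XY0 C1 q_gt_1 by (intro mult_left_mono) auto
      finally have a: "X * Y \<le> 2 * (1 + p) / \<delta> * X" by (simp add: mult_ac)
      have "X * Y \<le> (1 + p) * Y" using XY0 \<open>X \<le> 1 + p\<close> by (intro mult_right_mono) auto
      also have "\<dots> \<le> 2 * (1 + p) / \<delta> * Y"
        using XY0 C1 q_gt_1 by (intro mult_right_mono) auto
      finally have b: "X * Y \<le> 2 * (1 + p) / \<delta> * Y" .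
      have "X * Y \<le> (1 + p) * 2"
        using XY0 \<open>X \<le> 1 + p\<close> \<open>Y \<le> 2\<close> by (intro mult_mono) auto
      also have "\<dots> = 2 * (1 + p) / \<delta> * \<delta>" using \<delta> by simp
      finally have c: "X * Y \<le> 2 * (1 + p) / \<delta> * \<delta>" .
      have "X * Y \<le> 2 * (1 + p) / \<delta> * min (min X Y) \<delta>"
        using a b c by (simp add: min_def)
      also have "\<dots> \<le> 2 * (1 + p) / \<delta> * d"
        using d2 \<delta> q_gt_1 by (intro mult_left_mono) auto
      finally show ?thesis .
    qed
    \<comment> \<open>The points 1 and \<open>q\<close> are at least p - 1 apart, so
      \<open>X\<close> and \<open>Y\<close> cannot both be small. The one bounded below yields the
      constant; the other is at least \<open>d\<close>.\<close>
    have low: "(p - 1) / (2 * p) * d \<le> X * Y"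
    proof -
      have "p - 1 \<le> norm (q - 1)" by (metis norm_one norm_triangle_ineq2)
      also have "q - 1 = q * (1 - x / q) - (1 - x)" by (simp add: algebra_simps)
      also have "norm \<dots> \<le> p * Y + X"
        unfolding X_def Y_def norm_mult[symmetric] by (rule norm_triangle_ineq4)
      finally have "(p - 1) / 2 \<le> X \<or> (p - 1) / 2 \<le> p * Y"
        by (cases "(p - 1) / 2 \<le> X") (auto simp: field_simps)
      moreover have "(p - 1) / (2 * p) \<le> (p - 1) / 2"
        using q_gt_1 by (intro divide_left_mono) auto
      ultimately have "(p - 1) / (2 * p) \<le> X \<or> (p - 1) / (2 * p) \<le> Y"
      proof (elim disjE)
        assume "(p - 1) / 2 \<le> p * Y"
        then have "(p - 1) / (2 * p) \<le> Y" by (simp add: field_simps)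
        then show ?thesis ..
      qed (rule disjI1, linarith)
      then show ?thesis
      proof
        assume "(p - 1) / (2 * p) \<le> X"
        then show ?thesis using d1 d0 XY0 by (intro mult_mono) auto
      next
        assume "(p - 1) / (2 * p) \<le> Y"
        then have "(p - 1) / (2 * p) * d \<le> Y * X" using d1 d0 XY0 by (intro mult_mono) auto
        then show ?thesis by (simp add: mult.commute)
      qed
    qed
    have nt: "norm (theta q (- x)) = X * Y * norm (V x)"
      using theta[OF \<open>x \<noteq> 0\<close>] by (simp add: norm_mult X_def Y_def)
    have "(p - 1) / (2 * p) * d * v \<le> X * Y * norm (V x)"
      using v xa XY0 by (intro mult_mono[OF low]) auto
    moreover have "X * Y * norm (V x) \<le> 2 * (1 + p) / \<delta> * d * V'"
      using v xa XY0 \<delta> d0 q_gt_1 by (intro mult_mono[OF up]) auto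
    ultimately show ?thesis
      unfolding nt d_def by (simp only: mult_ac)
  qed
  then show ?thesis
    using that[of "(p - 1) / (2 * p) * v" "2 * (1 + p) / \<delta> * V'"] v \<delta> q_gt_1 by simp
qed

lemma theta_bounds:
  obtains c C where "0 < c" "0 < C"
    "\<And>x. x \<noteq> 0 \<Longrightarrow> c * dist_spiral x (spiral q 1) * gauss x \<le> norm (theta q (- x)) \<and>
        norm (theta q (- x)) \<le> C * dist_spiral x (spiral q 1) * gauss x"
proof -
  obtain c C where c: "0 < c" "0 < C"
    and b: "\<And>x. x \<in> annulus \<Longrightarrow> c * dist_spiral x (spiral q 1) \<le> norm (theta q (- x)) \<and>
        norm (theta q (- x)) \<le> C * dist_spiral x (spiral q 1)"
    using theta_bounds_annulus by blast
  have "continuous_on annulus gauss" "\<And>z. z \<in> annulus \<Longrightarrow> 0 < gauss z"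
    by (rule continuous_on_subset[OF gauss_continuous]) (auto simp: annulus_iff intro: gauss_pos)
  then obtain g G where g: "0 < g" "0 < G" "\<And>z. z \<in> annulus \<Longrightarrow> g \<le> gauss z \<and> gauss z \<le> G"
    using continuous_bounds_annulus by blast
  have t: "norm (theta q (- (q * z))) = p * norm z * norm (theta q (- z))" if "z \<noteq> 0" for z
    using theta_scale[of q "- z"] that by (simp add: norm_mult)
  have d: "a * dist_spiral (q * z) (spiral q 1) * gauss (q * z) = p * norm z * (a * dist_spiral z (spiral q 1) * gauss z)"
    if "z \<noteq> 0" for z a
    by (simp add: dist_spiral_scale gauss_scale that)
  show ?thesis
  proof (rule that[of "c / G" "C / g"])
    show "0 < c / G" "0 < C / g" using c g by auto
    fix x :: complex assume "x \<noteq> 0"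
    show "c / G * dist_spiral x (spiral q 1) * gauss x \<le> norm (theta q (- x)) \<and>
        norm (theta q (- x)) \<le> C / g * dist_spiral x (spiral q 1) * gauss x"
    proof
      show "c / G * dist_spiral x (spiral q 1) * gauss x \<le> norm (theta q (- x))"
      proof (rule compare_by_scale[OF d t _ \<open>x \<noteq> 0\<close>])
        fix z assume z: "z \<in> annulus"
        have "c / G * dist_spiral z (spiral q 1) * gauss z \<le> c / G * dist_spiral z (spiral q 1) * G"
          using c g z dist_spiral_nonneg by (intro mult_left_mono mult_nonneg_nonneg) auto
        also have "\<dots> \<le> norm (theta q (- z))" using b[OF z] g by simp
        finally show "c / G * dist_spiral z (spiral q 1) * gauss z \<le> norm (theta q (- z))" .
      qed auto
      show "norm (theta q (- x)) \<le> C / g * dist_spiral x (spiral q 1) * gauss x"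
      proof (rule compare_by_scale[OF t d _ \<open>x \<noteq> 0\<close>])
        fix z assume z: "z \<in> annulus"
        have "norm (theta q (- z)) \<le> C / g * dist_spiral z (spiral q 1) * g" using b[OF z] g by simp
        also have "\<dots> \<le> C / g * dist_spiral z (spiral q 1) * gauss z"
          using c g z dist_spiral_nonneg by (intro mult_left_mono mult_nonneg_nonneg) auto
        finally show "norm (theta q (- z)) \<le> C / g * dist_spiral z (spiral q 1) * gauss z" .
      qed auto
    qed
  qed
qed

lemma e_fun_scale:
  assumes "z \<noteq> 0"
  shows "e_fun q (q * z) = p * norm z * e_fun q z"
proof -
  have b: "bij_betw (\<lambda>n::int. n - 1) UNIV UNIV"
    by (rule bij_betwI[where g = "\<lambda>n. n + 1"]) auto
  have "e_fun q (q * z) = infsum (\<lambda>n. p * norm z * theta_term p (norm z) (n - 1)) UNIV"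
    unfolding e_fun_eq_infsum norm_mult using assms by (intro infsum_cong theta_term_scale) auto
  also have "\<dots> = p * norm z * infsum (\<lambda>n. theta_term p (norm z) (n - 1)) UNIV"
    by (rule infsum_cmult_right')
  also have "infsum (\<lambda>n. theta_term p (norm z) (n - 1)) UNIV = e_fun q z"
    unfolding e_fun_eq_infsum by (rule infsum_reindex_bij_betw[OF b])
  finally show ?thesis .
qed

lemma e_fun_bounds:
  obtains c C where "0 < c" "0 < C"
    "\<And>x. x \<noteq> 0 \<Longrightarrow> c * gauss x \<le> e_fun q x \<and> e_fun q x \<le> C * gauss x"
proof -
  define s1 where "s1 y = (\<Sum>n. theta_coeff1 p n * y ^ n)" for y
  define s2 where "s2 y = (\<Sum>n. theta_coeff2 p n * y ^ n)" for y
  have pn: "1 < norm p" using q_gt_1 by simp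
  have sm: "summable (\<lambda>n. theta_coeff1 p n * y ^ n)" "summable (\<lambda>n. theta_coeff2 p n * y ^ n)" for y
    by (rule summable_norm_cancel, rule theta_coeff1_summable theta_coeff2_summable, rule pn)+
  have cn: "0 \<le> theta_coeff1 p n" "0 \<le> theta_coeff2 p n" for n
    by (simp_all add: theta_coeff1_def theta_coeff2_def theta_term_def)
  have hs: "(theta_term p (norm z) has_sum s1 (norm z) + s2 (inverse (norm z)) / norm z) UNIV" if "z \<noteq> 0" for z :: complex
    unfolding s1_def s2_def using theta_term_has_sum[OF pn, of "norm z"] that by simp
  \<comment> \<open>All terms are nonnegative and the term with exponent 0 is 1.\<close>
  have lower: "1 \<le> e_fun q z" if "z \<noteq> 0" for z
  proof -
    have "sum (theta_term p (norm z)) {0} \<le> infsum (theta_term p (norm z)) UNIV"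
      using hs[OF that] by (intro finite_sum_le_infsum) (auto simp: summable_on_def theta_term_def)
    then show ?thesis by (simp add: e_fun_eq_infsum theta_term_def)
  qed
  \<comment> \<open>Both power series have nonnegative coefficients, hence increase; on the annulus
    their arguments |z| and 1/|z| are at most \<open>p\<close> and 1.\<close>
  have upper: "e_fun q z \<le> s1 p + s2 1" if "z \<in> annulus" for z
  proof -
    have z: "1 \<le> norm z" "norm z \<le> p" "z \<noteq> 0" using that by (auto simp: annulus_iff)
    have "s1 (norm z) \<le> s1 p"
      unfolding s1_def using z by (intro suminf_le sm mult_left_mono power_mono cn) auto
    moreover have "s2 (inverse (norm z)) \<le> s2 1"
      unfolding s2_def using z by (intro suminf_le sm mult_left_mono power_mono cn) (auto simp: field_simps)
    moreover have "0 \<le> s2 (inverse (norm z))"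
      unfolding s2_def by (intro suminf_nonneg sm mult_nonneg_nonneg cn) auto
    then have "s2 (inverse (norm z)) / norm z \<le> s2 (inverse (norm z))"
      using z by (simp add: divide_le_eq mult_left_le mult_le_cancel_left1)
    moreover have "e_fun q z = s1 (norm z) + s2 (inverse (norm z)) / norm z"
      unfolding e_fun_eq_infsum using hs[OF z(3)] by (rule infsumI)
    ultimately show ?thesis by linarith
  qed
  have "continuous_on annulus gauss" "\<And>z. z \<in> annulus \<Longrightarrow> 0 < gauss z"
    by (rule continuous_on_subset[OF gauss_continuous]) (auto simp: annulus_iff intro: gauss_pos)
  then obtain g G where g: "0 < g" "0 < G" "\<And>z. z \<in> annulus \<Longrightarrow> g \<le> gauss z \<and> gauss z \<le> G"
    using continuous_bounds_annulus by blast
  define B where "B = s1 p + s2 1"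
  have B: "1 \<le> B"
    using upper[OF annulus_nonempty] lower[of 1] unfolding B_def by simp
  have d: "a * gauss (q * z) = p * norm z * (a * gauss z)" if "z \<noteq> 0" for z a
    by (simp add: gauss_scale that)
  show ?thesis
  proof (rule that[of "1 / G" "B / g"])
    show "0 < 1 / G" "0 < B / g" using B g by auto
    fix x :: complex assume "x \<noteq> 0"
    show "1 / G * gauss x \<le> e_fun q x \<and> e_fun q x \<le> B / g * gauss x"
    proof
      show "1 / G * gauss x \<le> e_fun q x"
      proof (rule compare_by_scale[OF d e_fun_scale _ \<open>x \<noteq> 0\<close>])
        fix z assume z: "z \<in> annulus"
        have "1 / G * gauss z \<le> 1" using g z by (simp add: divide_le_eq)
        also have "1 \<le> e_fun q z" using z by (intro lower) (auto simp: annulus_iff)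
        finally show "1 / G * gauss z \<le> e_fun q z" .
      qed auto
      show "e_fun q x \<le> B / g * gauss x"
      proof (rule compare_by_scale[OF e_fun_scale d _ \<open>x \<noteq> 0\<close>])
        fix z assume z: "z \<in> annulus"
        have "e_fun q z \<le> B / g * g" using upper[OF z] g unfolding B_def by simp
        also have "\<dots> \<le> B / g * gauss z"
          using B g z by (intro mult_left_mono) auto
        finally show "e_fun q z \<le> B / g * gauss z" .
      qed auto
    qed
  qed
qed

text \<open>By \<open>gauss_mult\<close> the scale \<mu> contributes the power of |z| with exponent
  \<open>k\<close> ln \<mu> / ln p. Conversely an exponent \<open>a\<close> is produced by the scale
  \<mu> = p^(a/k), for which \<open>k\<close> must be positive. The right-hand side is easier to
  multiply and divide.\<close>

lemma gevrey_at_0_iff: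
  assumes "1 \<le> k"
  shows "gevrey_at_0 q k F \<longleftrightarrow>
    (\<exists>C>0. \<exists>a. \<exists>R>0. \<forall>z. 0 < norm z \<and> norm z < R \<longrightarrow> norm (F z) \<le> C * norm z powr a * gauss z ^ k)"
proof -
  obtain c C where c: "0 < c" "0 < C"
    and b: "\<And>x. x \<noteq> 0 \<Longrightarrow> c * gauss x \<le> e_fun q x \<and> e_fun q x \<le> C * gauss x"
    using e_fun_bounds by blast
  show ?thesis
  proof
    assume "gevrey_at_0 q k F"
    then obtain K \<mu> R where K: "K > 0" "\<mu> > 0" "R > 0"
      and F: "\<And>z. 0 < norm z \<Longrightarrow> norm z < R \<Longrightarrow> norm (F z) \<le> K * e_fun q (complex_of_real \<mu> * z) ^ k"
      unfolding gevrey_at_0_def by blast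
    define g where "g = gauss (complex_of_real \<mu>)"
    define a where "a = ln (norm (complex_of_real \<mu>)) / ln p"
    have "g > 0" unfolding g_def using K by (intro gauss_pos) auto
    have "norm (F z) \<le> (K * (C * g) ^ k) * norm z powr (a * k) * gauss z ^ k"
      if "0 < norm z" "norm z < R" for z
    proof -
      have "z \<noteq> 0" using that by auto
      have "norm (F z) \<le> K * e_fun q (complex_of_real \<mu> * z) ^ k" using F that by blast
      also have "\<dots> \<le> K * (C * gauss (complex_of_real \<mu> * z)) ^ k"
        using K b[of "complex_of_real \<mu> * z"] \<open>z \<noteq> 0\<close> c gauss_pos[of "complex_of_real \<mu> * z"]
        by (intro mult_left_mono power_mono) (auto intro: order_trans[rotated])
      also have "gauss (complex_of_real \<mu> * z) = g * norm z powr a * gauss z"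
        unfolding g_def a_def using K \<open>z \<noteq> 0\<close> by (intro gauss_mult) auto
      also have "K * (C * (g * norm z powr a * gauss z)) ^ k = (K * (C * g) ^ k) * (norm z powr a) ^ k * gauss z ^ k"
        by (simp add: power_mult_distrib mult_ac)
      also have "(norm z powr a) ^ k = norm z powr (a * k)"
        using \<open>z \<noteq> 0\<close> by (simp add: powr_realpow[symmetric] powr_powr)
      finally show ?thesis .
    qed
    then show "\<exists>C>0. \<exists>a. \<exists>R>0. \<forall>z. 0 < norm z \<and> norm z < R \<longrightarrow> norm (F z) \<le> C * norm z powr a * gauss z ^ k"
      using K c \<open>g > 0\<close> by (intro exI[of _ "K * (C * g) ^ k"] conjI exI[of _ "a * k"] exI[of _ R]) auto
  next
    assume "\<exists>C>0. \<exists>a. \<exists>R>0. \<forall>z. 0 < norm z \<and> norm z < R \<longrightarrow> norm (F z) \<le> C * norm z powr a * gauss z ^ k"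
    then obtain K a R where K: "K > 0" "R > 0"
      and F: "\<And>z. 0 < norm z \<Longrightarrow> norm z < R \<Longrightarrow> norm (F z) \<le> K * norm z powr a * gauss z ^ k"
      by blast
    define \<mu> where "\<mu> = exp (a / k * ln p)"
    have \<mu>: "\<mu> > 0" by (simp add: \<mu>_def)
    define g where "g = gauss (complex_of_real \<mu>)"
    have "g > 0" unfolding g_def using \<mu> by (intro gauss_pos) auto
    have "norm (F z) \<le> K / (c * g) ^ k * e_fun q (complex_of_real \<mu> * z) ^ k"
      if "0 < norm z" "norm z < R" for z
    proof -
      have "z \<noteq> 0" using that by auto
      have "norm z powr a = (norm z powr (a / k)) ^ k"
        using \<open>z \<noteq> 0\<close> assms by (simp add: powr_realpow[symmetric] powr_powr)
      then have "K * norm z powr a * gauss z ^ k = K / (c * g) ^ k * (c * (g * norm z powr (a / k) * gauss z)) ^ k"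
        using c \<open>g > 0\<close> by (simp add: power_mult_distrib field_simps)
      also have "g * norm z powr (a / k) * gauss z = gauss (complex_of_real \<mu> * z)"
        unfolding g_def using gauss_mult[of z "complex_of_real \<mu>"] \<mu> \<open>z \<noteq> 0\<close> ln_p_pos by (simp add: \<mu>_def)
      also have "K / (c * g) ^ k * (c * gauss (complex_of_real \<mu> * z)) ^ k \<le> K / (c * g) ^ k * e_fun q (complex_of_real \<mu> * z) ^ k"
        using K b[of "complex_of_real \<mu> * z"] \<open>z \<noteq> 0\<close> c \<open>g > 0\<close> \<mu> gauss_pos[of "complex_of_real \<mu> * z"]
        by (intro mult_left_mono power_mono) (auto intro!: less_imp_le)
      finally show ?thesis using F[OF that] by linarith
    qed
    then show "gevrey_at_0 q k F"
      unfolding gevrey_at_0_def using K c \<mu> \<open>g > 0\<close>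
      by (intro exI[of _ "K / (c * g) ^ k"] conjI exI[of _ \<mu>] exI[of _ R]) auto
  qed
qed

end

section \<open>Divisors: sectors and products of theta functions\<close>

lemma sector_iff: "z \<in> sector \<Lambda> \<epsilon> R \<longleftrightarrow> z \<noteq> 0 \<and> \<epsilon> < dist_div z \<Lambda> \<and> norm z < R"
  by (simp add: sector_def)

lemma dist_div_empty [simp]: "dist_div z {#} = 1"
  by (simp add: dist_div_def)

lemma dist_div_add_mset: "dist_div z (add_mset s A) = dist_spiral z s * dist_div z A"
  by (simp add: dist_div_def)

lemma dist_div_add: "dist_div z (A + B) = dist_div z A * dist_div z B"
  by (simp add: dist_div_def)

lemma theta_div_empty [simp]: "theta_div q rep {#} z = 1"
  by (simp add: theta_div_def)

lemma theta_div_add_mset: "theta_div q rep (add_mset s A) z = theta q (- z / rep s) * theta_div q rep A z"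
  by (simp add: theta_div_def)

lemma theta_div_add: "theta_div q rep (A + B) z = theta_div q rep A z * theta_div q rep B z"
  by (simp add: theta_div_def)

context q_theta
begin

text \<open>Combines being a divisor with the choice of representatives into one condition that is
  inherited by subdivisors and splits over sums.\<close>

definition reps :: "(complex set \<Rightarrow> complex) \<Rightarrow> complex set multiset \<Rightarrow> bool" where
  "reps rep \<Lambda> \<longleftrightarrow> (\<forall>s\<in>#\<Lambda>. rep s \<noteq> 0 \<and> s = spiral q (rep s))"

lemma repsI:
  assumes "q_divisor q \<Lambda>" "\<And>s. s \<in># \<Lambda> \<Longrightarrow> rep s \<in> s"
  shows "reps rep \<Lambda>"
  unfolding reps_def
proof
  fix s assume s: "s \<in># \<Lambda>"
  then obtain l where l: "l \<noteq> 0" "s = spiral q l"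
    using assms(1) unfolding q_divisor_def by blast
  then show "rep s \<noteq> 0 \<and> s = spiral q (rep s)"
    using assms(2)[OF s] spiral_zero spiral_eq by auto
qed

lemma reps_mono: "reps rep B \<Longrightarrow> A \<subseteq># B \<Longrightarrow> reps rep A"
  unfolding reps_def by (meson mset_subset_eqD)

lemma reps_add [simp]: "reps rep (A + B) \<longleftrightarrow> reps rep A \<and> reps rep B"
  unfolding reps_def by auto

lemma reps_empty [simp]: "reps rep {#}"
  unfolding reps_def by auto

lemma reps_add_mset [simp]: "reps rep (add_mset s A) \<longleftrightarrow> rep s \<noteq> 0 \<and> s = spiral q (rep s) \<and> reps rep A"
  unfolding reps_def by auto

lemma spiral_divide_iff: "l \<noteq> 0 \<Longrightarrow> x / l \<in> spiral q 1 \<longleftrightarrow> x \<in> spiral q l"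
  unfolding spiral_def image_iff by (simp add: divide_eq_eq mult.commute)

lemma dist_div_bounds:
  assumes "reps rep \<Lambda>"
  shows "0 \<le> dist_div z \<Lambda> \<and> dist_div z \<Lambda> \<le> 1"
  using assms
proof (induction \<Lambda>)
  case (add s A)
  then have "0 \<le> dist_spiral z s" "dist_spiral z s \<le> 1"
    using dist_spiral_nonneg[of z q "rep s"] dist_spiral_le_1[of z "rep s"] by auto
  then show ?case
    using add by (auto simp: dist_div_add_mset intro: mult_le_one)
qed auto

lemma dist_div_mono:
  assumes "reps rep B" "A \<subseteq># B"
  shows "dist_div z B \<le> dist_div z A"
proof -
  obtain D where D: "B = A + D" using assms(2) by (metis subset_mset.le_iff_add)
  then have "reps rep A" "reps rep D" using assms by auto
  then show ?thesis
    unfolding D dist_div_add using dist_div_bounds by (metis mult_left_le)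
qed

text \<open>All factors of the distance are at most 1, so discarding all but \<open>j\<close> copies
  of that of \<open>s\<close> cannot decrease the product. In this way one factor
  \<open>dist_div\<close> pays for a pole of any order up to the multiplicity.\<close>

lemma dist_div_le_power:
  assumes "reps rep \<Lambda>" "s \<in># \<Lambda>" "j \<le> count \<Lambda> s"
  shows "dist_div z \<Lambda> \<le> dist_spiral z s ^ j"
proof -
  have "replicate_mset j s \<subseteq># \<Lambda>"
    using assms(3) by (simp add: count_le_replicate_mset_subset_eq)
  moreover have "dist_div z (replicate_mset j s) = dist_spiral z s ^ j"
    by (simp add: dist_div_def)
  ultimately show ?thesis using dist_div_mono[OF assms(1)] by metis
qed

lemma dist_div_scale:
  assumes "reps rep \<Lambda>"
  shows "dist_div (q * z) \<Lambda> = dist_div z \<Lambda>"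
  using assms
proof (induction \<Lambda>)
  case (add s A)
  then show ?case
    using dist_spiral_scale[of z "rep s"] by (simp add: dist_div_add_mset)
qed auto

lemma dist_div_scale_power:
  assumes "reps rep \<Lambda>"
  shows "dist_div (z / q ^ n) \<Lambda> = dist_div z \<Lambda>"
proof (induction n)
  case (Suc n)
  have "dist_div (z / q ^ Suc n) \<Lambda> = dist_div (q * (z / q ^ Suc n)) \<Lambda>"
    by (rule dist_div_scale[OF assms, symmetric])
  also have "q * (z / q ^ Suc n) = z / q ^ n" by simp
  finally show ?case using Suc by simp
qed simp

lemma theta_div_holomorphic:
  assumes "reps rep \<Lambda>"
  shows "theta_div q rep \<Lambda> holomorphic_on - {0}"
  using assms
proof (induction \<Lambda>)
  case empty
  then show ?case by (simp add: theta_div_def)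
next
  case (add s A)
  then have "(theta q \<circ> (\<lambda>z. - z / rep s)) holomorphic_on - {0}"
    by (intro holomorphic_on_compose holomorphic_intros holomorphic_on_subset[OF theta_holomorphic[OF q_gt_1]]) auto
  then show ?case
    using add unfolding theta_div_add_mset[abs_def] by (intro holomorphic_intros) (auto simp: o_def)
qed

lemma theta_div_analytic:
  assumes "reps rep \<Lambda>" "z \<noteq> 0"
  shows "theta_div q rep \<Lambda> analytic_on {z}"
  using theta_div_holomorphic[OF assms(1)] assms(2)
  by (intro holomorphic_on_imp_analytic_at[of _ "- {0}"]) auto

text \<open>The exponent \<open>b\<close> collects the powers of |z| by which
  \<open>gauss (z / rep s)\<close> differs from \<open>gauss z\<close>. Upper and lower bound share
  it, so that quotients of the two bounds lose only constants.\<close>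

lemma theta_div_bounds:
  assumes "reps rep \<Lambda>"
  obtains b c C where "0 < c" "0 < C"
    "\<And>z. z \<noteq> 0 \<Longrightarrow> c * norm z powr b * gauss z ^ size \<Lambda> * dist_div z \<Lambda> \<le> norm (theta_div q rep \<Lambda> z) \<and>
        norm (theta_div q rep \<Lambda> z) \<le> C * norm z powr b * gauss z ^ size \<Lambda> * dist_div z \<Lambda>"
proof -
  have "\<exists>b c C. 0 < c \<and> 0 < C \<and> (\<forall>z. z \<noteq> 0 \<longrightarrow>
     c * norm z powr b * gauss z ^ size \<Lambda> * dist_div z \<Lambda> \<le> norm (theta_div q rep \<Lambda> z) \<and>
        norm (theta_div q rep \<Lambda> z) \<le> C * norm z powr b * gauss z ^ size \<Lambda> * dist_div z \<Lambda>)"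
    using assms
  proof (induction \<Lambda>)
    case empty
    show ?case by (intro exI[of _ 0] exI[of _ 1]) auto
  next
    case (add s A)
    then obtain b c C where A: "0 < c" "0 < C"
      "\<And>z. z \<noteq> 0 \<Longrightarrow> c * norm z powr b * gauss z ^ size A * dist_div z A \<le> norm (theta_div q rep A z) \<and>
        norm (theta_div q rep A z) \<le> C * norm z powr b * gauss z ^ size A * dist_div z A"
      by auto
    have s: "rep s \<noteq> 0" "s = spiral q (rep s)" and repA: "reps rep A" using add by auto
    obtain t T where t: "0 < t" "0 < T"
      "\<And>x. x \<noteq> 0 \<Longrightarrow> t * dist_spiral x (spiral q 1) * gauss x \<le> norm (theta q (- x)) \<and>
        norm (theta q (- x)) \<le> T * dist_spiral x (spiral q 1) * gauss x"
      using theta_bounds by blast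
    define g where "g = gauss (1 / rep s)"
    define a where "a = ln (norm (1 / rep s)) / ln p"
    have "g > 0" unfolding g_def using s by (intro gauss_pos) auto
    have 1: "t * g * norm z powr a * gauss z * dist_spiral z s \<le> norm (theta q (- z / rep s)) \<and>
        norm (theta q (- z / rep s)) \<le> T * g * norm z powr a * gauss z * dist_spiral z s" if "z \<noteq> 0" for z
    proof -
      have "gauss (z / rep s) = g * norm z powr a * gauss z"
        using gauss_mult[OF that, of "1 / rep s"] s by (simp add: g_def a_def)
      moreover have "dist_spiral (z / rep s) (spiral q 1) = dist_spiral z s"
        using dist_spiral_unit[of z "rep s"] s by simp
      ultimately show ?thesis
        using t(3)[of "z / rep s"] that s by (simp add: mult_ac)
    qed
    have "t * g * c * norm z powr (a + b) * gauss z ^ size (add_mset s A) * dist_div z (add_mset s A)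
          \<le> norm (theta_div q rep (add_mset s A) z) \<and>
        norm (theta_div q rep (add_mset s A) z) \<le>
          T * g * C * norm z powr (a + b) * gauss z ^ size (add_mset s A) * dist_div z (add_mset s A)"
      if z: "z \<noteq> 0" for z
    proof -
      have d: "0 \<le> dist_spiral z s" "0 \<le> dist_div z A"
        using dist_spiral_nonneg[of z q "rep s"] s dist_div_bounds[OF repA] by auto
      have "(t * g * norm z powr a * gauss z * dist_spiral z s) * (c * norm z powr b * gauss z ^ size A * dist_div z A)
        \<le> norm (theta q (- z / rep s)) * norm (theta_div q rep A z)"
        using 1[OF z] A(3)[OF z] A(1) d gauss_pos[OF z] t \<open>g > 0\<close> by (intro mult_mono) auto
      moreover have "norm (theta q (- z / rep s)) * norm (theta_div q rep A z) \<le>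
        (T * g * norm z powr a * gauss z * dist_spiral z s) * (C * norm z powr b * gauss z ^ size A * dist_div z A)"
        using 1[OF z] A(3)[OF z] A(2) d gauss_pos[OF z] t \<open>g > 0\<close> by (intro mult_mono) auto
      ultimately show ?thesis
        by (simp add: theta_div_add_mset dist_div_add_mset norm_mult powr_add mult_ac)
    qed
    moreover have "0 < t * g * c" "0 < T * g * C" using t A \<open>g > 0\<close> by auto
    ultimately show ?case by blast
  qed
  then show ?thesis using that by blast
qed

lemma theta_div_eq_0_iff:
  assumes "reps rep \<Lambda>" "z \<noteq> 0"
  shows "theta_div q rep \<Lambda> z = 0 \<longleftrightarrow> dist_div z \<Lambda> = 0"
proof -
  obtain c C b where A: "0 < c" "0 < C"
    "\<And>z. z \<noteq> 0 \<Longrightarrow> c * norm z powr b * gauss z ^ size \<Lambda> * dist_div z \<Lambda> \<le> norm (theta_div q rep \<Lambda> z) \<and>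
        norm (theta_div q rep \<Lambda> z) \<le> C * norm z powr b * gauss z ^ size \<Lambda> * dist_div z \<Lambda>"
    using theta_div_bounds[OF assms(1)] by metis
  define K where "K = c * norm z powr b * gauss z ^ size \<Lambda>"
  have "K > 0" unfolding K_def using A gauss_pos assms by simp
  have d: "0 \<le> dist_div z \<Lambda>" using dist_div_bounds[OF assms(1)] by blast
  show ?thesis
  proof
    assume "theta_div q rep \<Lambda> z = 0"
    then have "K * dist_div z \<Lambda> \<le> 0" using A(3)[OF assms(2)] unfolding K_def by simp
    then show "dist_div z \<Lambda> = 0" using d \<open>K > 0\<close> by (simp add: mult_le_0_iff)
  next
    assume "dist_div z \<Lambda> = 0"
    then show "theta_div q rep \<Lambda> z = 0" using A(3)[OF assms(2)] by simp
  qed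
qed

lemma theta_div_nz_iff:
  assumes "reps rep \<Lambda>" "z \<noteq> 0"
  shows "0 < dist_div z \<Lambda> \<longleftrightarrow> theta_div q rep \<Lambda> z \<noteq> 0"
  using theta_div_eq_0_iff[OF assms] dist_div_bounds[OF assms(1), of z] by auto

lemma sector_0_eq:
  assumes "reps rep \<Lambda>"
  shows "sector \<Lambda> 0 R = {z. z \<noteq> 0 \<and> norm z < R \<and> theta_div q rep \<Lambda> z \<noteq> 0}"
  by (rule set_eqI) (auto simp: sector_iff theta_div_nz_iff[OF assms])

lemma open_sector_0:
  assumes "reps rep \<Lambda>"
  shows "open (sector \<Lambda> 0 R)"
proof -
  have "open (- {0} \<inter> theta_div q rep \<Lambda> -` (- {0}))"
    by (intro continuous_open_preimage holomorphic_on_imp_continuous_on[OF theta_div_holomorphic[OF assms]]) auto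
  then have "open (- {0} \<inter> theta_div q rep \<Lambda> -` (- {0}) \<inter> ball 0 R)"
    by (rule open_Int[OF _ open_ball])
  also have "- {0} \<inter> theta_div q rep \<Lambda> -` (- {0}) \<inter> ball 0 R = sector \<Lambda> 0 R"
    unfolding sector_0_eq[OF assms] by auto
  finally show ?thesis .
qed

lemma sector_mono:
  assumes "reps rep B" "A \<subseteq># B" "\<epsilon> \<le> \<epsilon>'" "R' \<le> R"
  shows "sector B \<epsilon>' R' \<subseteq> sector A \<epsilon> R"
proof
  fix z assume "z \<in> sector B \<epsilon>' R'"
  then show "z \<in> sector A \<epsilon> R"
    using dist_div_mono[OF assms(1,2), of z] assms(3,4) by (auto simp: sector_iff)
qed

lemma theta_eq_0_iff:
  assumes "x \<noteq> 0"
  shows "theta q (- x) = 0 \<longleftrightarrow> x \<in> spiral q 1"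
proof -
  obtain c where "c \<noteq> 0" "\<And>z. z \<noteq> 0 \<Longrightarrow> theta q z = c * jacobi_prod q z"
    using theta_eq_jacobi by blast
  then have "theta q (- x) = 0 \<longleftrightarrow> (\<exists>n::int. - x = - (q powi n))"
    using jacobi_eq_0_iff[of "- x"] assms by simp
  then show ?thesis by (auto simp: spiral_def)
qed

lemma theta_div_eventually_nz:
  assumes "reps rep \<Lambda>" "z \<noteq> 0"
  shows "\<forall>\<^sub>F w in at z. theta_div q rep \<Lambda> w \<noteq> 0"
  using assms(1)
proof (induction \<Lambda>)
  case (add s A)
  obtain c where c: "c \<noteq> 0" "\<And>z. z \<noteq> 0 \<Longrightarrow> theta q z = c * jacobi_prod q z"
    using theta_eq_jacobi by blast
  define u where "u = - z / rep s"
  have "rep s \<noteq> 0" using add by auto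
  then have "u \<noteq> 0" using assms by (simp add: u_def)
  have "filterlim (\<lambda>w. - w / rep s) (at u) (at z)"
  proof (rule filterlim_atI)
    show "((\<lambda>w. - w / rep s) \<longlongrightarrow> u) (at z)"
      unfolding u_def using \<open>rep s \<noteq> 0\<close> by (intro tendsto_intros)
    show "\<forall>\<^sub>F w in at z. - w / rep s \<noteq> u"
      using \<open>rep s \<noteq> 0\<close> by (auto simp: u_def eventually_at_filter)
  qed
  then have 1: "\<forall>\<^sub>F w in at z. jacobi_prod q (- w / rep s) \<noteq> 0"
    using jacobi_eventually_nz[OF \<open>u \<noteq> 0\<close>] unfolding filterlim_iff by blast
  have 2: "\<forall>\<^sub>F w in at z. w \<noteq> 0"
    by (rule eventually_neq_at_within)
  have 3: "\<forall>\<^sub>F w in at z. theta_div q rep A w \<noteq> 0" using add by auto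
  show ?case
    using 1 2 3 by eventually_elim (use c \<open>rep s \<noteq> 0\<close> in \<open>auto simp: theta_div_add_mset\<close>)
qed auto

text \<open>Points of the spirals are limits of points of the sector. Through this, identities and
  bounds proved off the spirals extend to the punctured disc by continuity.\<close>

lemma sector_eventually:
  assumes "reps rep \<Lambda>" "z \<noteq> 0" "norm z < R"
  shows "\<forall>\<^sub>F w in at z. w \<in> sector \<Lambda> 0 R"
proof -
  have "\<forall>\<^sub>F w in at z. w \<in> ball 0 R"
    using assms(3) by (intro eventually_at_in_open') auto
  moreover have "\<forall>\<^sub>F w in at z. w \<noteq> 0"
    by (rule eventually_neq_at_within)
  ultimately show ?thesis
    using theta_div_eventually_nz[OF assms(1,2)]
    by eventually_elim (auto simp: sector_0_eq[OF assms(1)])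
qed

text \<open>Iterating the functional equation \<open>n\<close> times along the orbit of
  \<open>x\<close>; \<beta> is the product of -1/rep s over \<Lambda>. The triangular number in the
  exponent is the source of the order \<open>size \<Lambda>\<close>.\<close>

lemma theta_div_scale_power:
  assumes "reps rep \<Lambda>"
  shows "\<exists>\<beta>. \<beta> \<noteq> 0 \<and> (\<forall>x n. x \<noteq> 0 \<longrightarrow> theta_div q rep \<Lambda> (x / q ^ n) * (\<beta> * x ^ size \<Lambda>) ^ n
           = q ^ (size \<Lambda> * (n * (n - 1) div 2)) * theta_div q rep \<Lambda> x)"
  using assms
proof (induction \<Lambda>)
  case empty
  show ?case by (intro exI[of _ 1]) auto
next
  case (add s A)
  then obtain \<beta> where \<beta>: "\<beta> \<noteq> 0" "\<And>x n. x \<noteq> 0 \<Longrightarrow> theta_div q rep A (x / q ^ n) * (\<beta> * x ^ size A) ^ n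
           = q ^ (size A * (n * (n - 1) div 2)) * theta_div q rep A x"
    by auto
  have s: "rep s \<noteq> 0" using add by auto
  have 1: "theta q (y / q ^ n) * y ^ n = q ^ (n * (n - 1) div 2) * theta q y" if "y \<noteq> 0" for y n
  proof (induction n)
    case (Suc n)
    have "theta q (y / q ^ n) = theta q (q * (y / q ^ Suc n))" by simp
    also have "\<dots> = q * (y / q ^ Suc n) * theta q (y / q ^ Suc n)"
      using that by (intro theta_scale) auto
    finally have e: "theta q (y / q ^ n) = y / q ^ n * theta q (y / q ^ Suc n)" by simp
    have "Suc n * (Suc n - 1) = n * (n - 1) + n * 2"
      by (cases n) (auto simp: algebra_simps)
    then have t: "Suc n * (Suc n - 1) div 2 = n * (n - 1) div 2 + n" by simp
    have "theta q (y / q ^ Suc n) * y ^ Suc n = q ^ n * (theta q (y / q ^ n) * y ^ n)"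
      unfolding e by simp
    then show ?case unfolding Suc t by (simp add: power_add)
  qed simp
  show ?case
  proof (intro exI[of _ "- \<beta> / rep s"] conjI allI impI)
    show "- \<beta> / rep s \<noteq> 0" using \<beta> s by simp
    fix x :: complex and n assume x: "x \<noteq> 0"
    have "theta_div q rep (add_mset s A) (x / q ^ n) * (- \<beta> / rep s * x ^ size (add_mset s A)) ^ n
       = (theta q ((- x / rep s) / q ^ n) * (- x / rep s) ^ n) * (theta_div q rep A (x / q ^ n) * (\<beta> * x ^ size A) ^ n)"
      by (simp add: theta_div_add_mset power_mult_distrib[symmetric] mult_ac)
    also have "\<dots> = (q ^ (n * (n - 1) div 2) * theta q (- x / rep s)) * (q ^ (size A * (n * (n - 1) div 2)) * theta_div q rep A x)"
      using x s by (subst 1, simp, subst \<beta>(2)) auto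
    also have "\<dots> = q ^ (size (add_mset s A) * (n * (n - 1) div 2)) * theta_div q rep (add_mset s A) x"
      by (simp add: theta_div_add_mset power_add mult_ac)
    finally show "theta_div q rep (add_mset s A) (x / q ^ n) * (- \<beta> / rep s * x ^ size (add_mset s A)) ^ n
      = q ^ (size (add_mset s A) * (n * (n - 1) div 2)) * theta_div q rep (add_mset s A) x" .
  qed
qed

text \<open>The zero comes from the factor 1 + z of the first Euler product, which is -w at z = -(1
  + w). The cofactor at \<open>w = 0\<close> is nonzero by
  \<open>euler_minus_inv_nz\<close>.\<close>

lemma theta_local_factor:
  "\<exists>V. V analytic_on {0} \<and> V 0 \<noteq> 0 \<and> (\<forall>w. w \<noteq> -1 \<longrightarrow> theta q (- (1 + w)) = w * V w)"
proof -
  obtain c0 where c0: "c0 \<noteq> 0" "\<And>z. z \<noteq> 0 \<Longrightarrow> theta q z = c0 * jacobi_prod q z"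
    using theta_eq_jacobi by blast
  define V where "V = (\<lambda>w. - c0 * (euler_fun q (- (1 + w) / q) * euler_fun q (- 1 / (q * (1 + w)))))"
  have e: "euler_fun q (- (1 + w)) = - w * euler_fun q (- (1 + w) / q)" for w
    using euler_scale[of "- (1 + w)"] by simp
  have "theta q (- (1 + w)) = w * V w" if "w \<noteq> - 1" for w
  proof -
    have "- (1 + w) \<noteq> 0" using that by (simp add: add_eq_0_iff)
    have "1 / (q * - (1 + w)) = - 1 / (q * (1 + w))"
      by (simp only: mult_minus_right divide_minus_right divide_minus_left)
    then show ?thesis
      unfolding c0(2)[OF \<open>- (1 + w) \<noteq> 0\<close>] jacobi_prod_def e V_def by (simp only: mult_ac mult_minus_left mult_minus_right)
  qed
  moreover have "V 0 \<noteq> 0" using c0 euler_minus_inv_nz by (simp add: V_def)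
  moreover have "V analytic_on {0}"
  proof -
    have "(euler_fun q \<circ> (\<lambda>w. - (1 + w) / q)) holomorphic_on - {- 1}"
      "(euler_fun q \<circ> (\<lambda>w. - 1 / (q * (1 + w)))) holomorphic_on - {- 1}"
      by (intro holomorphic_on_compose euler_holomorphic holomorphic_intros; auto simp: add_eq_0_iff)+
    then have "V holomorphic_on - {- 1}"
      unfolding V_def by (intro holomorphic_intros) (auto simp: o_def)
    then show ?thesis
      by (rule holomorphic_on_imp_analytic_at) auto
  qed
  ultimately show ?thesis by blast
qed

text \<open>A spiral outside \<Lambda> is allowed and has exponent 0: when dividing by a theta
  product one also has to look at the spirals of the remaining divisors.\<close>

lemma theta_div_local_factor:
  assumes "reps rep \<Lambda>" "l \<noteq> 0" "s = spiral q l" "s \<in># \<Lambda> \<Longrightarrow> l = rep s"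
  shows "\<exists>V. V analytic_on {0} \<and> V 0 \<noteq> 0 \<and>
    (\<forall>w. w \<noteq> -1 \<longrightarrow> theta_div q rep \<Lambda> (l * (1 + w)) = w ^ count \<Lambda> s * V w)"
  using assms(1,4)
proof (induction \<Lambda>)
  case empty
  show ?case by (intro exI[of _ "\<lambda>_. 1"]) auto
next
  case (add s' A)
  then obtain V where V: "V analytic_on {0}" "V 0 \<noteq> 0"
    "\<And>w. w \<noteq> -1 \<Longrightarrow> theta_div q rep A (l * (1 + w)) = w ^ count A s * V w"
    by auto
  have s': "rep s' \<noteq> 0" "s' = spiral q (rep s')" using add by auto
  show ?case
  proof (cases "s' = s")
    case True
    then have l: "rep s' = l" using add.prems(2) by simp
    obtain W where W: "W analytic_on {0}" "W 0 \<noteq> 0" "\<And>w. w \<noteq> -1 \<Longrightarrow> theta q (- (1 + w)) = w * W w"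
      using theta_local_factor by blast
    have "theta_div q rep (add_mset s' A) (l * (1 + w)) = w ^ count (add_mset s' A) s * (W w * V w)"
      if "w \<noteq> - 1" for w
    proof -
      have "- (l * (1 + w)) / l = - (1 + w)" using assms(2) by simp
      then show ?thesis
        using W(3)[OF that] V(3)[OF that] True l by (simp only: theta_div_add_mset) simp
    qed
    moreover have "(\<lambda>w. W w * V w) analytic_on {0}" using V W by (intro analytic_intros)
    ultimately show ?thesis using V(2) W(2) by (intro exI[of _ "\<lambda>w. W w * V w"]) auto
  next
    case False
    define U where "U = (\<lambda>w. theta q (- (l * (1 + w)) / rep s'))"
    have "(theta q \<circ> (\<lambda>w. - (l * (1 + w)) / rep s')) holomorphic_on - {- 1}"
      using s' assms(2)
      by (intro holomorphic_on_compose holomorphic_intros holomorphic_on_subset[OF theta_holomorphic[OF q_gt_1]])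
         (auto simp: add_eq_0_iff)
    then have U: "U analytic_on {0}"
      unfolding U_def o_def by (rule holomorphic_on_imp_analytic_at) auto
    have U0: "U 0 \<noteq> 0"
    proof
      assume "U 0 = 0"
      then have "l / rep s' \<in> spiral q 1"
        using theta_eq_0_iff[of "l / rep s'"] s' assms(2) by (simp add: U_def)
      then have "l \<in> spiral q (rep s')"
        using spiral_divide_iff[OF s'(1)] by simp
      then show False using False s' assms(3) spiral_eq by metis
    qed
    have "theta_div q rep (add_mset s' A) (l * (1 + w)) = w ^ count (add_mset s' A) s * (U w * V w)"
      if "w \<noteq> - 1" for w
      using V(3)[OF that] False by (simp add: theta_div_add_mset U_def)
    moreover have "(\<lambda>w. U w * V w) analytic_on {0}" using V U by (intro analytic_intros)
    ultimately show ?thesis using V(2) U0 by (intro exI[of _ "\<lambda>w. U w * V w"]) auto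
  qed
qed

lemma spiral_notin_imp_theta:
  assumes "reps rep \<Lambda>" "z \<noteq> 0"
  shows "theta_div q rep \<Lambda> z = 0 \<longleftrightarrow> (\<exists>s\<in>#\<Lambda>. z \<in> s)"
  using assms(1)
proof (induction \<Lambda>)
  case (add s A)
  have s: "rep s \<noteq> 0" "s = spiral q (rep s)" using add by auto
  have "theta q (- z / rep s) = 0 \<longleftrightarrow> z / rep s \<in> spiral q 1"
    using theta_eq_0_iff[of "z / rep s"] s assms(2) by simp
  also have "\<dots> \<longleftrightarrow> z \<in> spiral q (rep s)"
    using spiral_divide_iff[OF s(1)] by simp
  finally show ?case using add s by (auto simp: theta_div_add_mset)
qed auto

text \<open>The points of finitely many spirals have countably many moduli, so some radius
  \<open>r\<close> avoids them all. On that circle the theta product has a positive minimum, which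
  its upper bound converts into a lower bound for the distance; invariance of the distance under
  \<open>q\<close> carries it to the radii \<open>r / p ^ n\<close>.\<close>

lemma good_circles:
  assumes "reps rep \<Lambda>"
  obtains r \<epsilon> where "0 < r" "0 < \<epsilon>" "\<And>n z. norm z = r / p ^ n \<Longrightarrow> \<epsilon> < dist_div z \<Lambda>"
proof -
  define Z where "Z = norm ` (\<Union>s\<in>set_mset \<Lambda>. s)"
  have "countable s" if "s \<in># \<Lambda>" for s
    using assms that unfolding reps_def spiral_def by (metis countableI_type countable_image)
  then have "countable Z"
    unfolding Z_def by (intro countable_image countable_UN[OF countable_finite]) auto
  then have "uncountable ({0<..<1::real} - Z)"
    by (intro uncountable_minus_countable) (simp_all add: uncountable_open_interval)
  then obtain r where r: "0 < r" "r \<notin> Z"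
    by (metis DiffD1 DiffD2 countable_empty equals0I greaterThanLessThan_iff)
  obtain c C b where A: "0 < c" "0 < C"
    "\<And>z. z \<noteq> 0 \<Longrightarrow> c * norm z powr b * gauss z ^ size \<Lambda> * dist_div z \<Lambda> \<le> norm (theta_div q rep \<Lambda> z) \<and>
        norm (theta_div q rep \<Lambda> z) \<le> C * norm z powr b * gauss z ^ size \<Lambda> * dist_div z \<Lambda>"
    using theta_div_bounds[OF assms(1)] by metis
  define S where "S = sphere (0::complex) r"
  have S: "compact S" "S \<noteq> {}" "S \<subseteq> - {0}"
    unfolding S_def using r by (auto simp: sphere_eq_empty)
  have "continuous_on S (\<lambda>z. norm (theta_div q rep \<Lambda> z))"
    using S(3) theta_div_holomorphic[OF assms]
    by (intro continuous_on_norm holomorphic_on_imp_continuous_on) (rule holomorphic_on_subset)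
  then obtain z0 where z0: "z0 \<in> S" "\<And>z. z \<in> S \<Longrightarrow> norm (theta_div q rep \<Lambda> z0) \<le> norm (theta_div q rep \<Lambda> z)"
    using continuous_attains_inf[OF S(1,2)] by blast
  have "theta_div q rep \<Lambda> z0 \<noteq> 0"
  proof
    assume "theta_div q rep \<Lambda> z0 = 0"
    then obtain s where "s \<in># \<Lambda>" "z0 \<in> s"
      using spiral_notin_imp_theta[OF assms, of z0] z0(1) S(3) by auto
    then have "norm z0 \<in> Z" by (auto simp: Z_def)
    then show False using r z0(1) by (simp add: S_def)
  qed
  define m where "m = norm (theta_div q rep \<Lambda> z0)"
  define K where "K = C * r powr b * gauss (of_real r) ^ size \<Lambda>"
  have "m > 0" using \<open>theta_div q rep \<Lambda> z0 \<noteq> 0\<close> by (simp add: m_def)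
  have "K > 0" unfolding K_def using A r gauss_pos[of "of_real r"] by simp
  have on_S: "m / K \<le> dist_div z \<Lambda>" if "norm z = r" for z
  proof -
    have "gauss z = gauss (of_real r)" using that r by (simp add: gauss_def)
    then have "m \<le> K * dist_div z \<Lambda>"
      using A(3)[of z] z0(2)[of z] that r unfolding m_def K_def S_def by auto
    then show ?thesis using \<open>K > 0\<close> by (simp add: field_simps)
  qed
  show ?thesis
  proof (rule that[of r "m / K / 2"])
    show "0 < r" "0 < m / K / 2" using r \<open>m > 0\<close> \<open>K > 0\<close> by auto
    fix n :: nat and z :: complex assume z: "norm z = r / p ^ n"
    have "norm (q ^ n * z) = r" using z by (simp add: norm_mult norm_power)
    then have "m / K \<le> dist_div (q ^ n * z) \<Lambda>" by (rule on_S)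
    also have "\<dots> = dist_div z \<Lambda>"
      using dist_div_scale_power[OF assms, of "q ^ n * z" n] by simp
    finally show "m / K / 2 < dist_div z \<Lambda>"
      using \<open>m > 0\<close> \<open>K > 0\<close> by (smt (verit) divide_pos_pos field_sum_of_halves)
  qed
qed

text \<open>Maximum modulus between circles on which the distance to the divisor is bounded below.\<close>

lemma bounded_from_sector:
  assumes "reps rep \<Lambda>"
  obtains \<epsilon> where "0 < \<epsilon>"
    "\<And>H B R. H holomorphic_on ball 0 R - {0} \<Longrightarrow> 0 < R \<Longrightarrow> (\<And>z. z \<in> sector \<Lambda> \<epsilon> R \<Longrightarrow> norm (H z) \<le> B) \<Longrightarrow>
       \<exists>R'>0. \<forall>z. 0 < norm z \<and> norm z < R' \<longrightarrow> norm (H z) \<le> B"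
proof -
  obtain r \<epsilon> where r: "0 < r" "0 < \<epsilon>" "\<And>n z. norm z = r / p ^ n \<Longrightarrow> \<epsilon> < dist_div z \<Lambda>"
    using good_circles[OF assms] by metis
  have lim: "(\<lambda>n. r * (1 / p) ^ n) \<longlonglongrightarrow> r * 0"
    using inv_q_lt_1 by (intro tendsto_intros LIMSEQ_realpow_zero) (auto simp: norm_divide)
  have ex: "\<exists>n. r / p ^ n < x" if "x > 0" for x
  proof -
    have "\<forall>\<^sub>F n in sequentially. r * (1 / p) ^ n < x"
      using order_tendstoD(2)[OF lim] that by simp
    then show ?thesis by (auto simp: eventually_sequentially power_divide)
  qed
  show ?thesis
  proof (rule that[OF r(2)])
    fix H :: "complex \<Rightarrow> complex" and B R :: real
    assume H: "H holomorphic_on ball 0 R - {0}" "0 < R" "\<And>z. z \<in> sector \<Lambda> \<epsilon> R \<Longrightarrow> norm (H z) \<le> B"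
    obtain n0 where n0: "r / p ^ n0 < R" using ex[OF H(2)] by blast
    show "\<exists>R'>0. \<forall>z. 0 < norm z \<and> norm z < R' \<longrightarrow> norm (H z) \<le> B"
    proof (intro exI[of _ "r / p ^ n0"] conjI allI impI)
      show "0 < r / p ^ n0" using r by simp
      fix z :: complex assume z: "0 < norm z \<and> norm z < r / p ^ n0"
      \<comment> \<open>The inner circle depends on \<open>z\<close>, but the bound \<open>B\<close>
        on the two bounding circles does not.\<close>
      then obtain m where m: "r / p ^ m < norm z" using ex by blast
      define S where "S = ball (0::complex) (r / p ^ n0) - cball 0 (r / p ^ m)"
      have rm: "0 < r / p ^ m" using r by simp
      have "closure S \<subseteq> cball 0 (r / p ^ n0) - ball 0 (r / p ^ m)"
        unfolding S_def by (intro closure_minimal) auto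
      then have cl: "closure S \<subseteq> ball 0 R - {0}" and cl2: "\<And>x. x \<in> closure S \<Longrightarrow> r / p ^ m \<le> norm x \<and> norm x \<le> r / p ^ n0"
        using n0 rm by (auto simp: subset_iff)
      have "open S" unfolding S_def by (intro open_Diff) auto
      show "norm (H z) \<le> B"
      proof (rule maximum_modulus_frontier[of H S])
        show "H holomorphic_on interior S"
          using H(1) cl interior_subset closure_subset by (meson holomorphic_on_subset subset_trans)
        show "continuous_on (closure S) H"
          using H(1) cl by (meson continuous_on_subset holomorphic_on_imp_continuous_on)
        show "bounded S" unfolding S_def by (auto intro: bounded_subset[OF bounded_ball])
        show "z \<in> S" using z m by (simp add: S_def)
        fix w assume w: "w \<in> frontier S"
        then have "w \<in> closure S" "w \<notin> S"
          using \<open>open S\<close> by (auto simp: frontier_def interior_open)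
        then have "norm w = r / p ^ n0 \<or> norm w = r / p ^ m" "w \<in> ball 0 R - {0}"
          using cl2[of w] cl by (auto simp: S_def)
        then have "w \<in> sector \<Lambda> \<epsilon> R" using r(3) by (auto simp: sector_iff)
        then show "norm (H w) \<le> B" by (rule H(3))
      qed
    qed
  qed
qed

end

subsection \<open>Taylor coefficients along a spiral\<close>

definition tcoeff :: "(complex \<Rightarrow> complex) \<Rightarrow> nat \<Rightarrow> complex" where
  "tcoeff g j = (deriv ^^ j) g 0 / fact j"

lemma has_fps_expansion_at_0: "g analytic_on {0} \<Longrightarrow> g has_fps_expansion fps_expansion g 0"
  unfolding analytic_at by blast

lemma tcoeff_eq_nth: "g has_fps_expansion G \<Longrightarrow> tcoeff g j = fps_nth G j"
  by (simp add: tcoeff_def fps_nth_fps_expansion)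

lemma tcoeff_cong:
  assumes "\<forall>\<^sub>F w in nhds 0. g w = h w"
  shows "tcoeff g j = tcoeff h j"
  unfolding tcoeff_def using higher_deriv_cong_ev[OF assms refl] by simp

lemma tcoeff_cmult:
  assumes "g analytic_on {0}"
  shows "tcoeff (\<lambda>w. c * g w) j = c * tcoeff g j"
proof -
  note g = has_fps_expansion_at_0[OF assms]
  show ?thesis
    unfolding tcoeff_eq_nth[OF has_fps_expansion_cmult_left[OF g]] tcoeff_eq_nth[OF g] by simp
qed

lemma tcoeff_add:
  assumes "g analytic_on {0}" "h analytic_on {0}"
  shows "tcoeff (\<lambda>w. g w + h w) j = tcoeff g j + tcoeff h j"
proof -
  note g = has_fps_expansion_at_0[OF assms(1)] and h = has_fps_expansion_at_0[OF assms(2)]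
  show ?thesis
    unfolding tcoeff_eq_nth[OF has_fps_expansion_add[OF g h]] tcoeff_eq_nth[OF g] tcoeff_eq_nth[OF h] by simp
qed

lemma tcoeff_mult:
  assumes "g analytic_on {0}" "h analytic_on {0}"
  shows "tcoeff (\<lambda>w. g w * h w) j = (\<Sum>i=0..j. tcoeff g i * tcoeff h (j - i))"
proof -
  note g = has_fps_expansion_at_0[OF assms(1)] and h = has_fps_expansion_at_0[OF assms(2)]
  show ?thesis
    unfolding tcoeff_eq_nth[OF has_fps_expansion_mult[OF g h]] tcoeff_eq_nth[OF g] tcoeff_eq_nth[OF h]
    by (rule fps_mult_nth)
qed

lemma tcoeff_power_mult:
  assumes "g analytic_on {0}"
  shows "tcoeff (\<lambda>w. w ^ c * g w) j = (if j < c then 0 else tcoeff g (j - c))"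
proof -
  note g = has_fps_expansion_at_0[OF assms(1)]
  have "(\<lambda>w. w ^ c * g w) has_fps_expansion fps_X ^ c * fps_expansion g 0"
    by (intro fps_expansion_intros g)
  then show ?thesis
    by (simp add: tcoeff_eq_nth[OF g] tcoeff_eq_nth fps_X_power_mult_nth)
qed

text \<open>Shifting the power series keeps \<open>h\<close> analytic, hence bounded near 0; this
  boundedness is what remains of a quotient after its principal part is removed.\<close>

lemma taylor_remainder:
  assumes "g analytic_on {0}"
  obtains h where "h analytic_on {0}"
    "\<forall>\<^sub>F w in nhds 0. g w = (\<Sum>j<n. tcoeff g j * w ^ j) + w ^ n * h w"
proof -
  note g = has_fps_expansion_at_0[OF assms(1)]
  define G where "G = fps_expansion g 0 - (\<Sum>j<n. fps_const (tcoeff g j) * fps_X ^ j)"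
  define f where "f = (\<lambda>w. g w - (\<Sum>j<n. tcoeff g j * w ^ j))"
  have f: "f has_fps_expansion G"
    unfolding f_def G_def by (intro fps_expansion_intros g)
  have "fps_nth G i = 0" if "i < n" for i
  proof -
    have "fps_nth (\<Sum>j<n. fps_const (tcoeff g j) * fps_X ^ j) i = (\<Sum>j<n. if i = j then tcoeff g j else 0)"
      by (simp add: fps_sum_nth fps_X_power_iff if_distrib cong: if_cong)
    also have "\<dots> = tcoeff g i" using that by simp
    finally show ?thesis unfolding G_def by (simp add: tcoeff_eq_nth[OF g])
  qed
  then have "fps_X ^ n * fps_shift n G = G"
    by (intro fps_ext) (auto simp: fps_X_power_mult_nth)
  define h where "h = eval_fps (fps_shift n G)"
  have "fps_conv_radius (fps_shift n G) > 0"
    using f by (auto simp: has_fps_expansion_def)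
  then have h: "h has_fps_expansion fps_shift n G"
    unfolding h_def by (rule eval_fps_has_fps_expansion)
  have "(\<lambda>w. w ^ n * h w) has_fps_expansion fps_X ^ n * fps_shift n G"
    by (intro fps_expansion_intros h)
  then have h': "(\<lambda>w. w ^ n * h w) has_fps_expansion G"
    unfolding \<open>fps_X ^ n * fps_shift n G = G\<close> .
  have "\<forall>\<^sub>F w in nhds 0. eval_fps G w = f w" "\<forall>\<^sub>F w in nhds 0. eval_fps G w = w ^ n * h w"
    using f h' by (auto simp: has_fps_expansion_def)
  then have "\<forall>\<^sub>F w in nhds 0. g w = (\<Sum>j<n. tcoeff g j * w ^ j) + w ^ n * h w"
    by eventually_elim (simp add: f_def algebra_simps)
  moreover have "h analytic_on {0}"
    using h has_fps_expansion_imp_analytic_0 by blast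
  ultimately show ?thesis using that by blast
qed

lemma tcoeff_cauchy:
  assumes "g holomorphic_on ball 0 r" "0 < \<rho>" "\<rho> < r" "\<And>w. norm w = \<rho> \<Longrightarrow> norm (g w) \<le> B"
  shows "norm (tcoeff g j) \<le> B / \<rho> ^ j"
proof -
  have "norm ((deriv ^^ j) g 0) \<le> fact j * B / \<rho> ^ j"
  proof (rule Cauchy_inequality)
    show "g holomorphic_on ball 0 \<rho>" using assms by (auto intro: holomorphic_on_subset)
    have "cball 0 \<rho> \<subseteq> ball (0::complex) r" using assms by auto
    then show "continuous_on (cball 0 \<rho>) g"
      using assms(1) holomorphic_on_imp_continuous_on continuous_on_subset by blast
  qed (use assms in auto)
  then show ?thesis
    by (simp add: tcoeff_def norm_divide divide_le_eq mult_ac)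
qed

lemma tcoeff_scaled:
  assumes "F analytic_on {\<xi>}" "\<xi> \<noteq> 0"
  shows "tcoeff (\<lambda>w. F (\<xi> * (1 + w))) j = \<xi> ^ j * (deriv ^^ j) F \<xi> / fact j"
proof -
  obtain r where r: "r > 0" "F holomorphic_on ball \<xi> r"
    using assms(1) by (auto simp: analytic_on_def)
  have "(deriv ^^ j) (\<lambda>w. F (\<xi> * w + \<xi>)) 0 = \<xi> ^ j * (deriv ^^ j) F (\<xi> * 0 + \<xi>)"
  proof (rule higher_deriv_compose_linear'[OF r(2), of "ball 0 (r / norm \<xi>)"])
    fix w :: complex assume "w \<in> ball 0 (r / norm \<xi>)"
    then have "norm (\<xi> * w) < r" using assms(2) by (simp add: norm_mult pos_less_divide_eq mult.commute)
    then show "\<xi> * w + \<xi> \<in> ball \<xi> r" by (simp add: dist_norm)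
  qed (use r assms in auto)
  then show ?thesis by (simp add: tcoeff_def distrib_left add.commute)
qed

section \<open>Calculus of growth orders of sequences indexed by the points of a spiral\<close>

context q_theta
begin

text \<open>The estimate of \<open>gevrey_over\<close> for an arbitrary sequence. The order is real
  because negative orders occur as well, for reciprocals of theta factors and for principal
  parts.\<close>

definition growth :: "real \<Rightarrow> (nat \<Rightarrow> complex) \<Rightarrow> bool" where
  "growth k x \<longleftrightarrow> (\<exists>C>0. \<exists>A>0. \<forall>\<^sub>F n in sequentially. norm (x n) \<le> C * A ^ n * p powr (k * (real n)\<^sup>2 / 2))"

lemma growthI:
  assumes "0 < C" "0 < A" "\<And>n. n \<ge> N \<Longrightarrow> norm (x n) \<le> C * A ^ n * p powr (k * (real n)\<^sup>2 / 2)"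
  shows "growth k x"
  unfolding growth_def using assms by (auto simp: eventually_sequentially)

text \<open>The constants are enlarged to at least 1, so that bounds with different constants can be
  combined by monotonicity.\<close>

lemma growthE:
  assumes "growth k x"
  obtains C A N where "1 \<le> C" "1 \<le> A" "\<And>n. n \<ge> N \<Longrightarrow> norm (x n) \<le> C * A ^ n * p powr (k * (real n)\<^sup>2 / 2)"
proof -
  obtain C A N where CA: "0 < C" "0 < A" "\<And>n. n \<ge> N \<Longrightarrow> norm (x n) \<le> C * A ^ n * p powr (k * (real n)\<^sup>2 / 2)"
    using assms unfolding growth_def eventually_sequentially by metis
  have "norm (x n) \<le> max 1 C * max 1 A ^ n * p powr (k * (real n)\<^sup>2 / 2)" if "n \<ge> N" for n
  proof -
    have "C * A ^ n * p powr (k * (real n)\<^sup>2 / 2) \<le> max 1 C * max 1 A ^ n * p powr (k * (real n)\<^sup>2 / 2)"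
      using CA by (intro mult_right_mono mult_mono power_mono) auto
    then show ?thesis using CA(3)[OF that] by linarith
  qed
  then show ?thesis by (intro that[of "max 1 C" "max 1 A" N]) auto
qed

lemma growth_le:
  assumes "growth k y" "\<And>n. n \<ge> N \<Longrightarrow> norm (x n) \<le> norm (y n)"
  shows "growth k x"
proof -
  obtain C A M where CA: "1 \<le> C" "1 \<le> A" "\<And>n. n \<ge> M \<Longrightarrow> norm (y n) \<le> C * A ^ n * p powr (k * (real n)\<^sup>2 / 2)"
    using growthE[OF assms(1)] by metis
  show ?thesis
  proof (rule growthI[of C A "max N M"])
    fix n assume "n \<ge> max N M"
    then show "norm (x n) \<le> C * A ^ n * p powr (k * (real n)\<^sup>2 / 2)"
      using assms(2)[of n] CA(3)[of n] by simp
  qed (use CA in auto)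
qed

lemma growth_cong:
  assumes "growth k y" "\<And>n. n \<ge> N \<Longrightarrow> x n = y n"
  shows "growth k x"
  using assms(1) by (rule growth_le[where N = N]) (simp add: assms(2))

lemma growth_mono:
  assumes "growth k x" "k \<le> k'"
  shows "growth k' x"
proof -
  obtain C A M where CA: "1 \<le> C" "1 \<le> A" "\<And>n. n \<ge> M \<Longrightarrow> norm (x n) \<le> C * A ^ n * p powr (k * (real n)\<^sup>2 / 2)"
    using growthE[OF assms(1)] by metis
  show ?thesis
  proof (rule growthI[of C A M])
    fix n assume "n \<ge> M"
    then have "norm (x n) \<le> C * A ^ n * p powr (k * (real n)\<^sup>2 / 2)" by (rule CA)
    also have "\<dots> \<le> C * A ^ n * p powr (k' * (real n)\<^sup>2 / 2)"
      using CA assms(2) q_gt_1 by (intro mult_left_mono powr_mono divide_right_mono mult_right_mono) auto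
    finally show "norm (x n) \<le> C * A ^ n * p powr (k' * (real n)\<^sup>2 / 2)" .
  qed (use CA in auto)
qed

lemma growth_add:
  assumes "growth k x" "growth k y"
  shows "growth k (\<lambda>n. x n + y n)"
proof -
  obtain C A M where CA: "1 \<le> C" "1 \<le> A" "\<And>n. n \<ge> M \<Longrightarrow> norm (x n) \<le> C * A ^ n * p powr (k * (real n)\<^sup>2 / 2)"
    using growthE[OF assms(1)] by metis
  obtain C' A' M' where CA': "1 \<le> C'" "1 \<le> A'" "\<And>n. n \<ge> M' \<Longrightarrow> norm (y n) \<le> C' * A' ^ n * p powr (k * (real n)\<^sup>2 / 2)"
    using growthE[OF assms(2)] by metis
  show ?thesis
  proof (rule growthI[of "C + C'" "A * A'" "max M M'"])
    fix n assume n: "n \<ge> max M M'"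
    define P where "P = p powr (k * (real n)\<^sup>2 / 2)"
    have P: "0 \<le> P" by (simp add: P_def)
    have "norm (x n + y n) \<le> C * A ^ n * P + C' * A' ^ n * P"
      using CA(3)[of n] CA'(3)[of n] n norm_triangle_ineq[of "x n" "y n"] unfolding P_def by simp
    also have "C * A ^ n * P \<le> C * (A * A') ^ n * P"
      using CA CA' P by (intro mult_left_mono mult_right_mono power_mono) auto
    also have "C' * A' ^ n * P \<le> C' * (A * A') ^ n * P"
      using CA CA' P by (intro mult_left_mono mult_right_mono power_mono) auto
    finally show "norm (x n + y n) \<le> (C + C') * (A * A') ^ n * p powr (k * (real n)\<^sup>2 / 2)"
      unfolding P_def by (simp add: algebra_simps)
  qed (use CA CA' in auto)
qed

lemma growth_mult:
  assumes "growth k x" "growth l y"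
  shows "growth (k + l) (\<lambda>n. x n * y n)"
proof -
  obtain C A M where CA: "1 \<le> C" "1 \<le> A" "\<And>n. n \<ge> M \<Longrightarrow> norm (x n) \<le> C * A ^ n * p powr (k * (real n)\<^sup>2 / 2)"
    using growthE[OF assms(1)] by metis
  obtain C' A' M' where CA': "1 \<le> C'" "1 \<le> A'" "\<And>n. n \<ge> M' \<Longrightarrow> norm (y n) \<le> C' * A' ^ n * p powr (l * (real n)\<^sup>2 / 2)"
    using growthE[OF assms(2)] by metis
  show ?thesis
  proof (rule growthI[of "C * C'" "A * A'" "max M M'"])
    fix n assume n: "n \<ge> max M M'"
    have "norm (x n * y n) \<le> (C * A ^ n * p powr (k * (real n)\<^sup>2 / 2)) * (C' * A' ^ n * p powr (l * (real n)\<^sup>2 / 2))"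
      unfolding norm_mult using CA CA' n by (intro mult_mono) auto
    also have "\<dots> = C * C' * (A * A') ^ n * p powr ((k + l) * (real n)\<^sup>2 / 2)"
      by (simp add: power_mult_distrib powr_add[symmetric] add_divide_distrib distrib_right)
    finally show "norm (x n * y n) \<le> C * C' * (A * A') ^ n * p powr ((k + l) * (real n)\<^sup>2 / 2)" .
  qed (use CA CA' in \<open>auto intro: mult_pos_pos\<close>)
qed

lemma growth_geometric: "growth 0 (\<lambda>n. c * b ^ n)"
proof (rule growthI[of "norm c + 1" "norm b + 1" 0])
  fix n
  have "norm (c * b ^ n) \<le> (norm c + 1) * (norm b + 1) ^ n"
    unfolding norm_mult norm_power by (intro mult_mono power_mono) auto
  then show "norm (c * b ^ n) \<le> (norm c + 1) * (norm b + 1) ^ n * p powr (0 * (real n)\<^sup>2 / 2)"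
    by simp
qed (auto intro: add_nonneg_pos)

lemma growth_zero: "growth k (\<lambda>n. 0)"
  by (rule growthI[of 1 1 0]) auto

lemma growth_mult_geometric:
  assumes "growth k x"
  shows "growth k (\<lambda>n. c * b ^ n * x n)"
  using growth_mult[OF growth_geometric assms] by simp

lemma growth_cmult: "growth k x \<Longrightarrow> growth k (\<lambda>n. c * x n)"
  using growth_mult_geometric[of k x c 1] by simp

lemma growth_sum:
  assumes "finite I" "\<And>i. i \<in> I \<Longrightarrow> growth k (x i)"
  shows "growth k (\<lambda>n. \<Sum>i\<in>I. x i n)"
  using assms by (induction I rule: finite_induct) (auto intro: growth_zero growth_add)

lemma p_powr_power: "(p powr x) ^ n = p powr (x * real n)"
  by (simp add: powr_power mult.commute)

text \<open>Since n(n-1)/2 = n^2/2 - n/2, the triangular exponent differs from the quadratic one by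
  a linear term, which goes into the geometric factor.\<close>

lemma growth_triangular:
  "growth (real k) (\<lambda>n. q ^ (k * (n * (n - 1) div 2)))"
  "growth (- real k) (\<lambda>n. 1 / q ^ (k * (n * (n - 1) div 2)))"
proof -
  have T: "real (n * (n - 1) div 2) = (real n)\<^sup>2 / 2 - real n / 2" for n
  proof -
    have "even (n * (n - 1))" by auto
    then have "real (n * (n - 1) div 2) = real (n * (n - 1)) / 2"
      by (simp add: real_of_nat_div)
    then show ?thesis
      by (cases n) (auto simp: power2_eq_square algebra_simps diff_divide_distrib add_divide_distrib)
  qed
  have e: "p ^ (k * (n * (n - 1) div 2)) = (p powr (- real k / 2)) ^ n * p powr (real k * (real n)\<^sup>2 / 2)" for n
  proof -
    have "p ^ (k * (n * (n - 1) div 2)) = p powr (real k * ((real n)\<^sup>2 / 2 - real n / 2))"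
      by (simp only: powr_realpow[symmetric, OF p_pos] of_nat_mult T)
    also have "real k * ((real n)\<^sup>2 / 2 - real n / 2) = (- real k / 2) * real n + real k * (real n)\<^sup>2 / 2"
      by (simp add: algebra_simps)
    finally show ?thesis
      by (simp only: powr_add p_powr_power)
  qed
  show "growth (real k) (\<lambda>n. q ^ (k * (n * (n - 1) div 2)))"
    by (rule growthI[of 1 "p powr (- real k / 2)" 0]) (simp_all only: norm_power e mult_1_left order_refl, simp_all)
  have e': "1 / p ^ (k * (n * (n - 1) div 2)) = (p powr (real k / 2)) ^ n * p powr (- real k * (real n)\<^sup>2 / 2)" for n
    unfolding e by (simp add: powr_minus field_simps power_inverse power_one_over)
  show "growth (- real k) (\<lambda>n. 1 / q ^ (k * (n * (n - 1) div 2)))"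
  proof (rule growthI[of 1 "p powr (real k / 2)" 0])
    fix n
    show "norm (1 / q ^ (k * (n * (n - 1) div 2))) \<le> 1 * (p powr (real k / 2)) ^ n * p powr (- real k * (real n)\<^sup>2 / 2)"
      by (simp only: norm_divide norm_power norm_one e' mult_1_left)
  qed simp_all
qed

lemma gauss_div_power:
  assumes "x \<noteq> 0"
  shows "gauss (x / q ^ n) = p ^ (n * (n - 1) div 2) / norm x ^ n * gauss x"
proof (induction n)
  case (Suc n)
  have "Suc n * (Suc n - 1) = n * (n - 1) + n * 2"
    by (cases n) (auto simp: algebra_simps)
  then have t: "Suc n * (Suc n - 1) div 2 = n * (n - 1) div 2 + n" by simp
  have "gauss (x / q ^ n) = gauss (q * (x / q ^ Suc n))" by simp
  also have "\<dots> = p * norm (x / q ^ Suc n) * gauss (x / q ^ Suc n)"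
    using assms by (intro gauss_scale) auto
  also have "\<dots> = norm x / p ^ n * gauss (x / q ^ Suc n)"
    by (simp add: norm_divide norm_mult norm_power)
  finally have "gauss (x / q ^ Suc n) = p ^ n / norm x * gauss (x / q ^ n)"
    using assms by (simp add: field_simps)
  then show ?case unfolding Suc t by (simp add: power_add)
qed simp

text \<open>For |w| \<le> 1/2 the point \<open>l * (1 + w)\<close> stays in a compact set off 0. By
  \<open>gauss_div_power\<close>, dividing it by \<open>q ^ n\<close> multiplies the
  \<open>k\<close>-th power of \<open>gauss\<close> by a triangular power of \<open>p\<close> and a
  geometric factor.\<close>

lemma gauss_near_spiral:
  assumes "l \<noteq> 0"
  obtains C A where "0 < C" "0 < A"
    "\<And>n w. norm w \<le> 1/2 \<Longrightarrow> norm (l / q ^ n * (1 + w)) powr a * gauss (l / q ^ n * (1 + w)) ^ k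
        \<le> C * A ^ n * p powr (real k * (real n)\<^sup>2 / 2)"
proof -
  define S where "S = cball 0 (2 * norm l) - ball (0::complex) (norm l / 2)"
  have S: "compact S" unfolding S_def by (intro compact_diff) auto
  have S0: "S \<subseteq> - {0}" using assms by (auto simp: S_def)
  have "continuous_on S (\<lambda>x. norm x powr a * gauss x ^ k)"
    using S0 by (intro continuous_intros continuous_on_subset[OF gauss_continuous S0]) auto
  then have "bounded ((\<lambda>x. norm x powr a * gauss x ^ k) ` S)"
    by (intro compact_imp_bounded compact_continuous_image S)
  then obtain K where K: "0 < K" "\<And>x. x \<in> S \<Longrightarrow> norm x powr a * gauss x ^ k \<le> K"
    unfolding bounded_pos by fastforce
  obtain C A N where CA: "1 \<le> C" "1 \<le> A" "\<And>n. n \<ge> N \<Longrightarrow> norm (q ^ (k * (n * (n - 1) div 2))) \<le> C * A ^ n * p powr (real k * (real n)\<^sup>2 / 2)"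
    using growthE[OF growth_triangular(1)] by metis
  have T: "p ^ (k * (n * (n - 1) div 2)) \<le> p powr (real k * (real n)\<^sup>2 / 2)" for n
  proof -
    have "k * (n * (n - 1) div 2) * 2 \<le> k * (n * n)" by (simp add: mult_le_mono) (metis div_times_less_eq_dividend le_trans mult_le_mono2 diff_le_self mult.assoc)
    then have "real (k * (n * (n - 1) div 2)) \<le> real k * (real n)\<^sup>2 / 2"
      unfolding power2_eq_square of_nat_mult[symmetric] by linarith
    then show ?thesis
      using q_gt_1 by (simp only: powr_realpow[symmetric, OF p_pos]) (intro powr_mono, auto)
  qed
  define A where "A = (p powr (- a)) * (2 / norm l) ^ k"
  have "norm (l / q ^ n * (1 + w)) powr a * gauss (l / q ^ n * (1 + w)) ^ k \<le> K * A ^ n * p powr (real k * (real n)\<^sup>2 / 2)"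
    if w: "norm w \<le> 1/2" for n w
  proof -
    define x where "x = l * (1 + w)"
    have "norm (1 + w) \<le> 3/2" using w norm_triangle_ineq[of 1 w] by simp
    moreover have n1: "1/2 \<le> norm (1 + w)" using w norm_triangle_ineq2[of 1 "- w"] by simp
    ultimately have nx: "norm l / 2 \<le> norm x" "norm x \<le> 2 * norm l"
      using assms unfolding x_def norm_mult by (auto simp: mult_left_mono)
    have "x \<in> S" using nx unfolding S_def by auto
    then have "x \<noteq> 0" using S0 by auto
    have e: "l / q ^ n * (1 + w) = x / q ^ n" by (simp add: x_def)
    have "norm (x / q ^ n) powr a * gauss (x / q ^ n) ^ k
       = (norm x powr a * gauss x ^ k) * ((p powr (- a)) ^ n * (1 / norm x) ^ (k * n)) * p ^ (k * (n * (n - 1) div 2))"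
    proof -
      have "norm (x / q ^ n) powr a = norm x powr a * (p powr (- a)) ^ n"
      proof -
        have "(p ^ n) powr a = p powr (a * real n)"
          by (simp add: powr_realpow[symmetric] powr_powr mult.commute)
        moreover have "(p powr (- a)) ^ n = 1 / p powr (a * real n)"
          unfolding p_powr_power by (simp add: powr_minus divide_inverse)
        ultimately show ?thesis by (simp add: norm_divide norm_power powr_divide)
      qed
      then show ?thesis
        unfolding gauss_div_power[OF \<open>x \<noteq> 0\<close>]
        by (simp add: power_mult_distrib power_divide power_mult[symmetric] mult_ac)
    qed
    also have "\<dots> \<le> K * ((p powr (- a)) ^ n * (2 / norm l) ^ (k * n)) * p powr (real k * (real n)\<^sup>2 / 2)"
    proof (intro mult_mono power_mono)
      show "1 / norm x \<le> 2 / norm l"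
        using nx assms \<open>x \<noteq> 0\<close> by (simp add: field_simps)
    qed (use K \<open>x \<in> S\<close> T gauss_pos[OF \<open>x \<noteq> 0\<close>] in auto)
    also have "(p powr (- a)) ^ n * (2 / norm l) ^ (k * n) = A ^ n"
      by (simp add: A_def power_mult_distrib power_mult)
    finally show ?thesis unfolding e .
  qed
  moreover have "A > 0" using assms by (simp add: A_def)
  ultimately show ?thesis using K(1) that by blast
qed

lemma div_power_small:
  assumes "0 < R"
  obtains N where "\<And>n. n \<ge> N \<Longrightarrow> c / p ^ n < R"
proof -
  have "(\<lambda>n. c * (1 / p) ^ n) \<longlonglongrightarrow> c * 0"
    using inv_q_lt_1 by (intro tendsto_intros LIMSEQ_realpow_zero) (auto simp: norm_divide)
  then have "\<forall>\<^sub>F n in sequentially. c * (1 / p) ^ n < R"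
    using assms by (intro order_tendstoD(2)) auto
  then show ?thesis
    using that by (auto simp: eventually_sequentially power_divide)
qed

lemma near_spiral_punctured:
  assumes "l \<noteq> 0" "norm l * 2 / p ^ n < R" "norm w < 1"
  shows "l / q ^ n * (1 + w) \<in> ball 0 R - {0}"
proof -
  have "norm (1 + w) \<le> 2" using assms(3) norm_triangle_ineq[of 1 w] by simp
  then have "norm (l / q ^ n * (1 + w)) \<le> norm l * 2 / p ^ n"
    using assms(1) by (simp add: norm_mult norm_divide norm_power divide_right_mono mult_left_mono)
  moreover have "1 + w \<noteq> 0"
    using assms(3) by (metis add_eq_0_iff norm_minus_cancel norm_one less_irrefl)
  ultimately show ?thesis using assms by auto
qed

lemma scaled_holomorphic:
  assumes "F holomorphic_on ball 0 R - {0}" "l \<noteq> 0" "norm l * 2 / p ^ n < R"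
  shows "(\<lambda>w. F (l / q ^ n * (1 + w))) holomorphic_on ball 0 1"
proof -
  have "(F \<circ> (\<lambda>w. l / q ^ n * (1 + w))) holomorphic_on ball 0 1"
  proof (rule holomorphic_on_compose_gen[OF _ assms(1)])
    show "(\<lambda>w. l / q ^ n * (1 + w)) ` ball 0 1 \<subseteq> ball 0 R - {0}"
      using near_spiral_punctured[OF assms(2,3)] by auto
  qed (intro holomorphic_intros)
  then show ?thesis by (simp add: o_def)
qed

text \<open>Cauchy's estimate on the circle |w| = 1/2 around every point of the spiral: order
  \<open>k\<close> at 0 implies order \<open>k\<close> for derivatives of all orders along every
  spiral.\<close>

lemma tcoeff_growth_of_bound:
  assumes "F holomorphic_on ball 0 R - {0}" "0 < R" "l \<noteq> 0"
    and "\<And>z. 0 < norm z \<Longrightarrow> norm z < R \<Longrightarrow> norm (F z) \<le> B * norm z powr a * gauss z ^ k"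
  shows "growth k (\<lambda>n. tcoeff (\<lambda>w. F (l / q ^ n * (1 + w))) j)"
proof -
  obtain C A where CA: "0 < C" "0 < A"
    "\<And>n w. norm w \<le> 1/2 \<Longrightarrow> norm (l / q ^ n * (1 + w)) powr a * gauss (l / q ^ n * (1 + w)) ^ k
        \<le> C * A ^ n * p powr (real k * (real n)\<^sup>2 / 2)"
    using gauss_near_spiral[OF assms(3)] by metis
  obtain N where N: "\<And>n. n \<ge> N \<Longrightarrow> norm l * 2 / p ^ n < R"
    using div_power_small[OF assms(2)] by metis
  \<comment> \<open>\<open>B\<close> may be nonpositive, while the constant of a growth bound has to
    be positive; hence |B| + 1.\<close>
  show ?thesis
  proof (rule growthI[of "(\<bar>B\<bar> + 1) * C / (1/2) ^ j" A N])
    fix n assume n: "n \<ge> N"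
    have "norm (F (l / q ^ n * (1 + w))) \<le> (\<bar>B\<bar> + 1) * (C * A ^ n * p powr (real k * (real n)\<^sup>2 / 2))"
      if "norm w = 1/2" for w
    proof -
      define z where "z = l / q ^ n * (1 + w)"
      have z: "0 < norm z" "norm z < R"
        using near_spiral_punctured[OF assms(3) N[OF n], of w] that unfolding z_def by auto
      have "norm (F z) \<le> B * (norm z powr a * gauss z ^ k)" using assms(4)[OF z] by (simp add: mult_ac)
      also have "\<dots> \<le> (\<bar>B\<bar> + 1) * (norm z powr a * gauss z ^ k)"
        using z gauss_pos[of z] by (intro mult_right_mono) auto
      also have "\<dots> \<le> (\<bar>B\<bar> + 1) * (C * A ^ n * p powr (real k * (real n)\<^sup>2 / 2))"
        unfolding z_def using that by (intro mult_left_mono CA(3)) auto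
      finally show ?thesis unfolding z_def .
    qed
    then have "norm (tcoeff (\<lambda>w. F (l / q ^ n * (1 + w))) j) \<le> (\<bar>B\<bar> + 1) * (C * A ^ n * p powr (real k * (real n)\<^sup>2 / 2)) / (1/2) ^ j"
      by (intro tcoeff_cauchy[OF scaled_holomorphic[OF assms(1,3) N[OF n]]]) auto
    then show "norm (tcoeff (\<lambda>w. F (l / q ^ n * (1 + w))) j) \<le> (\<bar>B\<bar> + 1) * C / (1/2) ^ j * A ^ n * p powr (real k * (real n)\<^sup>2 / 2)"
      by (simp add: mult_ac)
  qed (use CA in \<open>auto intro!: mult_pos_pos\<close>)
qed

lemma theta_div_tcoeff_growth:
  assumes "reps rep \<Lambda>" "l \<noteq> 0"
  shows "growth (size \<Lambda>) (\<lambda>n. tcoeff (\<lambda>w. theta_div q rep \<Lambda> (l / q ^ n * (1 + w))) j)"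
proof -
  obtain c C b where A: "0 < c" "0 < C"
    "\<And>z. z \<noteq> 0 \<Longrightarrow> c * norm z powr b * gauss z ^ size \<Lambda> * dist_div z \<Lambda> \<le> norm (theta_div q rep \<Lambda> z) \<and>
        norm (theta_div q rep \<Lambda> z) \<le> C * norm z powr b * gauss z ^ size \<Lambda> * dist_div z \<Lambda>"
    using theta_div_bounds[OF assms(1)] by metis
  show ?thesis
  proof (rule tcoeff_growth_of_bound[OF _ zero_less_one assms(2)])
    show "theta_div q rep \<Lambda> holomorphic_on ball 0 1 - {0}"
      by (rule holomorphic_on_subset[OF theta_div_holomorphic[OF assms(1)]]) auto
    fix z :: complex assume "0 < norm z"
    then have z: "z \<noteq> 0" by auto
    have "norm (theta_div q rep \<Lambda> z) \<le> C * norm z powr b * gauss z ^ size \<Lambda> * dist_div z \<Lambda>"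
      using A(3)[OF z] by blast
    also have "\<dots> \<le> C * norm z powr b * gauss z ^ size \<Lambda> * 1"
      using A(2) gauss_pos[OF z] dist_div_bounds[OF assms(1), of z] by (intro mult_left_mono) auto
    finally show "norm (theta_div q rep \<Lambda> z) \<le> C * norm z powr b * gauss z ^ size \<Lambda>" by simp
  qed
qed

text \<open>In the coordinate \<open>w\<close> the j-th derivative at \<open>l / q ^ n\<close> is
  multiplied by \<open>l ^ j / q ^ (n * j)\<close> and divided by j!. This is geometric in
  \<open>n\<close>, so the order is unchanged, and derivatives may be replaced by Taylor
  coefficients, to which the Cauchy product applies.\<close>

lemma gevrey_over_iff:
  assumes "F holomorphic_on ball 0 R - {0}" "0 < R" "reps rep \<Lambda>"
  shows "gevrey_over q rep k \<Lambda> \<Lambda>' F \<longleftrightarrow>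
    (\<forall>s\<in>#\<Lambda>. \<forall>j. count \<Lambda>' s \<le> j \<and> j < count \<Lambda> s \<longrightarrow>
       growth (real k) (\<lambda>n. tcoeff (\<lambda>w. F (rep s / q ^ n * (1 + w))) j))"
proof -
  have "growth (real k) (\<lambda>n. tcoeff (\<lambda>w. F (l / q ^ n * (1 + w))) j) \<longleftrightarrow>
     (\<exists>C>0. \<exists>A>0. \<forall>\<^sub>F n in sequentially.
           norm ((deriv ^^ j) F (l * q powi (- int n))) \<le> C * A ^ n * p powr (real k * (real n)\<^sup>2 / 2))"
    if l: "l \<noteq> 0" for l j
  proof -
    obtain N where N: "\<And>n. n \<ge> N \<Longrightarrow> norm l * 2 / p ^ n < R"
      using div_power_small[OF assms(2)] by metis
    have e: "l * q powi (- int n) = l / q ^ n" for n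
      by (simp add: power_int_minus divide_inverse)
    define d where "d n = (deriv ^^ j) F (l / q ^ n)" for n
    define t where "t n = tcoeff (\<lambda>w. F (l / q ^ n * (1 + w))) j" for n
    have td: "t n = (l ^ j / fact j) * (1 / q ^ j) ^ n * d n" if "n \<ge> N" for n
    proof -
      have "l / q ^ n * (1 + 0) \<in> ball 0 R - {0}"
        by (rule near_spiral_punctured[OF l N[OF that]]) simp
      then have "F analytic_on {l / q ^ n}"
        using assms(1) by (intro holomorphic_on_imp_analytic_at[of _ "ball 0 R - {0}"]) auto
      then have "t n = (l / q ^ n) ^ j * d n / fact j"
        unfolding t_def d_def using l by (intro tcoeff_scaled) auto
      then show ?thesis by (simp add: power_divide power_mult[symmetric] mult.commute)
    qed
    then have dt: "d n = (fact j / l ^ j) * (q ^ j) ^ n * t n" if "n \<ge> N" for n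
      using that l by (simp add: power_divide)
    have "growth (real k) t \<longleftrightarrow> growth (real k) d"
      by (rule iffI; rule growth_cong[OF growth_mult_geometric]) (assumption | rule dt td)+
    then show ?thesis unfolding e t_def d_def growth_def .
  qed
  moreover have "rep s \<noteq> 0" if "s \<in># \<Lambda>" for s
    using assms(3) that by (auto simp: reps_def)
  ultimately show ?thesis
    unfolding gevrey_over_def by simp
qed

text \<open>The behaviour along the whole spiral is obtained from that at \<open>l\<close> by
  \<open>theta_div_scale_power\<close>. The radius \<delta> does not depend on \<open>n\<close>, and
  all quadratic exponents are in \<kappa>, whose reciprocal is controlled too. This makes both
  multiplication and division by the theta product traceable on Taylor coefficients.\<close>

lemma theta_normal_form:
  assumes "reps rep \<Lambda>" "l \<noteq> 0" "s = spiral q l" "s \<in># \<Lambda> \<Longrightarrow> l = rep s"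
  obtains \<delta> \<kappa> Z where "0 < \<delta>" "\<delta> < 1" "\<And>n. \<kappa> n \<noteq> 0" "growth (size \<Lambda>) \<kappa>" "growth (- real (size \<Lambda>)) (\<lambda>n. 1 / \<kappa> n)"
    "\<And>n. Z n holomorphic_on ball 0 \<delta>" "\<And>n w. norm w < \<delta> \<Longrightarrow> Z n w \<noteq> 0" "\<And>j. growth 0 (\<lambda>n. tcoeff (Z n) j)"
    "\<And>n w. norm w < \<delta> \<Longrightarrow> theta_div q rep \<Lambda> (l / q ^ n * (1 + w)) * Z n w = \<kappa> n * w ^ count \<Lambda> s"
proof -
  define k where "k = size \<Lambda>"
  obtain V where V: "V analytic_on {0}" "V 0 \<noteq> 0"
    "\<And>w. w \<noteq> -1 \<Longrightarrow> theta_div q rep \<Lambda> (l * (1 + w)) = w ^ count \<Lambda> s * V w"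
    using theta_div_local_factor[OF assms] by metis
  obtain \<beta> where \<beta>: "\<beta> \<noteq> 0" "\<And>x n. x \<noteq> 0 \<Longrightarrow> theta_div q rep \<Lambda> (x / q ^ n) * (\<beta> * x ^ k) ^ n
           = q ^ (k * (n * (n - 1) div 2)) * theta_div q rep \<Lambda> x"
    using theta_div_scale_power[OF assms(1)] unfolding k_def by metis
  obtain r0 where r0: "r0 > 0" "V holomorphic_on ball 0 r0"
    using V(1) by (auto simp: analytic_on_def)
  have "isCont V 0" using V(1) by (rule analytic_at_imp_isCont)
  then have "\<forall>\<^sub>F w in nhds 0. V w \<noteq> 0"
    using V(2) by (simp add: isCont_def tendsto_imp_eventually_ne eventually_nhds_conv_at)
  then obtain r1 where r1: "r1 > 0" "\<And>w. norm w < r1 \<Longrightarrow> V w \<noteq> 0"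
    unfolding eventually_nhds_metric by auto
  \<comment> \<open>1/2 keeps \<open>1 + w\<close> nonzero, \<open>r0\<close> keeps \<open>V\<close>
    holomorphic and \<open>r1\<close> keeps it nonzero.\<close>
  define \<delta> where "\<delta> = min (1/2) (min r0 r1)"
  have \<delta>: "0 < \<delta>" "\<delta> < 1" "\<delta> \<le> r0" "\<delta> \<le> r1" using r0 r1 by (auto simp: \<delta>_def)
  \<comment> \<open>Inserting x = l(1 + w) into the scaling formula splits the factor (\<beta>
    x^k)^n: its constant part goes into \<kappa>, the part (1 + w)^(kn) into
    \<open>Z\<close>.\<close>
  define \<kappa> where "\<kappa> n = q ^ (k * (n * (n - 1) div 2)) / (\<beta> * l ^ k) ^ n" for n
  define Z where "Z n w = (1 + w) ^ (k * n) / V w" for n w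
  have V_hol: "V holomorphic_on ball 0 \<delta>"
    by (rule holomorphic_on_subset[OF r0(2)]) (use \<delta> in auto)
  have Vnz: "V w \<noteq> 0" if "w \<in> ball 0 \<delta>" for w
    using r1(2)[of w] that \<delta>(4) by simp
  have Z_hol: "Z n holomorphic_on ball 0 \<delta>" for n
    unfolding Z_def by (intro holomorphic_intros V_hol) (rule Vnz)
  have w1: "1 + w \<noteq> 0" if "norm w < \<delta>" for w :: complex
    using that \<delta> by (metis add_eq_0_iff norm_minus_cancel norm_one less_asym)
  show ?thesis
  proof (rule that[OF \<delta>(1,2), of \<kappa> Z])
    show "\<kappa> n \<noteq> 0" for n using \<beta> assms(2) by (simp add: \<kappa>_def)
    have "growth k (\<lambda>n. 1 * (1 / (\<beta> * l ^ k)) ^ n * q ^ (k * (n * (n - 1) div 2)))"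
      by (intro growth_mult_geometric growth_triangular)
    then show "growth (size \<Lambda>) \<kappa>"
      unfolding k_def[symmetric] by (rule growth_cong[where N = 0]) (simp add: \<kappa>_def power_divide)
    have "growth (- real k) (\<lambda>n. 1 * (\<beta> * l ^ k) ^ n * (1 / q ^ (k * (n * (n - 1) div 2))))"
      by (intro growth_mult_geometric growth_triangular)
    then show "growth (- real (size \<Lambda>)) (\<lambda>n. 1 / \<kappa> n)"
      unfolding k_def[symmetric] by (rule growth_cong[where N = 0]) (simp add: \<kappa>_def)
    show "Z n w \<noteq> 0" if "norm w < \<delta>" for n w
      using w1[OF that] Vnz[of w] that by (simp add: Z_def)
    show "theta_div q rep \<Lambda> (l / q ^ n * (1 + w)) * Z n w = \<kappa> n * w ^ count \<Lambda> s" if "norm w < \<delta>" for n w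
    proof -
      define x where "x = l * (1 + w)"
      have "x \<noteq> 0" using assms(2) w1[OF that] by (simp add: x_def)
      have "w \<noteq> -1" using w1[OF that] by (auto simp: add_eq_0_iff)
      have "theta_div q rep \<Lambda> (x / q ^ n) * (1 + w) ^ (k * n) * (\<beta> * l ^ k) ^ n = theta_div q rep \<Lambda> (x / q ^ n) * (\<beta> * x ^ k) ^ n"
        by (simp add: x_def power_mult_distrib power_mult[symmetric] mult_ac)
      also have "\<dots> = q ^ (k * (n * (n - 1) div 2)) * (w ^ count \<Lambda> s * V w)"
        using \<beta>(2)[OF \<open>x \<noteq> 0\<close>] V(3)[OF \<open>w \<noteq> -1\<close>] by (simp add: x_def)
      finally show ?thesis
        using Vnz[of w] that \<beta>(1) assms(2) by (simp add: Z_def \<kappa>_def x_def field_simps)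
    qed
    show "growth 0 (\<lambda>n. tcoeff (Z n) j)" for j
    proof -
      define S where "S = sphere (0::complex) (\<delta> / 2)"
      have "S \<subseteq> ball 0 \<delta>" using \<delta> by (auto simp: S_def)
      have "continuous_on S (\<lambda>w. 1 / V w)"
        using \<open>S \<subseteq> ball 0 \<delta>\<close> Vnz
        by (intro continuous_intros continuous_on_subset[OF holomorphic_on_imp_continuous_on[OF V_hol]]) auto
      then have "bounded ((\<lambda>w. 1 / V w) ` S)"
        by (intro compact_imp_bounded compact_continuous_image) (simp_all add: S_def)
      then obtain B where B: "0 < B" "\<And>w. w \<in> S \<Longrightarrow> norm (1 / V w) \<le> B"
        unfolding bounded_pos by auto
      show ?thesis
      proof (rule growthI[of "B / (\<delta> / 2) ^ j" "2 ^ k" 0])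
        fix n
        have "norm (Z n w) \<le> (2 ^ k) ^ n * B" if "norm w = \<delta> / 2" for w
        proof -
          have "norm (1 + w) \<le> 2" using norm_triangle_ineq[of 1 w] that \<delta> by simp
          then have "norm (1 + w) ^ (k * n) \<le> 2 ^ (k * n)" by (intro power_mono) auto
          moreover have "norm (1 / V w) \<le> B" using B(2) that by (simp add: S_def)
          ultimately have "norm (1 + w) ^ (k * n) * norm (1 / V w) \<le> 2 ^ (k * n) * B"
            using B(1) by (intro mult_mono) auto
          then show ?thesis by (simp add: Z_def norm_divide norm_power power_mult)
        qed
        then have "norm (tcoeff (Z n) j) \<le> (2 ^ k) ^ n * B / (\<delta> / 2) ^ j"
          using \<delta> by (intro tcoeff_cauchy[OF Z_hol]) auto
        then show "norm (tcoeff (Z n) j) \<le> B / (\<delta> / 2) ^ j * (2 ^ k) ^ n * p powr (0 * (real n)\<^sup>2 / 2)"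
          using \<delta> by (simp add: mult_ac)
      qed (use B \<delta> in auto)
    qed
  qed (rule Z_hol)
qed

lemma theta_div_tcoeff_zero:
  assumes "reps rep \<Lambda>" "l \<noteq> 0" "s = spiral q l" "l = rep s" "j < count \<Lambda> s"
  shows "tcoeff (\<lambda>w. theta_div q rep \<Lambda> (l / q ^ n * (1 + w))) j = 0"
proof -
  obtain \<delta> \<kappa> Z where Z: "0 < \<delta>" "\<delta> < 1" "\<And>n. \<kappa> n \<noteq> 0" "growth (size \<Lambda>) \<kappa>" "growth (- real (size \<Lambda>)) (\<lambda>n. 1 / \<kappa> n)"
    "\<And>n. Z n holomorphic_on ball 0 \<delta>" "\<And>n w. norm w < \<delta> \<Longrightarrow> Z n w \<noteq> 0" "\<And>j. growth 0 (\<lambda>n. tcoeff (Z n) j)"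
    "\<And>n w. norm w < \<delta> \<Longrightarrow> theta_div q rep \<Lambda> (l / q ^ n * (1 + w)) * Z n w = \<kappa> n * w ^ count \<Lambda> s"
    using theta_normal_form[OF assms(1-3)] assms(4) by metis
  define E where "E w = \<kappa> n / Z n w" for w
  have "Z n analytic_on {0}"
    using Z(6) by (rule holomorphic_on_imp_analytic_at) (use Z(1) in simp_all)
  then have E_an: "E analytic_on {0}"
    unfolding E_def using Z(1) Z(7)[of 0 n] by (intro analytic_intros) auto
  have "\<forall>\<^sub>F w in nhds 0. w \<in> ball 0 \<delta>"
    using Z(1) by (intro eventually_nhds_in_open) auto
  then have "\<forall>\<^sub>F w in nhds 0. theta_div q rep \<Lambda> (l / q ^ n * (1 + w)) = w ^ count \<Lambda> s * E w"
  proof eventually_elim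
    case (elim w)
    then have w: "norm w < \<delta>" by simp
    then show ?case using Z(9)[OF w, of n] Z(7)[OF w, of n] by (simp add: E_def field_simps)
  qed
  then have "tcoeff (\<lambda>w. theta_div q rep \<Lambda> (l / q ^ n * (1 + w))) j = tcoeff (\<lambda>w. w ^ count \<Lambda> s * E w) j"
    by (rule tcoeff_cong)
  then show ?thesis using assms(5) by (simp add: tcoeff_power_mult[OF E_an])
qed

text \<open>Near \<open>l / q ^ n\<close> the normal form gives
  \<open>Fn n w * Z n w = w ^ c * (\<kappa> n * Hn n w)\<close>. So coefficient \<open>j\<close> of
  the quotient is \<open>1 / \<kappa> n\<close> times coefficient \<open>c + j\<close> of the left
  side: the shift by \<open>c\<close> is why the condition on \<open>F\<close> is over
  \<open>M + \<Lambda>\<close>, and \<open>1 / \<kappa> n\<close> lowers the order by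
  \<open>size \<Lambda>\<close>.\<close>

lemma quotient_gevrey_over:
  assumes "reps rep (M + \<Lambda>)" "0 < R" "F holomorphic_on ball 0 R - {0}" "H holomorphic_on ball 0 R - {0}"
    and "\<And>z. 0 < norm z \<Longrightarrow> norm z < R \<Longrightarrow> F z = theta_div q rep \<Lambda> z * H z"
    and "gevrey_over q rep (k + size \<Lambda>) (M + \<Lambda>) {#} F"
  shows "gevrey_over q rep k M {#} H"
proof -
  have rM: "reps rep M" and r\<Lambda>: "reps rep \<Lambda>" using assms(1) by auto
  have "growth (real k) (\<lambda>n. tcoeff (\<lambda>w. H (rep s / q ^ n * (1 + w))) j)"
    if s: "s \<in># M" and j: "j < count M s" for s j
  proof -
    define l where "l = rep s"
    define c where "c = count \<Lambda> s"
    have l: "l \<noteq> 0" "s = spiral q l" using rM s by (auto simp: reps_def l_def)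
    obtain \<delta> \<kappa> Z where Z: "0 < \<delta>" "\<delta> < 1" "\<And>n. \<kappa> n \<noteq> 0" "growth (size \<Lambda>) \<kappa>" "growth (- real (size \<Lambda>)) (\<lambda>n. 1 / \<kappa> n)"
      "\<And>n. Z n holomorphic_on ball 0 \<delta>" "\<And>n w. norm w < \<delta> \<Longrightarrow> Z n w \<noteq> 0" "\<And>j. growth 0 (\<lambda>n. tcoeff (Z n) j)"
      "\<And>n w. norm w < \<delta> \<Longrightarrow> theta_div q rep \<Lambda> (l / q ^ n * (1 + w)) * Z n w = \<kappa> n * w ^ count \<Lambda> s"
      using theta_normal_form[OF r\<Lambda> l] l_def by metis
    obtain N where N: "\<And>n. n \<ge> N \<Longrightarrow> norm l * 2 / p ^ n < R"
      using div_power_small[OF assms(2)] by metis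
    define Fn where "Fn n w = F (l / q ^ n * (1 + w))" for n w
    define Hn where "Hn n w = H (l / q ^ n * (1 + w))" for n w
    have gF: "growth (k + size \<Lambda>) (\<lambda>n. tcoeff (Fn n) i)" if "i \<le> c + j" for i
    proof -
      have "i < count (M + \<Lambda>) s" using that j by (simp add: c_def)
      then show ?thesis
        using assms(6) s unfolding gevrey_over_iff[OF assms(3,2,1)] Fn_def l_def by simp
    qed
    have eq: "tcoeff (Hn n) j = 1 / \<kappa> n * (\<Sum>i=0..c + j. tcoeff (Fn n) i * tcoeff (Z n) (c + j - i))"
      if "n \<ge> N" for n
    proof -
      have Fa: "Fn n analytic_on {0}" and Ha: "Hn n analytic_on {0}"
        unfolding Fn_def Hn_def using scaled_holomorphic[OF _ l(1) N[OF that]] assms(3,4)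
        by (auto intro!: holomorphic_on_imp_analytic_at[of _ "ball 0 1"])
      have Za: "Z n analytic_on {0}"
        using Z(1,6) by (auto intro!: holomorphic_on_imp_analytic_at[of _ "ball 0 \<delta>"])
      have "\<forall>\<^sub>F w in nhds 0. w \<in> ball 0 \<delta>"
        using Z(1) by (intro eventually_nhds_in_open) auto
      then have ev: "\<forall>\<^sub>F w in nhds 0. Fn n w * Z n w = w ^ c * (\<kappa> n * Hn n w)"
      proof eventually_elim
        case (elim w)
        then have "norm w < 1" using Z(2) by simp
        then have "l / q ^ n * (1 + w) \<in> ball 0 R - {0}"
          by (rule near_spiral_punctured[OF l(1) N[OF that]])
        then have "Fn n w = theta_div q rep \<Lambda> (l / q ^ n * (1 + w)) * Hn n w"
          unfolding Fn_def Hn_def by (intro assms(5)) auto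
        then have "Fn n w * Z n w = (theta_div q rep \<Lambda> (l / q ^ n * (1 + w)) * Z n w) * Hn n w"
          by simp
        also have "theta_div q rep \<Lambda> (l / q ^ n * (1 + w)) * Z n w = \<kappa> n * w ^ c"
          unfolding c_def using elim by (intro Z(9)) simp
        finally show ?case by (simp add: mult_ac)
      qed
      have "(\<lambda>w. \<kappa> n * Hn n w) analytic_on {0}" by (intro analytic_intros Ha)
      then have "\<kappa> n * tcoeff (Hn n) j = tcoeff (\<lambda>w. w ^ c * (\<kappa> n * Hn n w)) (c + j)"
        by (simp add: tcoeff_power_mult tcoeff_cmult Ha)
      also have "\<dots> = tcoeff (\<lambda>w. Fn n w * Z n w) (c + j)"
        using tcoeff_cong[OF ev] by simp
      also have "\<dots> = (\<Sum>i=0..c + j. tcoeff (Fn n) i * tcoeff (Z n) (c + j - i))"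
        by (rule tcoeff_mult[OF Fa Za])
      finally show ?thesis using Z(3)[of n] by (simp add: field_simps)
    qed
    have "growth (- real (size \<Lambda>) + (real (k + size \<Lambda>) + 0))
       (\<lambda>n. 1 / \<kappa> n * (\<Sum>i=0..c + j. tcoeff (Fn n) i * tcoeff (Z n) (c + j - i)))"
      by (intro growth_mult Z(5) growth_sum gF Z(8)) auto
    then have "growth k (\<lambda>n. 1 / \<kappa> n * (\<Sum>i=0..c + j. tcoeff (Fn n) i * tcoeff (Z n) (c + j - i)))"
      by simp
    then have "growth k (\<lambda>n. tcoeff (Hn n) j)"
      by (rule growth_cong) (rule eq)
    then show ?thesis unfolding Hn_def l_def .
  qed
  then show ?thesis
    unfolding gevrey_over_iff[OF assms(4,2) rM] by simp
qed

end

subsection \<open>Asymptotic expansions\<close>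

lemma remove_sings_bounded:
  assumes "\<forall>\<^sub>F w in at z. f analytic_on {w}" "\<forall>\<^sub>F w in at z. norm (f w) \<le> B"
  shows "remove_sings f analytic_on {z}"
proof -
  have iso: "isolated_singularity_at f z"
    using assms(1) by (simp add: isolated_singularity_at_altdef)
  then obtain A where A: "open A" "z \<in> A" "f holomorphic_on (A - {z})"
    using analytic_imp_holomorphic isolated_singularity_at_iff_analytic_nhd by auto
  have "z \<in> interior A" using A by (simp add: interior_open)
  then obtain g where g: "g holomorphic_on A" "\<forall>w\<in>A - {z}. g w = f w"
    using holomorphic_on_extend_bounded[OF A(3)] assms(2) by blast
  have "isCont g z"
    using g(1) A(1,2) holomorphic_on_imp_continuous_on continuous_on_eq_continuous_at by blast
  moreover have "\<forall>\<^sub>F w in at z. g w = f w"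
    using eventually_at_in_open[OF A(1,2)] by eventually_elim (use g(2) in auto)
  ultimately have "f \<midarrow>z\<rightarrow> g z"
    unfolding isCont_def by (rule Lim_transform_eventually)
  then show ?thesis by (rule remove_sings_analytic_at[OF iso])
qed

lemma isCont_norm_le:
  fixes f :: "complex \<Rightarrow> complex"
  assumes "isCont f z" "isCont g z" "\<forall>\<^sub>F w in at z. norm (f w) \<le> g w"
  shows "norm (f z) \<le> g z"
  by (rule tendsto_le[OF _ _ tendsto_norm assms(3)]) (use assms(1,2) in \<open>auto simp: isCont_def\<close>)

lemma isCont_eqI:
  fixes f g :: "complex \<Rightarrow> complex"
  assumes "isCont f z" "isCont g z" "\<forall>\<^sub>F w in at z. f w = g w"
  shows "f z = g z"
proof -
  have "f \<midarrow>z\<rightarrow> g z"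
    using Lim_transform_eventually[of g "g z" "at z" f] assms(2,3) by (simp add: isCont_def eq_commute)
  then show ?thesis
    using assms(1) LIM_unique by (auto simp: isCont_def)
qed

lemma holomorphic_isCont: "f holomorphic_on S \<Longrightarrow> open S \<Longrightarrow> z \<in> S \<Longrightarrow> isCont f z"
  by (intro analytic_at_imp_isCont holomorphic_on_imp_analytic_at)

text \<open>The truncated binomial series of 1/(1 - u)^j, with a remainder estimate for every u
  \<noteq> 1, also where the series diverges. In the induction each further division by 1 - u is
  paid for by one factor min(1, |1 - u|). The coefficients become partial sums of the previous ones;
  a bound by powers of 2 suffices.\<close>

lemma geometric_power_remainder:
  "\<exists>(\<gamma> :: nat \<Rightarrow> complex) C. 0 \<le> C \<and> (\<forall>i. norm (\<gamma> i) \<le> C * 2 ^ i) \<and> (\<forall>N u. u \<noteq> 1 \<longrightarrow>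
     norm (1 / (1 - u) ^ j - (\<Sum>i<N. \<gamma> i * u ^ i)) * min 1 (norm (1 - u)) ^ j \<le> C * 2 ^ N * norm u ^ N)"
  for j :: nat
proof (induction j)
  case 0
  define \<gamma> :: "nat \<Rightarrow> complex" where "\<gamma> i = (if i = 0 then 1 else 0)" for i
  have s: "(\<Sum>i<N. \<gamma> i * u ^ i) = (if N = 0 then 0 else 1)" for N u
    by (induction N) (simp_all add: \<gamma>_def)
  show ?case
  proof (intro exI[of _ \<gamma>] exI[of _ 1] conjI allI impI)
    show "norm (\<gamma> i) \<le> 1 * 2 ^ i" for i by (simp add: \<gamma>_def)
    show "norm (1 / (1 - u) ^ 0 - (\<Sum>i<N. \<gamma> i * u ^ i)) * min 1 (norm (1 - u)) ^ 0 \<le> 1 * 2 ^ N * norm u ^ N" for N u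
      unfolding s by simp
  qed simp
next
  case (Suc j)
  then obtain \<gamma> :: "nat \<Rightarrow> complex" and C where \<gamma>C: "0 \<le> C \<and> (\<forall>i. norm (\<gamma> i) \<le> C * 2 ^ i) \<and> (\<forall>N u. u \<noteq> 1 \<longrightarrow>
     norm (1 / (1 - u) ^ j - (\<Sum>i<N. \<gamma> i * u ^ i)) * min 1 (norm (1 - u)) ^ j \<le> C * 2 ^ N * norm u ^ N)"
    by (elim exE) (rule that)
  have C: "0 \<le> C" "\<And>i. norm (\<gamma> i) \<le> C * 2 ^ i"
    "\<And>N u. u \<noteq> 1 \<Longrightarrow> norm (1 / (1 - u) ^ j - (\<Sum>i<N. \<gamma> i * u ^ i)) * min 1 (norm (1 - u)) ^ j \<le> C * 2 ^ N * norm u ^ N"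
    using \<gamma>C by simp_all
  define \<sigma> where "\<sigma> N = (\<Sum>i<N. \<gamma> i)" for N
  have \<sigma>: "norm (\<sigma> N) \<le> C * 2 ^ N" for N
  proof (induction N)
    case (Suc N)
    have "norm (\<sigma> (Suc N)) \<le> norm (\<sigma> N) + norm (\<gamma> N)"
      unfolding \<sigma>_def by (simp add: norm_triangle_ineq)
    then show ?case using Suc C(2)[of N] by simp
  qed (use C in \<open>simp add: \<sigma>_def\<close>)
  \<comment> \<open>Summation by parts: multiplying the sum with coefficients \<sigma> by 1 - u
    recovers the sum with coefficients \<gamma>, up to one boundary term.\<close>
  have tele: "(1 - u) * (\<Sum>i<N. \<sigma> (Suc i) * u ^ i) = (\<Sum>i<N. \<gamma> i * u ^ i) - \<sigma> N * u ^ N" for N u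
  proof (induction N)
    case (Suc N)
    have "\<sigma> (Suc N) = \<sigma> N + \<gamma> N" by (simp add: \<sigma>_def)
    have "(1 - u) * (\<Sum>i<Suc N. \<sigma> (Suc i) * u ^ i) = (\<Sum>i<N. \<gamma> i * u ^ i) - \<sigma> N * u ^ N + (1 - u) * (\<sigma> (Suc N) * u ^ N)"
      by (simp only: sum.lessThan_Suc distrib_left Suc)
    also have "\<dots> = (\<Sum>i<Suc N. \<gamma> i * u ^ i) - \<sigma> (Suc N) * u ^ Suc N"
      using \<open>\<sigma> (Suc N) = \<sigma> N + \<gamma> N\<close> by (simp add: algebra_simps)
    finally show ?case .
  qed (simp add: \<sigma>_def)
  show ?case
  proof (intro exI[of _ "\<lambda>i. \<sigma> (Suc i)"] exI[of _ "2 * C"] conjI allI impI)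
    show "0 \<le> 2 * C" using C by simp
    show "norm (\<sigma> (Suc i)) \<le> 2 * C * 2 ^ i" for i using \<sigma>[of "Suc i"] by simp
    fix N :: nat and u :: complex assume u: "u \<noteq> 1"
    define m where "m = min 1 (norm (1 - u))"
    define r where "r = 1 / (1 - u) ^ j - (\<Sum>i<N. \<gamma> i * u ^ i)"
    define r' where "r' = 1 / (1 - u) ^ Suc j - (\<Sum>i<N. \<sigma> (Suc i) * u ^ i)"
    have m: "0 \<le> m" "m \<le> 1" "m \<le> norm (1 - u)" by (auto simp: m_def)
    have "(1 - u) * r' = r + \<sigma> N * u ^ N"
      unfolding r'_def right_diff_distrib tele using u by (simp add: r_def)
    then have "norm (1 - u) * norm r' = norm (r + \<sigma> N * u ^ N)"
      by (metis norm_mult)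
    also have "\<dots> \<le> norm r + norm (\<sigma> N) * norm u ^ N"
      using norm_triangle_ineq[of r "\<sigma> N * u ^ N"] by (simp add: norm_mult norm_power)
    finally have 1: "norm (1 - u) * norm r' \<le> norm r + norm (\<sigma> N) * norm u ^ N" .
    have "norm r' * m ^ Suc j \<le> norm r' * norm (1 - u) * m ^ j"
      unfolding power_Suc mult.assoc[symmetric] using m by (intro mult_left_mono mult_right_mono) auto
    also have "\<dots> \<le> (norm r + norm (\<sigma> N) * norm u ^ N) * m ^ j"
      using 1 m by (intro mult_right_mono) (auto simp: mult.commute)
    also have "\<dots> = norm r * m ^ j + norm (\<sigma> N) * norm u ^ N * m ^ j"
      by (simp add: distrib_right)
    also have "norm r * m ^ j \<le> C * 2 ^ N * norm u ^ N"
      unfolding r_def m_def by (rule C(3)[OF u])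
    also have "norm (\<sigma> N) * norm u ^ N * m ^ j \<le> (C * 2 ^ N) * norm u ^ N * 1"
      using \<sigma>[of N] m C by (intro mult_mono power_le_one) auto
    finally show "norm r' * m ^ Suc j \<le> 2 * C * 2 ^ N * norm u ^ N" by (simp add: mult_ac)
  qed
qed

section \<open>The space of functions with q-asymptotic expansion, and series of poles along a
  spiral\<close>

context q_theta
begin

text \<open>Weighting the remainder with \<open>dist_div\<close> treats all \<epsilon> at once:
  where the distance exceeds \<epsilon>, the weight is removed at the cost of 1/\<epsilon>. The
  constant \<open>C + 1\<close> makes the inequality strict, and the case \<open>N = 0\<close> gives
  membership in \<open>B_space\<close>.\<close>

lemma A_spaceI:
  assumes "reps rep \<Lambda>" "0 < R" "f holomorphic_on sector \<Lambda> 0 R" "0 \<le> C" "0 < A"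
    and "\<And>N z. z \<in> sector \<Lambda> 0 R \<Longrightarrow>
      norm (f z - (\<Sum>n<N. a n * z ^ n)) * dist_div z \<Lambda> \<le> C * A ^ N * p powr ((real N)\<^sup>2 / (2 * real (size \<Lambda>))) * norm z ^ N"
  shows "f \<in> A_space q \<Lambda>"
proof -
  have *: "norm (f z - (\<Sum>n<N. a n * z ^ n)) < (C + 1) / \<epsilon> * A ^ N * p powr ((real N)\<^sup>2 / (2 * real (size \<Lambda>))) * norm z ^ N"
    if "\<epsilon> > 0" "z \<in> sector \<Lambda> \<epsilon> R" for \<epsilon> N z
  proof -
    define X where "X = A ^ N * p powr ((real N)\<^sup>2 / (2 * real (size \<Lambda>))) * norm z ^ N"
    define D where "D = norm (f z - (\<Sum>n<N. a n * z ^ n))"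
    have z: "z \<noteq> 0" "\<epsilon> < dist_div z \<Lambda>" "z \<in> sector \<Lambda> 0 R" using that by (auto simp: sector_iff)
    have "X > 0" using assms z by (simp add: X_def)
    have "D * \<epsilon> \<le> D * dist_div z \<Lambda>" using z by (intro mult_left_mono) (auto simp: D_def)
    also have "\<dots> \<le> C * X" using assms(6)[OF z(3), of N] by (simp add: D_def X_def mult_ac)
    also have "\<dots> < (C + 1) * X" using \<open>X > 0\<close> by simp
    finally have "D < (C + 1) / \<epsilon> * X" using that(1) by (simp add: field_simps)
    then show ?thesis by (simp add: D_def X_def mult_ac)
  qed
  have B: "f \<in> B_space \<Lambda>"
  proof -
    have "bounded (f ` sector \<Lambda> \<epsilon> r)" if "\<epsilon> > 0" "r < R" for \<epsilon> r
    proof (rule boundedI)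
      fix y assume "y \<in> f ` sector \<Lambda> \<epsilon> r"
      then obtain z where z: "y = f z" "z \<in> sector \<Lambda> \<epsilon> r" by blast
      then have "z \<in> sector \<Lambda> \<epsilon> R" using that by (auto simp: sector_iff)
      from *[OF that(1) this, of 0] show "norm y \<le> (C + 1) / \<epsilon>"
        using z by simp
    qed
    moreover have "f analytic_on sector \<Lambda> 0 R"
      using assms(3) by (simp add: analytic_on_open open_sector_0[OF assms(1)])
    ultimately show ?thesis unfolding B_space_def using assms(2) by blast
  qed
  have C: "0 < C + 1" using assms by simp
  show ?thesis
    unfolding A_space_def mem_Collect_eq
    by (rule conjI[OF B], rule exI[of _ a], rule exI[of _ "C + 1"], rule conjI[OF C], rule exI[of _ A],
        rule conjI[OF assms(5)], rule exI[of _ R], rule conjI[OF assms(2)], intro allI impI ballI *)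
qed

lemma A_spaceE:
  assumes "reps rep \<Lambda>" "f \<in> A_space q \<Lambda>"
  obtains R C A a where "0 < R" "R \<le> 1" "1 \<le> C" "1 \<le> A" "f holomorphic_on sector \<Lambda> 0 R"
    "\<forall>N. \<forall>z\<in>sector \<Lambda> 0 R.
      norm (f z - (\<Sum>n<N. a n * z ^ n)) * dist_div z \<Lambda> \<le> C * A ^ N * p powr ((real N)\<^sup>2 / (2 * real (size \<Lambda>))) * norm z ^ N"
proof -
  from assms(2) obtain R1 where R1: "0 < R1" "f analytic_on sector \<Lambda> 0 R1"
    unfolding A_space_def B_space_def by force
  from assms(2) obtain a C A R2 where R2: "0 < C" "0 < A" "0 < R2"
    and bd: "\<forall>\<epsilon>>0. \<forall>N. \<forall>z\<in>sector \<Lambda> \<epsilon> R2.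
      norm (f z - (\<Sum>n<N. a n * z ^ n)) < C / \<epsilon> * A ^ N * p powr ((real N)\<^sup>2 / (2 * real (size \<Lambda>))) * norm z ^ N"
    unfolding A_space_def mem_Collect_eq by (elim conjE exE) (rule that; assumption)
  define R where "R = min 1 (min R1 R2)"
  have R: "0 < R" "R \<le> 1" "R \<le> R1" "R \<le> R2" using R1 R2 by (auto simp: R_def)
  show ?thesis
  proof (rule that[OF R(1,2), of "max 1 (2 * C)" "max 1 A"])
    have "sector \<Lambda> 0 R \<subseteq> sector \<Lambda> 0 R1" using R by (auto simp: sector_iff)
    then show "f holomorphic_on sector \<Lambda> 0 R"
      using R1(2) analytic_imp_holomorphic analytic_on_subset by blast
    show "\<forall>N. \<forall>z\<in>sector \<Lambda> 0 R. norm (f z - (\<Sum>n<N. a n * z ^ n)) * dist_div z \<Lambda>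
        \<le> max 1 (2 * C) * max 1 A ^ N * p powr ((real N)\<^sup>2 / (2 * real (size \<Lambda>))) * norm z ^ N"
    proof (intro allI ballI)
      fix N z assume z: "z \<in> sector \<Lambda> 0 R"
      define D where "D = norm (f z - (\<Sum>n<N. a n * z ^ n))"
      define d where "d = dist_div z \<Lambda>"
      define X where "X = p powr ((real N)\<^sup>2 / (2 * real (size \<Lambda>))) * norm z ^ N"
      have "X \<ge> 0" by (simp add: X_def)
      have d: "d > 0" using z by (simp add: sector_iff d_def)
      \<comment> \<open>Sectors are defined by a strict inequality, so the point's own distance
        \<open>d\<close> cannot serve as \<epsilon>; half of it costs a factor 2 in the
        constant.\<close>
      have "z \<in> sector \<Lambda> (d / 2) R2" using z R d by (auto simp: sector_iff d_def)
      then have "D < C / (d / 2) * A ^ N * X"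
        using bd[rule_format, of "d / 2" z N] d by (simp add: D_def X_def mult_ac)
      then have "D * d < (2 * C) * A ^ N * X" using d by (simp add: field_simps)
      also have "\<dots> \<le> max 1 (2 * C) * max 1 A ^ N * X"
        using R2 \<open>X \<ge> 0\<close> by (intro mult_right_mono mult_mono power_mono) auto
      finally show "norm (f z - (\<Sum>n<N. a n * z ^ n)) * dist_div z \<Lambda> \<le> max 1 (2 * C) * max 1 A ^ N * p powr ((real N)\<^sup>2 / (2 * real (size \<Lambda>))) * norm z ^ N"
        by (simp add: D_def d_def X_def mult_ac)
    qed
  qed auto
qed

lemma A_space_add:
  assumes "reps rep \<Lambda>" "f \<in> A_space q \<Lambda>" "g \<in> A_space q \<Lambda>"
  shows "(\<lambda>z. f z + g z) \<in> A_space q \<Lambda>"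
proof -
  obtain R C A a where f: "0 < R" "R \<le> 1" "1 \<le> C" "1 \<le> A" "f holomorphic_on sector \<Lambda> 0 R"
    "\<forall>N. \<forall>z\<in>sector \<Lambda> 0 R. norm (f z - (\<Sum>n<N. a n * z ^ n)) * dist_div z \<Lambda> \<le> C * A ^ N * p powr ((real N)\<^sup>2 / (2 * real (size \<Lambda>))) * norm z ^ N"
    by (rule A_spaceE[OF assms(1,2)]) (rule that; assumption)
  obtain R' C' A' a' where g: "0 < R'" "R' \<le> 1" "1 \<le> C'" "1 \<le> A'" "g holomorphic_on sector \<Lambda> 0 R'"
    "\<forall>N. \<forall>z\<in>sector \<Lambda> 0 R'. norm (g z - (\<Sum>n<N. a' n * z ^ n)) * dist_div z \<Lambda> \<le> C' * A' ^ N * p powr ((real N)\<^sup>2 / (2 * real (size \<Lambda>))) * norm z ^ N"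
    by (rule A_spaceE[OF assms(1,3)]) (rule that; assumption)
  show ?thesis
  proof (rule A_spaceI[OF assms(1), of "min R R'" _ "C + C'" "max A A'" "\<lambda>n. a n + a' n"])
    have sub: "sector \<Lambda> 0 (min R R') \<subseteq> sector \<Lambda> 0 R" "sector \<Lambda> 0 (min R R') \<subseteq> sector \<Lambda> 0 R'"
      by (auto simp: sector_iff)
    show "(\<lambda>z. f z + g z) holomorphic_on sector \<Lambda> 0 (min R R')"
      by (intro holomorphic_intros holomorphic_on_subset[OF f(5)] holomorphic_on_subset[OF g(5)] sub)
    fix N z assume z: "z \<in> sector \<Lambda> 0 (min R R')"
    define d where "d = dist_div z \<Lambda>"
    define X where "X = p powr ((real N)\<^sup>2 / (2 * real (size \<Lambda>))) * norm z ^ N"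
    have X: "0 \<le> X" by (simp add: X_def)
    have d: "0 \<le> d" using z by (simp add: d_def sector_iff)
    have e: "f z + g z - (\<Sum>n<N. (a n + a' n) * z ^ n) = (f z - (\<Sum>n<N. a n * z ^ n)) + (g z - (\<Sum>n<N. a' n * z ^ n))"
      by (simp add: distrib_right sum.distrib)
    have "norm (f z + g z - (\<Sum>n<N. (a n + a' n) * z ^ n)) * d
       \<le> (norm (f z - (\<Sum>n<N. a n * z ^ n)) + norm (g z - (\<Sum>n<N. a' n * z ^ n))) * d"
      unfolding e by (intro mult_right_mono norm_triangle_ineq d)
    also have "\<dots> \<le> C * A ^ N * X + C' * A' ^ N * X"
      using f(6)[rule_format, OF subsetD[OF sub(1) z], of N] g(6)[rule_format, OF subsetD[OF sub(2) z], of N]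
      unfolding d_def X_def distrib_right by (intro add_mono) (simp_all add: mult_ac)
    also have "C * A ^ N * X \<le> C * max A A' ^ N * X"
      using f g X by (intro mult_left_mono mult_right_mono power_mono) auto
    also have "C' * A' ^ N * X \<le> C' * max A A' ^ N * X"
      using f g X by (intro mult_left_mono mult_right_mono power_mono) auto
    finally show "norm (f z + g z - (\<Sum>n<N. (a n + a' n) * z ^ n)) * d
       \<le> (C + C') * max A A' ^ N * p powr ((real N)\<^sup>2 / (2 * real (size \<Lambda>))) * norm z ^ N"
      by (simp only: X_def distrib_right mult.assoc)
  qed (use f g in auto)
qed

lemma A_space_zero:
  assumes "reps rep \<Lambda>"
  shows "(\<lambda>z. 0) \<in> A_space q \<Lambda>"
  by (rule A_spaceI[OF assms, of 1 _ 0 1 "\<lambda>_. 0"]) auto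

lemma A_space_sum:
  assumes "reps rep \<Lambda>" "finite I" "\<And>i. i \<in> I \<Longrightarrow> f i \<in> A_space q \<Lambda>"
  shows "(\<lambda>z. \<Sum>i\<in>I. f i z) \<in> A_space q \<Lambda>"
  using assms(2,3)
  by (induction I rule: finite_induct) (auto intro: A_space_zero[OF assms(1)] A_space_add[OF assms(1)])

text \<open>The singularity at 0 is removable, and a convergent Taylor series has geometrically
  bounded remainders. The factor with exponent quadratic in \<open>N\<close> is at least 1 and only
  weakens the bound.\<close>

lemma A_space_bounded_punctured:
  assumes "reps rep \<Lambda>" "0 < R" "H holomorphic_on ball 0 R - {0}"
    and "\<And>z. 0 < norm z \<Longrightarrow> norm z < R \<Longrightarrow> norm (H z) \<le> B"
  shows "H \<in> A_space q \<Lambda>"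
proof -
  have "\<forall>\<^sub>F z in at 0. z \<in> ball 0 R - {0}"
    using assms(2) by (intro eventually_at_in_open) auto
  then have "\<forall>\<^sub>F z in at 0. norm (H z) \<le> B"
    by eventually_elim (use assms(4) in auto)
  moreover have "(0::complex) \<in> interior (ball 0 R)" using assms(2) by simp
  ultimately obtain h where h: "h holomorphic_on ball 0 R" "\<forall>z\<in>ball 0 R - {0}. h z = H z"
    using holomorphic_on_extend_bounded[OF assms(3)] by blast
  define r where "r = R / 2"
  have r: "0 < r" "r < R" using assms(2) by (auto simp: r_def)
  define M where "M = \<bar>B\<bar>"
  have a: "norm (tcoeff h n) \<le> M / r ^ n" for n
  proof (rule tcoeff_cauchy[OF h(1) r])
    fix w :: complex assume "norm w = r"
    then show "norm (h w) \<le> M" using assms(4)[of w] h(2) r by (auto simp: M_def)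
  qed
  show ?thesis
  proof (rule A_spaceI[OF assms(1), of "r / 2" _ "2 * M" "1 / r" "tcoeff h"])
    have sub: "sector \<Lambda> 0 (r / 2) \<subseteq> ball 0 R - {0}" using r by (auto simp: sector_iff)
    show "H holomorphic_on sector \<Lambda> 0 (r / 2)" by (rule holomorphic_on_subset[OF assms(3) sub])
    fix N z assume z: "z \<in> sector \<Lambda> 0 (r / 2)"
    then have z': "norm z < r / 2" "0 < dist_div z \<Lambda>" by (auto simp: sector_iff)
    \<comment> \<open>On half the Cauchy radius this ratio is below 1/2, so the tail is at most
      twice the bound for its first term.\<close>
    define x where "x = norm z / r"
    have x: "0 \<le> x" "x < 1/2" using z' r by (auto simp: x_def field_simps)
    have "(\<lambda>n. (deriv ^^ n) h 0 / fact n * (z - 0) ^ n) sums h z"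
      using holomorphic_power_series[OF h(1), of z] z' r by simp
    then have s: "(\<lambda>n. tcoeff h n * z ^ n) sums h z" by (simp add: tcoeff_def)
    then have s': "(\<lambda>n. tcoeff h (n + N) * z ^ (n + N)) sums (h z - (\<Sum>n<N. tcoeff h n * z ^ n))"
      by (subst sums_iff_shift) auto
    have t: "norm (tcoeff h (n + N) * z ^ (n + N)) \<le> M * x ^ N * (1/2) ^ n" for n
    proof -
      have "norm (tcoeff h (n + N) * z ^ (n + N)) \<le> M / r ^ (n + N) * norm z ^ (n + N)"
        unfolding norm_mult norm_power using a by (intro mult_right_mono) auto
      also have "\<dots> = M * x ^ N * x ^ n" by (simp add: x_def power_add power_divide mult_ac)
      also have "\<dots> \<le> M * x ^ N * (1/2) ^ n"
        using x by (intro mult_left_mono power_mono) (auto simp: M_def)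
      finally show ?thesis .
    qed
    have "norm (h z - (\<Sum>n<N. tcoeff h n * z ^ n)) \<le> M * x ^ N * 2"
    proof (rule norm_sums_le[OF s' _ t])
      have "(\<lambda>n. (1/2::real) ^ n) sums (1 / (1 - 1/2))" by (intro geometric_sums) auto
      from sums_mult[OF this, of "M * x ^ N"] show "(\<lambda>n. M * x ^ N * (1/2) ^ n) sums (M * x ^ N * 2)" by simp
    qed
    have 1: "norm (H z - (\<Sum>n<N. tcoeff h n * z ^ n)) \<le> 2 * M * x ^ N"
    proof -
      have "h z = H z" using h(2) sub z by blast
      then show ?thesis using \<open>norm (h z - _) \<le> _\<close> by (simp add: mult_ac)
    qed
    have "norm (H z - (\<Sum>n<N. tcoeff h n * z ^ n)) * dist_div z \<Lambda> \<le> 2 * M * x ^ N * 1"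
      using 1 dist_div_bounds[OF assms(1), of z] x by (intro mult_mono) (auto simp: M_def)
    also have "\<dots> \<le> 2 * M * x ^ N * p powr ((real N)\<^sup>2 / (2 * real (size \<Lambda>)))"
      using q_gt_1 x by (intro mult_left_mono ge_one_powr_ge_zero) (auto simp: M_def)
    finally show "norm (H z - (\<Sum>n<N. tcoeff h n * z ^ n)) * dist_div z \<Lambda>
      \<le> 2 * M * (1 / r) ^ N * p powr ((real N)\<^sup>2 / (2 * real (size \<Lambda>))) * norm z ^ N"
      by (simp add: x_def power_divide mult_ac)
  qed (use r in \<open>auto simp: M_def\<close>)
qed

text \<open>Completing the square \<open>- k n\<^sup>2 / 2 + n N\<close> produces the order of the asymptotics.\<close>

lemma gauss_sum_bound:
  fixes k :: nat
  assumes "1 \<le> k" "0 < A"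
  obtains C B where "0 < C" "0 < B"
    "\<forall>N. summable (\<lambda>n. A ^ n * p powr (- real k * (real n)\<^sup>2 / 2) * p ^ (n * N))"
    "\<forall>N. (\<Sum>n. A ^ n * p powr (- real k * (real n)\<^sup>2 / 2) * p ^ (n * N)) \<le> C * B ^ N * p powr ((real N)\<^sup>2 / (2 * real k))"
proof -
  define a where "a = ln A / ln p"
  have A: "A = p powr a" using assms ln_p_pos by (simp add: a_def powr_def)
  \<comment> \<open>The additional 1 in the square leaves a factor 1/p^n after completing the
    square, so that the whole series is dominated by a geometric one.\<close>
  define E where "E N = p powr ((real N + a + 1)\<^sup>2 / (2 * real k))" for N :: nat
  have t: "A ^ n * p powr (- real k * (real n)\<^sup>2 / 2) * p ^ (n * N) \<le> E N * (1 / p) ^ n" for n N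
  proof -
    have "A ^ n * p powr (- real k * (real n)\<^sup>2 / 2) * p ^ (n * N)
       = p powr (a * real n + - real k * (real n)\<^sup>2 / 2 + real n * real N)"
      unfolding A p_powr_power powr_add by (simp add: powr_realpow[symmetric])
    also have "a * real n + - real k * (real n)\<^sup>2 / 2 + real n * real N \<le> (real N + a + 1)\<^sup>2 / (2 * real k) - real n"
    proof -
      have "0 \<le> (real k * real n - (real N + a + 1))\<^sup>2 / (2 * real k)" by simp
      also have "\<dots> = real k * (real n)\<^sup>2 / 2 - real n * (real N + a + 1) + (real N + a + 1)\<^sup>2 / (2 * real k)"
        using assms by (simp add: power2_diff field_simps power2_eq_square)
      finally show ?thesis by (simp add: algebra_simps)
    qed
    then have "p powr (a * real n + - real k * (real n)\<^sup>2 / 2 + real n * real N) \<le> p powr ((real N + a + 1)\<^sup>2 / (2 * real k) - real n)"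
      using q_gt_1 by (intro powr_mono) auto
    also have "\<dots> = E N * (1 / p) ^ n"
      by (simp add: E_def powr_diff powr_realpow power_divide)
    finally show ?thesis .
  qed
  have gs: "(\<lambda>n. E N * (1 / p) ^ n) sums (E N * (1 / (1 - 1 / p)))" for N
    using q_gt_1 by (intro sums_mult geometric_sums) (auto simp: divide_less_eq)
  have sm: "summable (\<lambda>n. A ^ n * p powr (- real k * (real n)\<^sup>2 / 2) * p ^ (n * N))" for N
    by (rule summable_comparison_test'[OF sums_summable[OF gs[of N]], of 0]) (use t[of _ N] assms in auto)
  have "(real N + a + 1)\<^sup>2 / (2 * real k) = (a + 1) / k * real N + ((a + 1)\<^sup>2 / (2 * real k) + (real N)\<^sup>2 / (2 * real k))" for N
    using assms by (simp add: power2_eq_square field_simps)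
  then have E: "E N = (p powr ((a + 1) / k)) ^ N * (p powr ((a + 1)\<^sup>2 / (2 * real k)) * p powr ((real N)\<^sup>2 / (2 * real k)))" for N
    unfolding E_def by (simp only: powr_add p_powr_power)
  show ?thesis
  proof (rule that[of "p powr ((a + 1)\<^sup>2 / (2 * real k)) * (1 / (1 - 1 / p))" "p powr ((a + 1) / k)"])
    have "(\<Sum>n. A ^ n * p powr (- real k * (real n)\<^sup>2 / 2) * p ^ (n * N))
      \<le> p powr ((a + 1)\<^sup>2 / (2 * real k)) * (1 / (1 - 1 / p)) * (p powr ((a + 1) / k)) ^ N * p powr ((real N)\<^sup>2 / (2 * real k))" for N
    proof -
      have "(\<Sum>n. A ^ n * p powr (- real k * (real n)\<^sup>2 / 2) * p ^ (n * N)) \<le> E N * (1 / (1 - 1 / p))"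
        using suminf_le[OF t sm sums_summable[OF gs]] sums_unique[OF gs[of N]] by simp
      then show ?thesis
        unfolding E by (simp add: mult_ac)
    qed
    then show "\<forall>N. (\<Sum>n. A ^ n * p powr (- real k * (real n)\<^sup>2 / 2) * p ^ (n * N))
      \<le> p powr ((a + 1)\<^sup>2 / (2 * real k)) * (1 / (1 - 1 / p)) * (p powr ((a + 1) / k)) ^ N * p powr ((real N)\<^sup>2 / (2 * real k))" ..
    show "\<forall>N. summable (\<lambda>n. A ^ n * p powr (- real k * (real n)\<^sup>2 / 2) * p ^ (n * N))"
      using sm ..
  qed (use q_gt_1 in auto)
qed

text \<open>The poles are normalised as powers of 1 - z/\<xi>, the quantity whose modulus enters
  \<open>dist_spiral\<close>.\<close>

definition pole_series :: "complex \<Rightarrow> (nat \<Rightarrow> complex) \<Rightarrow> nat \<Rightarrow> complex \<Rightarrow> complex" where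
  "pole_series l b j z = (\<Sum>n. b n / (1 - z / (l / q ^ n)) ^ j)"

text \<open>Near a point z \<noteq> 0 almost all poles \<xi> satisfy 2 |\<xi>| \<le> |w|, hence |1 -
  w/\<xi>| \<ge> 1, and the series is dominated by the coefficients. Requiring \<open>z\<close> to
  avoid only the poles with nonzero coefficient allows a single pole to be deleted by setting its
  coefficient to 0.\<close>

lemma pole_series_uniform:
  assumes "l \<noteq> 0" "summable (\<lambda>n. norm (b n))" "z \<noteq> 0" "\<And>n. b n \<noteq> 0 \<Longrightarrow> z \<noteq> l / q ^ n"
  obtains r where "0 < r" "\<And>n. (\<lambda>w. b n / (1 - w / (l / q ^ n)) ^ j) holomorphic_on ball z r"
    "uniform_limit (ball z r) (\<lambda>N w. \<Sum>n<N. b n / (1 - w / (l / q ^ n)) ^ j) (pole_series l b j) sequentially"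
proof -
  have "norm z / 4 > 0" using assms(3) by simp
  then obtain N where N: "\<And>n. n \<ge> N \<Longrightarrow> norm l / p ^ n < norm z / 4"
    using div_power_small by metis
  have "\<forall>\<^sub>F w in nhds z. \<forall>n\<in>{n. n < N \<and> b n \<noteq> 0}. w \<noteq> l / q ^ n"
    by (intro eventually_ball_finite ballI t1_space_nhds) (use assms(4) in auto)
  then obtain r0 where r0: "r0 > 0" "\<And>w n. dist w z < r0 \<Longrightarrow> n < N \<Longrightarrow> b n \<noteq> 0 \<Longrightarrow> w \<noteq> l / q ^ n"
    unfolding eventually_nhds_metric by blast
  define r where "r = min r0 (norm z / 2)"
  have r: "r > 0" using r0 assms(3) by (simp add: r_def)
  have far: "1 \<le> norm (1 - w / (l / q ^ n))" if "w \<in> ball z r" "n \<ge> N" for w n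
  proof -
    have "dist z w < norm z / 2" using that by (simp add: r_def)
    then have "norm z / 2 \<le> norm w"
      using norm_triangle_ineq2[of z w] by (simp add: dist_norm)
    moreover have "norm (l / q ^ n) < norm z / 4"
      using N[OF that(2)] by (simp add: norm_divide norm_power)
    ultimately have "2 * norm (l / q ^ n) \<le> norm w" by linarith
    then have "2 \<le> norm (w / (l / q ^ n))"
      using assms(1) by (simp add: norm_divide norm_mult norm_power field_simps)
    then show ?thesis
      using norm_triangle_ineq2[of "w / (l / q ^ n)" 1] by (simp add: norm_minus_commute)
  qed
  have nz: "1 - w / (l / q ^ n) \<noteq> 0" if "w \<in> ball z r" "b n \<noteq> 0" for w n
  proof (cases "n \<ge> N")
    case True
    then show ?thesis using far[OF that(1) True] by auto
  next
    case False
    then have "w \<noteq> l / q ^ n" using r0(2)[of w n] that by (simp add: r_def dist_commute)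
    then show ?thesis using assms(1) by (simp add: field_simps)
  qed
  show ?thesis
  proof (rule that[OF r])
    show "(\<lambda>w. b n / (1 - w / (l / q ^ n)) ^ j) holomorphic_on ball z r" for n
    proof (cases "b n = 0")
      case False
      then show ?thesis using assms(1) nz by (intro holomorphic_intros) auto
    qed simp
    show "uniform_limit (ball z r) (\<lambda>N w. \<Sum>n<N. b n / (1 - w / (l / q ^ n)) ^ j) (pole_series l b j) sequentially"
      unfolding pole_series_def
    proof (rule Weierstrass_m_test_ev[OF _ assms(2)])
      show "\<forall>\<^sub>F n in sequentially. \<forall>w\<in>ball z r. norm (b n / (1 - w / (l / q ^ n)) ^ j) \<le> norm (b n)"
        unfolding eventually_sequentially
      proof (intro exI[of _ N] allI impI ballI)
        fix n w assume "N \<le> n" "w \<in> ball z r"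
        then have "1 \<le> norm ((1 - w / (l / q ^ n)) ^ j)"
          unfolding norm_power using far by (intro one_le_power) auto
        then show "norm (b n / (1 - w / (l / q ^ n)) ^ j) \<le> norm (b n)"
          unfolding norm_divide by (simp add: divide_le_eq mult_left_le mult_le_cancel_left1)
      qed
    qed
  qed
qed

lemma pole_series_analytic:
  assumes "l \<noteq> 0" "summable (\<lambda>n. norm (b n))" "z \<noteq> 0" "\<And>n. b n \<noteq> 0 \<Longrightarrow> z \<noteq> l / q ^ n"
  shows "pole_series l b j analytic_on {z}"
proof -
  obtain r where r: "0 < r" "\<And>n. (\<lambda>w. b n / (1 - w / (l / q ^ n)) ^ j) holomorphic_on ball z r"
    "uniform_limit (ball z r) (\<lambda>N w. \<Sum>n<N. b n / (1 - w / (l / q ^ n)) ^ j) (pole_series l b j) sequentially"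
    using pole_series_uniform[OF assms] by blast
  have "pole_series l b j holomorphic_on ball z r"
  proof (rule holomorphic_uniform_sequence)
    show "(\<lambda>w. \<Sum>n<N. b n / (1 - w / (l / q ^ n)) ^ j) holomorphic_on ball z r" for N
      by (intro holomorphic_intros r)
    fix x assume "x \<in> ball z r"
    then obtain d where "d > 0" "cball x d \<subseteq> ball z r"
      using open_contains_cball by (metis open_ball)
    then show "\<exists>d>0. cball x d \<subseteq> ball z r \<and>
        uniform_limit (cball x d) (\<lambda>N w. \<Sum>n<N. b n / (1 - w / (l / q ^ n)) ^ j) (pole_series l b j) sequentially"
      using uniform_limit_on_subset[OF r(3)] by blast
  qed simp
  then show ?thesis using r(1) by (auto simp: analytic_at intro!: exI[of _ "ball z r"])
qed

lemma pole_series_summable: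
  assumes "l \<noteq> 0" "summable (\<lambda>n. norm (b n))" "z \<noteq> 0" "\<And>n. b n \<noteq> 0 \<Longrightarrow> z \<noteq> l / q ^ n"
  shows "summable (\<lambda>n. b n / (1 - z / (l / q ^ n)) ^ j)"
proof -
  obtain r where r: "0 < r"
    "uniform_limit (ball z r) (\<lambda>N w. \<Sum>n<N. b n / (1 - w / (l / q ^ n)) ^ j) (pole_series l b j) sequentially"
    using pole_series_uniform[OF assms] by blast
  then have "(\<lambda>N. \<Sum>n<N. b n / (1 - z / (l / q ^ n)) ^ j) \<longlonglongrightarrow> pole_series l b j z"
    by (intro tendsto_uniform_limitI) auto
  then show ?thesis by (auto simp: summable_def sums_def)
qed

text \<open>Used at the pole \<open>l / q ^ m\<close> itself: the modified series is analytic there,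
  and the singular term is explicit.\<close>

lemma pole_series_split:
  assumes "l \<noteq> 0" "summable (\<lambda>n. norm (b n))" "z \<noteq> 0" "\<And>n. z \<noteq> l / q ^ n"
  shows "pole_series l b j z = pole_series l (b(m := 0)) j z + b m / (1 - z / (l / q ^ m)) ^ j"
proof -
  define t where "t n = b n / (1 - z / (l / q ^ n)) ^ j" for n
  have "t sums pole_series l b j z"
    unfolding t_def pole_series_def using assms by (intro summable_sums pole_series_summable) auto
  moreover have "(\<lambda>n. if n = m then t n else 0) sums t m" by (rule sums_single)
  ultimately have "(\<lambda>n. t n - (if n = m then t n else 0)) sums (pole_series l b j z - t m)"
    by (rule sums_diff)
  moreover have "(\<lambda>n. t n - (if n = m then t n else 0)) = (\<lambda>n. (b(m := 0)) n / (1 - z / (l / q ^ n)) ^ j)"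
    by (auto simp: t_def fun_eq_iff)
  ultimately have "pole_series l (b(m := 0)) j z = pole_series l b j z - t m"
    unfolding pole_series_def[of l "b(m := 0)"] by (simp add: sums_iff)
  then show ?thesis by (simp add: t_def)
qed

text \<open>Each term is expanded by \<open>geometric_power_remainder\<close> with u = z q^n / l.
  Its weight min(1, |1 - u|)^j is at least the distance to \<Lambda>, since \<open>j\<close> is at
  most the multiplicity, and |u|^N contributes p^(nN). Summed against the decay of \<open>b\<close>,
  this is exactly the sum estimated in \<open>gauss_sum_bound\<close>.\<close>

lemma pole_series_A_space:
  assumes "reps rep \<Lambda>" "s \<in># \<Lambda>" "l = rep s" "j \<le> count \<Lambda> s" "0 < A"
    and b: "\<And>n. norm (b n) \<le> C * A ^ n * p powr (- real (size \<Lambda>) * (real n)\<^sup>2 / 2)"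
  shows "pole_series l b j \<in> A_space q \<Lambda>" "summable (\<lambda>n. norm (b n))"
proof -
  define k where "k = size \<Lambda>"
  have k: "1 \<le> k" using assms(2) by (cases \<Lambda>) (auto simp: k_def)
  have l: "l \<noteq> 0" "s = spiral q l" using assms(1-3) by (auto simp: reps_def)
  have C: "0 \<le> C" using order_trans[OF norm_ge_zero b[of 0]] by simp
  obtain K B where K0: "0 < K" "0 < B"
    "\<forall>N. summable (\<lambda>n. A ^ n * p powr (- real k * (real n)\<^sup>2 / 2) * p ^ (n * N))"
    "\<forall>N. (\<Sum>n. A ^ n * p powr (- real k * (real n)\<^sup>2 / 2) * p ^ (n * N)) \<le> K * B ^ N * p powr ((real N)\<^sup>2 / (2 * real k))"
    by (rule gauss_sum_bound[OF k assms(5)]) (rule that; assumption)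
  note K = K0(1,2) K0(3,4)[rule_format]
  define G where "G N n = C * (A ^ n * p powr (- real k * (real n)\<^sup>2 / 2) * p ^ (n * N))" for N n
  have G: "summable (G N)" for N
    unfolding G_def by (intro summable_mult K)
  have bG: "norm (b n) * p ^ (n * N) \<le> G N n" for n N
    using mult_right_mono[OF b[of n], of "p ^ (n * N)"] by (simp add: G_def k_def mult_ac)
  have sb: "summable (\<lambda>n. norm (b n) * p ^ (n * N))" for N
    by (rule summable_comparison_test'[OF G[of N], of 0]) (use bG in auto)
  then show sb0: "summable (\<lambda>n. norm (b n))" using sb[of 0] by simp
  obtain \<gamma> :: "nat \<Rightarrow> complex" and D where "0 \<le> D" "\<forall>i. norm (\<gamma> i) \<le> D * 2 ^ i"
    and D': "\<forall>N u. u \<noteq> 1 \<longrightarrow> norm (1 / (1 - u) ^ j - (\<Sum>i<N. \<gamma> i * u ^ i)) * min 1 (norm (1 - u)) ^ j \<le> D * 2 ^ N * norm u ^ N"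
    using geometric_power_remainder[of j] by (elim exE conjE) (rule that; assumption)
  note D = this(1) this(2)[rule_format] D'[rule_format]
  define c where "c i n = b n * (\<gamma> i * (q ^ n / l) ^ i)" for i n
  have sc: "summable (c i)" for i
  proof (rule summable_norm_cancel, rule summable_cong[THEN iffD1])
    show "summable (\<lambda>n. norm (\<gamma> i) / norm l ^ i * (norm (b n) * p ^ (n * i)))"
      by (intro summable_mult sb)
    show "\<forall>\<^sub>F n in sequentially. norm (\<gamma> i) / norm l ^ i * (norm (b n) * p ^ (n * i)) = norm (c i n)"
      by (simp add: c_def norm_mult norm_divide norm_power power_divide power_mult[symmetric])
  qed
  define a where "a i = (\<Sum>n. c i n)" for i
  have nz: "z \<noteq> l / q ^ n" if "z \<in> sector \<Lambda> 0 R" for z n R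
  proof
    assume "z = l / q ^ n"
    then have "z \<in> s" unfolding l(2) spiral_def
      by (auto intro!: image_eqI[of _ _ "- int n"] simp: power_int_minus divide_inverse)
    then have "theta_div q rep \<Lambda> z = 0"
      using spiral_notin_imp_theta[OF assms(1)] that assms(2) by (auto simp: sector_iff)
    then show False using that unfolding sector_0_eq[OF assms(1)] by simp
  qed
  show "pole_series l b j \<in> A_space q \<Lambda>"
  proof (rule A_spaceI[OF assms(1) zero_less_one, of _ "D * C * K" "2 / norm l * B" a])
    have "pole_series l b j analytic_on sector \<Lambda> 0 1"
      unfolding analytic_on_analytic_at[of _ "sector \<Lambda> 0 1"]
      using nz by (intro ballI pole_series_analytic l sb0) (auto simp: sector_iff)
    then show "pole_series l b j holomorphic_on sector \<Lambda> 0 1" by (rule analytic_imp_holomorphic)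
    fix N z assume z: "z \<in> sector \<Lambda> 0 1"
    define d where "d = dist_div z \<Lambda>"
    have "z \<noteq> 0" and d: "0 < d" using z by (auto simp: sector_iff d_def)
    define u where "u n = z / (l / q ^ n)" for n
    define r where "r n = 1 / (1 - u n) ^ j - (\<Sum>i<N. \<gamma> i * u n ^ i)" for n
    have "(\<lambda>n. b n / (1 - u n) ^ j) sums pole_series l b j z"
      unfolding pole_series_def u_def using nz[OF z] \<open>z \<noteq> 0\<close>
      by (intro summable_sums pole_series_summable l sb0) auto
    moreover have "(\<lambda>n. \<Sum>i<N. c i n * z ^ i) sums (\<Sum>i<N. a i * z ^ i)"
      unfolding a_def by (intro sums_sum sums_mult2 summable_sums sc)
    ultimately have "(\<lambda>n. b n / (1 - u n) ^ j - (\<Sum>i<N. c i n * z ^ i)) sums (pole_series l b j z - (\<Sum>i<N. a i * z ^ i))"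
      by (rule sums_diff)
    moreover have "b n / (1 - u n) ^ j - (\<Sum>i<N. c i n * z ^ i) = b n * r n" for n
    proof -
      have "c i n * z ^ i = b n * (\<gamma> i * u n ^ i)" for i
        by (simp add: c_def u_def power_mult_distrib power_divide)
      then show ?thesis by (simp add: r_def right_diff_distrib sum_distrib_left)
    qed
    ultimately have sums: "(\<lambda>n. b n * r n) sums (pole_series l b j z - (\<Sum>i<N. a i * z ^ i))" by simp
    define Q where "Q = D * (2 * norm z / norm l) ^ N"
    have Q: "0 \<le> Q" using D by (simp add: Q_def)
    have t: "norm (b n * r n) \<le> Q / d * G N n" for n
    proof -
      have "u n \<noteq> 1" using nz[OF z] l by (auto simp: u_def field_simps)
      have "l / q ^ n \<in> s" unfolding l(2) spiral_def
        by (auto intro!: image_eqI[of _ _ "- int n"] simp: power_int_minus divide_inverse)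
      then have "dist_spiral z s \<le> norm (1 - u n)" unfolding u_def by (rule dist_spiral_le)
      moreover have "dist_spiral z s \<le> 1" "0 \<le> dist_spiral z s"
        unfolding l(2) by (rule dist_spiral_le_1 dist_spiral_nonneg)+
      ultimately have "dist_spiral z s ^ j \<le> min 1 (norm (1 - u n)) ^ j"
        by (intro power_mono) auto
      then have "d \<le> min 1 (norm (1 - u n)) ^ j"
        using dist_div_le_power[OF assms(1,2,4), of z] by (simp add: d_def)
      then have "norm (r n) * d \<le> norm (r n) * min 1 (norm (1 - u n)) ^ j"
        by (intro mult_left_mono) auto
      also have "\<dots> \<le> D * 2 ^ N * norm (u n) ^ N" unfolding r_def by (rule D(3)[OF \<open>u n \<noteq> 1\<close>])
      also have "\<dots> = Q * p ^ (n * N)"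
        by (simp add: u_def Q_def norm_divide norm_mult norm_power power_divide power_mult_distrib power_mult)
      finally have "norm (r n) \<le> Q / d * p ^ (n * N)" using d by (simp add: field_simps)
      then have "norm (b n) * norm (r n) \<le> norm (b n) * (Q / d * p ^ (n * N))"
        by (intro mult_left_mono) auto
      also have "\<dots> = Q / d * (norm (b n) * p ^ (n * N))" by simp
      also have "\<dots> \<le> Q / d * G N n" using Q d bG by (intro mult_left_mono) auto
      finally show ?thesis by (simp add: norm_mult)
    qed
    have "norm (pole_series l b j z - (\<Sum>i<N. a i * z ^ i)) \<le> Q / d * suminf (G N)"
      by (rule norm_sums_le[OF sums sums_mult[OF summable_sums[OF G]] t])
    also have "suminf (G N) = C * (\<Sum>n. A ^ n * p powr (- real k * (real n)\<^sup>2 / 2) * p ^ (n * N))"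
      unfolding G_def by (rule suminf_mult[OF K(3)])
    also have "Q / d * \<dots> \<le> Q / d * (C * (K * B ^ N * p powr ((real N)\<^sup>2 / (2 * real k))))"
      using Q d C K(4) by (intro mult_left_mono) auto
    finally have "norm (pole_series l b j z - (\<Sum>i<N. a i * z ^ i)) * d \<le> Q / d * (C * (K * B ^ N * p powr ((real N)\<^sup>2 / (2 * real k)))) * d"
      using d by (intro mult_right_mono) auto
    also have "\<dots> = Q * (C * (K * B ^ N * p powr ((real N)\<^sup>2 / (2 * real k))))"
      using d by simp
    finally show "norm (pole_series l b j z - (\<Sum>i<N. a i * z ^ i)) * d
       \<le> D * C * K * (2 / norm l * B) ^ N * p powr ((real N)\<^sup>2 / (2 * real (size \<Lambda>))) * norm z ^ N"
      by (simp add: Q_def k_def power_mult_distrib power_divide mult_ac)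
  qed (use D C K l in auto)
qed


subsection \<open>Functions of order zero over a divisor\<close>

lemma spiral_point: "l / q ^ n \<in> spiral q l"
  unfolding spiral_def by (auto intro!: image_eqI[of _ _ "- int n"] simp: power_int_minus divide_inverse)

lemma sector_holomorphic_analytic:
  assumes "reps rep \<Lambda>" "f holomorphic_on sector \<Lambda> 0 R" "z \<in> sector \<Lambda> 0 R"
  shows "f analytic_on {z}"
  using assms open_sector_0[OF assms(1)] by (intro holomorphic_on_imp_analytic_at)

text \<open>The theta bound carries one factor of the distance, which cancels the weight in the
  estimate of \<open>f\<close>. So the product is bounded near each spiral point and extends, and
  the extension inherits the remainder estimates for every truncation.\<close>

lemma A_space_imp_E0:
  assumes "reps rep \<Lambda>" "1 \<le> size \<Lambda>" "f \<in> A_space q \<Lambda>"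
  obtains F R where "F \<in> E0 q rep \<Lambda>" "0 < R" "F holomorphic_on ball 0 R - {0}"
    "\<forall>z\<in>sector \<Lambda> 0 R. F z = theta_div q rep \<Lambda> z * f z"
proof -
  define k where "k = size \<Lambda>"
  define \<theta> where "\<theta> = theta_div q rep \<Lambda>"
  obtain c0 C0 b where A: "0 < c0" "0 < C0"
    "\<And>z. z \<noteq> 0 \<Longrightarrow> c0 * norm z powr b * gauss z ^ size \<Lambda> * dist_div z \<Lambda> \<le> norm (theta_div q rep \<Lambda> z) \<and>
        norm (theta_div q rep \<Lambda> z) \<le> C0 * norm z powr b * gauss z ^ size \<Lambda> * dist_div z \<Lambda>"
    using theta_div_bounds[OF assms(1)] by metis
  obtain R C B a where R: "0 < R" "R \<le> 1" "1 \<le> C" "1 \<le> B" "f holomorphic_on sector \<Lambda> 0 R"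
    and asym: "\<forall>N. \<forall>z\<in>sector \<Lambda> 0 R.
      norm (f z - (\<Sum>n<N. a n * z ^ n)) * dist_div z \<Lambda> \<le> C * B ^ N * p powr ((real N)\<^sup>2 / (2 * real (size \<Lambda>))) * norm z ^ N"
    by (rule A_spaceE[OF assms(1,3)]) (rule that; assumption)
  define S where "S = sector \<Lambda> 0 R"
  define P where "P N z = (\<Sum>n<N. a n * z ^ n)" for N z
  define h where "h z = \<theta> z * f z" for z
  define W where "W N = C0 * C * B ^ N * p powr ((real N)\<^sup>2 / (2 * real k))" for N
  define bd where "bd N z = W N * (norm z ^ N * (norm z powr b * gauss z ^ k))" for N z
  define F where "F = remove_sings h"
  have \<theta>_an: "\<theta> analytic_on {z}" if "z \<noteq> 0" for z
    unfolding \<theta>_def using assms(1) that by (rule theta_div_analytic)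
  have h_an: "h analytic_on {z}" if "z \<in> S" for z
  proof -
    have "z \<noteq> 0" using that by (simp add: S_def sector_iff)
    then show ?thesis unfolding h_def
      by (rule analytic_on_mult[OF \<theta>_an sector_holomorphic_analytic[OF assms(1) R(5) that[unfolded S_def]]])
  qed
  have F_h: "F z = h z" if "z \<in> S" for z
    unfolding F_def by (rule remove_sings_at_analytic[OF h_an[OF that]])
  have ev: "\<forall>\<^sub>F w in at z. w \<in> S" if "0 < norm z" "norm z < R" for z
    unfolding S_def using that by (intro sector_eventually[OF assms(1)]) auto
  have bd_S: "norm (h z - \<theta> z * P N z) \<le> bd N z" if "z \<in> S" for z N
  proof -
    have z: "z \<noteq> 0" "0 < dist_div z \<Lambda>" using that by (auto simp: S_def sector_iff)
    have "norm (h z - \<theta> z * P N z) = norm (\<theta> z) * norm (f z - P N z)"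
      unfolding h_def norm_mult[symmetric] by (simp add: right_diff_distrib)
    also have "\<dots> \<le> (C0 * norm z powr b * gauss z ^ k * dist_div z \<Lambda>) * norm (f z - P N z)"
      unfolding \<theta>_def k_def using A(3)[OF z(1)] by (intro mult_right_mono) auto
    also have "\<dots> = (C0 * norm z powr b * gauss z ^ k) * (norm (f z - P N z) * dist_div z \<Lambda>)"
      by simp
    also have "\<dots> \<le> (C0 * norm z powr b * gauss z ^ k) * (C * B ^ N * p powr ((real N)\<^sup>2 / (2 * real k)) * norm z ^ N)"
      using asym[rule_format, OF that[unfolded S_def], of N] A(2) gauss_pos[OF z(1)]
      unfolding P_def k_def by (intro mult_left_mono) auto
    finally show ?thesis by (simp add: bd_def W_def mult_ac)
  qed
  have bd_cont: "isCont (bd N) z" if "z \<noteq> 0" for z N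
  proof -
    have "isCont gauss z"
      using gauss_continuous that continuous_on_eq_continuous_at[of "- {0}"] by auto
    then show ?thesis
      unfolding bd_def using that by (intro continuous_intros) auto
  qed
  have F_an: "F analytic_on {z}" if "0 < norm z" "norm z < R" for z
    unfolding F_def
  proof (rule remove_sings_bounded)
    show "\<forall>\<^sub>F w in at z. h analytic_on {w}"
      using ev[OF that] by eventually_elim (rule h_an)
    have "z \<noteq> 0" using that by auto
    from bd_cont[OF this, of 0] have "\<forall>\<^sub>F w in at z. bd 0 w < bd 0 z + 1"
      unfolding isCont_def by (rule order_tendstoD) simp
    then show "\<forall>\<^sub>F w in at z. norm (h w) \<le> bd 0 z + 1"
      using ev[OF that]
    proof eventually_elim
      case (elim w)
      then show ?case using bd_S[of w 0] by (simp add: P_def)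
    qed
  qed
  have F_hol: "F holomorphic_on ball 0 R - {0}"
  proof (rule analytic_imp_holomorphic)
    show "F analytic_on ball 0 R - {0}"
      unfolding analytic_on_analytic_at[of _ "ball 0 R - {0}"] by (intro ballI F_an) auto
  qed
  \<comment> \<open>Both sides are continuous on the punctured disc, so the estimate passes from the
    sector to the spiral points, where it is needed.\<close>
  have F_bd: "norm (F z - \<theta> z * P N z) \<le> bd N z" if z: "0 < norm z" "norm z < R" for z N
  proof (rule isCont_norm_le[where f = "\<lambda>z. F z - \<theta> z * P N z"])
    have "z \<noteq> 0" using z by auto
    then show "isCont (bd N) z" by (rule bd_cont)
    have "isCont F z" "isCont \<theta> z"
      using F_an[OF z] \<theta>_an[OF \<open>z \<noteq> 0\<close>] by (auto intro: analytic_at_imp_isCont)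
    then show "isCont (\<lambda>z. F z - \<theta> z * P N z) z"
      unfolding P_def by (intro continuous_intros)
    show "\<forall>\<^sub>F w in at z. norm (F w - \<theta> w * P N w) \<le> bd N w"
      using ev[OF z] by eventually_elim (use bd_S F_h in auto)
  qed
  have W0: "0 < W 0" using A R by (simp add: W_def)
  have "gevrey_at_0 q k F"
    unfolding gevrey_at_0_iff[OF assms(2)[folded k_def]]
  proof (rule exI[of _ "W 0"], rule conjI[OF W0], rule exI[of _ b], rule exI[of _ R], rule conjI[OF R(1)], intro allI impI)
    fix z :: complex assume "0 < norm z \<and> norm z < R"
    then show "norm (F z) \<le> W 0 * norm z powr b * gauss z ^ k"
      using F_bd[of z 0] by (simp add: P_def bd_def mult_ac)
  qed
  moreover have "gevrey_over q rep 0 \<Lambda> {#} F"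
    unfolding gevrey_over_iff[OF F_hol R(1) assms(1)]
  proof (intro ballI allI impI)
    fix s j assume s: "s \<in># \<Lambda>" and j: "count {#} s \<le> j \<and> j < count \<Lambda> s"
    define l where "l = rep s"
    have l: "l \<noteq> 0" "s = spiral q l" using assms(1) s by (auto simp: reps_def l_def)
    obtain N0 where N0: "\<And>n. n \<ge> N0 \<Longrightarrow> norm l * 2 / p ^ n < R"
      using div_power_small[OF R(1)] by metis
    obtain C1 A1 where C1: "0 < C1" "0 < A1"
      "\<And>n w. norm w \<le> 1/2 \<Longrightarrow> norm (l / q ^ n * (1 + w)) powr b * gauss (l / q ^ n * (1 + w)) ^ k
        \<le> C1 * A1 ^ n * p powr (real k * (real n)\<^sup>2 / 2)"
      using gauss_near_spiral[OF l(1)] by metis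
    define D where "D n z = F z - \<theta> z * P (k * n) z" for n z
    have \<theta>_hol: "\<theta> holomorphic_on ball 0 R - {0}"
      unfolding \<theta>_def by (rule holomorphic_on_subset[OF theta_div_holomorphic[OF assms(1)]]) auto
    have D_hol: "D n holomorphic_on ball 0 R - {0}" for n
      unfolding D_def P_def by (intro holomorphic_intros F_hol \<theta>_hol)
    \<comment> \<open>The reason for truncating at \<open>k * n\<close>: the remainder gives the
      exponent \<open>k n\<^sup>2 / 2\<close>, the power of |z| gives \<open>- k n\<^sup>2\<close>
      and the theta factor \<open>k n\<^sup>2 / 2\<close>. Their sum is 0 and only geometric factors
      survive.\<close>
    have kn: "p powr ((real (k * n))\<^sup>2 / (2 * real k)) * (1 / p ^ n) ^ (k * n) * p powr (real k * (real n)\<^sup>2 / 2) = 1" for n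
    proof -
      have 1: "(real (k * n))\<^sup>2 / (2 * real k) = real k * (real n)\<^sup>2 / 2"
        using assms(2) by (simp add: k_def power2_eq_square)
      have "(1 / p ^ n) ^ (k * n) = p powr (- (real k * (real n)\<^sup>2))"
      proof -
        have "p ^ (n * (k * n)) = p powr (real k * (real n)\<^sup>2)"
          unfolding powr_realpow[symmetric, OF p_pos] by (simp add: power2_eq_square mult_ac)
        moreover have "(1 / p ^ n) ^ (k * n) = 1 / p ^ (n * (k * n))"
          by (simp only: power_one_over power_mult)
        ultimately show ?thesis
          by (simp add: powr_minus divide_inverse)
      qed
      then show ?thesis
        unfolding 1 by (simp add: powr_add[symmetric])
    qed
    have D_bd: "norm (D n (l / q ^ n * (1 + w))) \<le> C0 * C * C1 * ((2 * norm l * B) ^ k * A1) ^ n"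
      if n: "n \<ge> N0" and w: "norm w = 1/2" for n w
    proof -
      define z where "z = l / q ^ n * (1 + w)"
      have z: "0 < norm z" "norm z < R"
        using near_spiral_punctured[OF l(1) N0[OF n], of w] w unfolding z_def by auto
      have "norm (1 + w) \<le> 2" using w norm_triangle_ineq[of 1 w] by simp
      then have "norm l * norm (1 + w) \<le> norm l * 2" by (intro mult_left_mono) auto
      then have nz: "norm z \<le> 2 * norm l * (1 / p ^ n)"
        unfolding z_def by (simp add: norm_mult norm_divide norm_power divide_right_mono mult.commute)
      have "norm (D n z) \<le> bd (k * n) z"
        unfolding D_def by (rule F_bd[OF z])
      also have "\<dots> \<le> W (k * n) * ((2 * norm l * (1 / p ^ n)) ^ (k * n) * (C1 * A1 ^ n * p powr (real k * (real n)\<^sup>2 / 2)))"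
        unfolding bd_def z_def
        using A R C1 nz w gauss_pos[of z] z unfolding z_def
        by (intro mult_left_mono mult_mono power_mono C1(3)) (auto simp: W_def)
      also have "\<dots> = C0 * C * C1 * (B ^ (k * n) * (2 * norm l) ^ (k * n) * A1 ^ n) *
          (p powr ((real (k * n))\<^sup>2 / (2 * real k)) * (1 / p ^ n) ^ (k * n) * p powr (real k * (real n)\<^sup>2 / 2))"
        unfolding W_def power_mult_distrib by (simp only: mult_ac)
      also have "\<dots> = C0 * C * C1 * ((2 * norm l * B) ^ k * A1) ^ n"
        unfolding kn by (simp add: power_mult_distrib power_mult mult_ac)
      finally show ?thesis unfolding z_def .
    qed
    have D_growth: "growth 0 (\<lambda>n. tcoeff (\<lambda>w. D n (l / q ^ n * (1 + w))) j)"
    proof (rule growthI[of "C0 * C * C1 / (1/2) ^ j" "(2 * norm l * B) ^ k * A1" N0])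
      fix n assume n: "n \<ge> N0"
      have "norm (tcoeff (\<lambda>w. D n (l / q ^ n * (1 + w))) j) \<le> C0 * C * C1 * ((2 * norm l * B) ^ k * A1) ^ n / (1/2) ^ j"
        by (rule tcoeff_cauchy[OF scaled_holomorphic[OF D_hol l(1) N0[OF n]] _ _ D_bd[OF n]]) simp_all
      then show "norm (tcoeff (\<lambda>w. D n (l / q ^ n * (1 + w))) j)
          \<le> C0 * C * C1 / (1/2) ^ j * ((2 * norm l * B) ^ k * A1) ^ n * p powr (0 * (real n)\<^sup>2 / 2)"
        by (simp add: mult_ac)
    qed (use A R C1 l in auto)
    have "tcoeff (\<lambda>w. F (l / q ^ n * (1 + w))) j = tcoeff (\<lambda>w. D n (l / q ^ n * (1 + w))) j" if n: "n \<ge> N0" for n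
    proof -
      have D_an: "(\<lambda>w. D n (l / q ^ n * (1 + w))) analytic_on {0}"
        using scaled_holomorphic[OF D_hol l(1) N0[OF n]] by (rule holomorphic_on_imp_analytic_at) auto
      have P_an: "(\<lambda>w. P (k * n) (l / q ^ n * (1 + w))) analytic_on {0}"
        unfolding P_def by (intro analytic_intros)
      have \<theta>_an': "(\<lambda>w. \<theta> (l / q ^ n * (1 + w))) analytic_on {0}"
        using scaled_holomorphic[OF \<theta>_hol l(1) N0[OF n]] by (rule holomorphic_on_imp_analytic_at) auto
      \<comment> \<open>The theta product vanishes at the spiral point to the multiplicity of
        \<open>s\<close>, so times the truncated expansion it does not contribute to coefficients of
        smaller index.\<close>
      have "tcoeff (\<lambda>w. \<theta> (l / q ^ n * (1 + w)) * P (k * n) (l / q ^ n * (1 + w))) j = 0"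
      proof -
        have "tcoeff (\<lambda>w. \<theta> (l / q ^ n * (1 + w))) i = 0" if "i \<le> j" for i
          unfolding \<theta>_def using that j by (intro theta_div_tcoeff_zero[OF assms(1) l l_def]) simp
        then show ?thesis
          unfolding tcoeff_mult[OF \<theta>_an' P_an] by (intro sum.neutral) auto
      qed
      moreover have "F z = D n z + \<theta> z * P (k * n) z" for z by (simp add: D_def)
      then have "tcoeff (\<lambda>w. F (l / q ^ n * (1 + w))) j = tcoeff (\<lambda>w. D n (l / q ^ n * (1 + w))) j
          + tcoeff (\<lambda>w. \<theta> (l / q ^ n * (1 + w)) * P (k * n) (l / q ^ n * (1 + w))) j"
        by (simp only:) (intro tcoeff_add D_an analytic_on_mult \<theta>_an' P_an)
      ultimately show ?thesis by simp
    qed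
    then have "growth 0 (\<lambda>n. tcoeff (\<lambda>w. F (l / q ^ n * (1 + w))) j)"
      by (rule growth_cong[OF D_growth])
    then show "growth (real 0) (\<lambda>n. tcoeff (\<lambda>w. F (rep s / q ^ n * (1 + w))) j)"
      by (simp add: l_def)
  qed
  moreover have "analytic_punctured F"
    unfolding analytic_punctured_def using F_hol R(1) by (auto simp: analytic_on_open open_Diff)
  ultimately have "F \<in> E0 q rep \<Lambda>" by (simp add: E0_def k_def)
  moreover have "\<forall>z\<in>sector \<Lambda> 0 R. F z = theta_div q rep \<Lambda> z * f z"
    using F_h unfolding S_def h_def \<theta>_def by blast
  ultimately show ?thesis using that R(1) F_hol by blast
qed

text \<open>Replacing initial terms by 0 makes the bound valid for all \<open>n\<close>. It is
  asserted for every later cut-off too, so that finitely many sequences can share one.\<close>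

lemma growth_eventually_bound:
  assumes "growth k x"
  shows "\<exists>N. \<forall>M\<ge>N. \<exists>C A. 0 < A \<and> (\<forall>n. norm (if n \<ge> M then x n else 0) \<le> C * A ^ n * p powr (k * (real n)\<^sup>2 / 2))"
proof -
  obtain C A N where CA: "1 \<le> C" "1 \<le> A" "\<And>n. n \<ge> N \<Longrightarrow> norm (x n) \<le> C * A ^ n * p powr (k * (real n)\<^sup>2 / 2)"
    using growthE[OF assms] by metis
  show ?thesis
  proof (rule exI[of _ N], intro allI impI, rule exI[of _ C], rule exI[of _ A], intro conjI allI)
    fix M n assume "N \<le> M"
    then show "norm (if n \<ge> M then x n else 0) \<le> C * A ^ n * p powr (k * (real n)\<^sup>2 / 2)"
      using CA by simp
  qed (use CA in auto)
qed

text \<open>The principal parts of \<open>F / theta_div q rep \<Lambda>\<close> along one spiral, set to \<open>0\<close> at the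
  finitely many points where no estimate is available.\<close>

lemma principal_parts:
  assumes "reps rep \<Lambda>" "s \<in># \<Lambda>" "0 < R" "F holomorphic_on ball 0 R - {0}" "gevrey_over q rep 0 \<Lambda> {#} F"
  shows "\<exists>b N. (\<forall>j. j < count \<Lambda> s \<longrightarrow> (\<exists>C A. 0 < A \<and> (\<forall>n. norm (b j n) \<le> C * A ^ n * p powr (- real (size \<Lambda>) * (real n)\<^sup>2 / 2))))
     \<and> (\<forall>n\<ge>N. \<exists>B. \<forall>\<^sub>F z in at (rep s / q ^ n).
           norm (F z / theta_div q rep \<Lambda> z - (\<Sum>j<count \<Lambda> s. b j n / (1 - z / (rep s / q ^ n)) ^ (count \<Lambda> s - j))) \<le> B)"
proof -
  define l where "l = rep s"
  define c where "c = count \<Lambda> s"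
  have l: "l \<noteq> 0" "s = spiral q l" using assms(1,2) by (auto simp: reps_def l_def)
  obtain \<delta> \<kappa> Z where Z: "0 < \<delta>" "\<delta> < 1" "\<And>n. \<kappa> n \<noteq> 0" "growth (size \<Lambda>) \<kappa>" "growth (- real (size \<Lambda>)) (\<lambda>n. 1 / \<kappa> n)"
    "\<And>n. Z n holomorphic_on ball 0 \<delta>" "\<And>n w. norm w < \<delta> \<Longrightarrow> Z n w \<noteq> 0" "\<And>j. growth 0 (\<lambda>n. tcoeff (Z n) j)"
    "\<And>n w. norm w < \<delta> \<Longrightarrow> theta_div q rep \<Lambda> (l / q ^ n * (1 + w)) * Z n w = \<kappa> n * w ^ count \<Lambda> s"
    using theta_normal_form[OF assms(1) l] l_def by metis
  obtain N0 where N0: "\<And>n. n \<ge> N0 \<Longrightarrow> norm l * 2 / p ^ n < R"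
    using div_power_small[OF assms(3)] by metis
  define Fn where "Fn n w = F (l / q ^ n * (1 + w))" for n w
  define \<psi> where "\<psi> n w = Fn n w * Z n w" for n w
  \<comment> \<open>These are the coefficients of the expansion of the quotient in powers of
    \<open>w\<close>; the sign appears because 1 - z/\<xi> = -w.\<close>
  define x where "x j n = (- 1) ^ (c - j) * (1 / \<kappa> n * tcoeff (\<psi> n) j)" for j n
  have Fa: "Fn n analytic_on {0}" if "n \<ge> N0" for n
    unfolding Fn_def using scaled_holomorphic[OF assms(4) l(1) N0[OF that]] by (rule holomorphic_on_imp_analytic_at) auto
  have Za: "Z n analytic_on {0}" for n
    using Z(6) by (rule holomorphic_on_imp_analytic_at) (use Z(1) in simp_all)
  have \<psi>a: "\<psi> n analytic_on {0}" if "n \<ge> N0" for n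
    unfolding \<psi>_def by (intro analytic_intros Fa Za that)
  have gF: "growth 0 (\<lambda>n. tcoeff (Fn n) j)" if "j < c" for j
    using assms(5) assms(2) that unfolding gevrey_over_iff[OF assms(4,3,1)] Fn_def l_def c_def by simp
  have gx: "growth (- real (size \<Lambda>)) (x j)" if "j < c" for j
  proof -
    have "growth (0 + 0) (\<lambda>n. \<Sum>i=0..j. tcoeff (Fn n) i * tcoeff (Z n) (j - i))"
      using that by (intro growth_sum growth_mult gF Z(8)) auto
    then have "growth 0 (\<lambda>n. tcoeff (\<psi> n) j)"
      by (rule growth_cong[where N = N0, OF growth_mono]) (simp_all add: \<psi>_def[abs_def] tcoeff_mult[OF Fa Za])
    then have "growth (- real (size \<Lambda>) + 0) (\<lambda>n. 1 / \<kappa> n * tcoeff (\<psi> n) j)"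
      by (intro growth_mult Z(5))
    then show ?thesis unfolding x_def by (intro growth_cmult) simp
  qed
  have "\<forall>j\<in>{..<c}. \<exists>N. \<forall>M\<ge>N. \<exists>C A. 0 < A \<and> (\<forall>n. norm (if n \<ge> M then x j n else 0) \<le> C * A ^ n * p powr (- real (size \<Lambda>) * (real n)\<^sup>2 / 2))"
    by (intro ballI growth_eventually_bound gx) simp
  then obtain Nf where Nf: "\<forall>j\<in>{..<c}. \<forall>M\<ge>Nf j. \<exists>C A. 0 < A \<and> (\<forall>n. norm (if n \<ge> M then x j n else 0) \<le> C * A ^ n * p powr (- real (size \<Lambda>) * (real n)\<^sup>2 / 2))"
    by (rule bchoice[THEN exE]) (rule that)
  \<comment> \<open>A common cut-off: it lies above \<open>N0\<close> and above each
    \<open>Nf j\<close>.\<close>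
  define N where "N = N0 + (\<Sum>j<c. Nf j)"
  define b where "b j n = (if n \<ge> N then x j n else 0)" for j n
  have b1: "\<exists>C A. 0 < A \<and> (\<forall>n. norm (b j n) \<le> C * A ^ n * p powr (- real (size \<Lambda>) * (real n)\<^sup>2 / 2))" if "j < c" for j
  proof -
    have "Nf j \<le> (\<Sum>j<c. Nf j)" using that by (intro member_le_sum) auto
    then have "Nf j \<le> N" by (simp add: N_def)
    then show ?thesis unfolding b_def using Nf that by blast
  qed
  have b2: "\<exists>B. \<forall>\<^sub>F z in at (l / q ^ n). norm (F z / theta_div q rep \<Lambda> z - (\<Sum>j<c. b j n / (1 - z / (l / q ^ n)) ^ (c - j))) \<le> B"
    if "n \<ge> N" for n
  proof -
    define \<xi> where "\<xi> = l / q ^ n"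
    have "\<xi> \<noteq> 0" using l by (simp add: \<xi>_def)
    have n0: "n \<ge> N0" using that by (simp add: N_def)
    \<comment> \<open>Divided by \<open>\<kappa> n * w ^ c\<close>, the Taylor polynomial becomes
      the principal part, and the remainder becomes \<open>h w / \<kappa> n\<close>, which is
      bounded near 0.\<close>
    obtain h where h: "h analytic_on {0}" "\<forall>\<^sub>F w in nhds 0. \<psi> n w = (\<Sum>j<c. tcoeff (\<psi> n) j * w ^ j) + w ^ c * h w"
      using taylor_remainder[OF \<psi>a[OF n0]] by metis
    have "isCont (\<lambda>w. norm (h w)) 0"
      using analytic_at_imp_isCont[OF h(1)] by (intro continuous_intros)
    then have "(\<lambda>w. norm (h w)) \<midarrow>0\<rightarrow> norm (h 0)" by (simp add: isCont_def)
    then have "\<forall>\<^sub>F w in at 0. norm (h w) < norm (h 0) + 1"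
      by (rule order_tendstoD) simp
    moreover have "\<forall>\<^sub>F w in at 0. w \<in> ball 0 \<delta> - {0}"
      using Z(1) by (intro eventually_at_in_open) auto
    moreover have "\<forall>\<^sub>F w in at 0. \<psi> n w = (\<Sum>j<c. tcoeff (\<psi> n) j * w ^ j) + w ^ c * h w"
      using h(2) by (auto simp: eventually_at_filter elim: eventually_mono)
    ultimately have "\<forall>\<^sub>F w in at 0. norm (F (\<xi> * (1 + w)) / theta_div q rep \<Lambda> (\<xi> * (1 + w)) - (\<Sum>j<c. b j n / (- w) ^ (c - j)))
        \<le> (norm (h 0) + 1) / norm (\<kappa> n)"
    proof eventually_elim
      case (elim w)
      then have w: "w \<noteq> 0" "norm w < \<delta>" by auto
      have t: "theta_div q rep \<Lambda> (\<xi> * (1 + w)) = \<kappa> n * w ^ c / Z n w"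
        using Z(9)[OF w(2), of n] Z(7)[OF w(2), of n] by (simp add: \<xi>_def c_def field_simps)
      have 1: "F (\<xi> * (1 + w)) / theta_div q rep \<Lambda> (\<xi> * (1 + w)) = \<psi> n w / (\<kappa> n * w ^ c)"
        unfolding t by (simp add: \<psi>_def Fn_def \<xi>_def)
      have 2: "b j n / (- w) ^ (c - j) = tcoeff (\<psi> n) j * w ^ j / (\<kappa> n * w ^ c)" if "j < c" for j
      proof -
        have wc: "w ^ c = w ^ (c - j) * w ^ j" using that by (simp add: power_add[symmetric])
        have "(- w) ^ (c - j) = (- 1) ^ (c - j) * w ^ (c - j)" by (rule power_minus)
        then show ?thesis
          unfolding wc using w \<open>n \<ge> N\<close> by (simp add: b_def x_def)
      qed
      have "(\<Sum>j<c. b j n / (- w) ^ (c - j)) = (\<Sum>j<c. tcoeff (\<psi> n) j * w ^ j) / (\<kappa> n * w ^ c)"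
        unfolding sum_divide_distrib by (intro sum.cong refl 2) simp
      then have "F (\<xi> * (1 + w)) / theta_div q rep \<Lambda> (\<xi> * (1 + w)) - (\<Sum>j<c. b j n / (- w) ^ (c - j)) = h w / \<kappa> n"
        unfolding 1 elim(3) using w Z(3)[of n] by (simp add: add_divide_distrib)
      then show ?case using elim(1) by (simp add: norm_divide divide_right_mono)
    qed
    moreover have "filterlim (\<lambda>z. z / \<xi> - 1) (at 0) (at \<xi>)"
    proof (rule filterlim_atI)
      have "((\<lambda>z. z / \<xi> - 1) \<longlongrightarrow> \<xi> / \<xi> - 1) (at \<xi>)"
        using \<open>\<xi> \<noteq> 0\<close> by (intro tendsto_intros)
      then show "((\<lambda>z. z / \<xi> - 1) \<longlongrightarrow> 0) (at \<xi>)" using \<open>\<xi> \<noteq> 0\<close> by simp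
      show "\<forall>\<^sub>F z in at \<xi>. z / \<xi> - 1 \<noteq> 0"
        using \<open>\<xi> \<noteq> 0\<close> by (auto simp: eventually_at_filter)
    qed
    ultimately have "\<forall>\<^sub>F z in at \<xi>. norm (F (\<xi> * (1 + (z / \<xi> - 1))) / theta_div q rep \<Lambda> (\<xi> * (1 + (z / \<xi> - 1)))
         - (\<Sum>j<c. b j n / (- (z / \<xi> - 1)) ^ (c - j))) \<le> (norm (h 0) + 1) / norm (\<kappa> n)"
      unfolding filterlim_iff by (elim allE impE)
    then show ?thesis
      using \<open>\<xi> \<noteq> 0\<close> unfolding \<xi>_def[symmetric] by auto
  qed
  show ?thesis
    unfolding l_def[symmetric] c_def[symmetric] using b1 b2 by blast
qed

text \<open>The pole series reproduce the principal parts of the quotient at all spiral points close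
  enough to 0, so the difference is locally bounded and its singularities are removable. Index
  \<open>j\<close> goes with pole order \<open>count \<Lambda> s - j\<close>, from
  \<open>w ^ j\<close> over \<open>w ^ count \<Lambda> s\<close>.\<close>

lemma decomposition_one:
  assumes "reps rep \<Lambda>" "0 < R" "F holomorphic_on ball 0 R - {0}" "gevrey_over q rep 0 \<Lambda> {#} F"
  obtains G H R' where "G \<in> A_space q \<Lambda>" "0 < R'" "R' \<le> R" "H holomorphic_on ball 0 R' - {0}"
    "\<forall>z\<in>sector \<Lambda> 0 R'. F z = theta_div q rep \<Lambda> z * (G z + H z)"
proof -
  define P where "P s b N \<longleftrightarrow>
      (\<forall>j. j < count \<Lambda> s \<longrightarrow> (\<exists>C A. 0 < A \<and> (\<forall>n. norm (b j n) \<le> C * A ^ n * p powr (- real (size \<Lambda>) * (real n)\<^sup>2 / 2))))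
     \<and> (\<forall>n\<ge>N. \<exists>B. \<forall>\<^sub>F z in at (rep s / q ^ n).
           norm (F z / theta_div q rep \<Lambda> z - (\<Sum>j<count \<Lambda> s. b j n / (1 - z / (rep s / q ^ n)) ^ (count \<Lambda> s - j))) \<le> B)"
    for s b N
  have "\<forall>s\<in>set_mset \<Lambda>. \<exists>b N. P s b N"
    unfolding P_def by (intro ballI principal_parts[OF assms(1) _ assms(2-4)])
  then have "\<forall>s\<in>set_mset \<Lambda>. \<exists>bN. P s (fst bN) (snd bN)"
    by simp
  then obtain bN where bN: "\<forall>s\<in>set_mset \<Lambda>. P s (fst (bN s)) (snd (bN s))"
    by (rule bchoice[THEN exE]) (rule that)
  define b where "b s = fst (bN s)" for s
  define N where "N s = snd (bN s)" for s
  have b_bound: "\<exists>C A. 0 < A \<and> (\<forall>n. norm (b s j n) \<le> C * A ^ n * p powr (- real (size \<Lambda>) * (real n)\<^sup>2 / 2))"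
    if "s \<in># \<Lambda>" "j < count \<Lambda> s" for s j
    using bN that unfolding P_def b_def by blast
  have b_close: "\<exists>B. \<forall>\<^sub>F z in at (rep s / q ^ n).
           norm (F z / theta_div q rep \<Lambda> z - (\<Sum>j<count \<Lambda> s. b s j n / (1 - z / (rep s / q ^ n)) ^ (count \<Lambda> s - j))) \<le> B"
    if "s \<in># \<Lambda>" "n \<ge> N s" for s n
    using bN that unfolding P_def b_def N_def by blast
  have rep: "rep s \<noteq> 0" "s = spiral q (rep s)" if "s \<in># \<Lambda>" for s
    using assms(1) that by (auto simp: reps_def)
  \<comment> \<open>Small enough that every spiral point \<open>rep s / q ^ n\<close> in the disc
    has \<open>n\<close> beyond \<open>N s\<close>, where the coefficients are the true principal
    parts.\<close>
  define R' where "R' = Min (insert R ((\<lambda>s. norm (rep s) / p ^ N s) ` set_mset \<Lambda>))"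
  have R': "0 < R'" "R' \<le> R" "\<And>s. s \<in># \<Lambda> \<Longrightarrow> R' \<le> norm (rep s) / p ^ N s"
    unfolding R'_def using assms(2) rep by (auto simp: Min_gr_iff)
  define g where "g s j = pole_series (rep s) (b s j) (count \<Lambda> s - j)" for s j
  define G where "G z = (\<Sum>s\<in>set_mset \<Lambda>. \<Sum>j<count \<Lambda> s. g s j z)" for z
  have sum_b: "summable (\<lambda>n. norm (b s j n))" and gA: "g s j \<in> A_space q \<Lambda>" if st: "s \<in># \<Lambda>" "j < count \<Lambda> s" for s j
  proof -
    obtain C A where CA: "0 < A" "\<forall>n. norm (b s j n) \<le> C * A ^ n * p powr (- real (size \<Lambda>) * (real n)\<^sup>2 / 2)"
      using b_bound[OF st] by blast
    show "summable (\<lambda>n. norm (b s j n))" "g s j \<in> A_space q \<Lambda>"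
      unfolding g_def
      by (rule pole_series_A_space[OF assms(1) st(1) refl _ CA(1) CA(2)[rule_format], of "count \<Lambda> s - j"]; simp)+
  qed
  have GA: "G \<in> A_space q \<Lambda>"
    unfolding G_def by (intro A_space_sum[OF assms(1)] gA) auto
  have off: "z \<noteq> rep s / q ^ n" if "z \<in> sector \<Lambda> 0 R'" "s \<in># \<Lambda>" for z s n
  proof
    assume "z = rep s / q ^ n"
    then have "z \<in> s" using spiral_point[of "rep s" n] rep[OF that(2)] by simp
    then have "theta_div q rep \<Lambda> z = 0"
      using spiral_notin_imp_theta[OF assms(1)] that by (auto simp: sector_iff)
    then show False using that unfolding sector_0_eq[OF assms(1)] by simp
  qed
  define H0 where "H0 z = F z / theta_div q rep \<Lambda> z - G z" for z
  have H0_an: "H0 analytic_on {z}" if z: "z \<in> sector \<Lambda> 0 R'" for z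
  proof -
    have z': "z \<noteq> 0" "norm z < R'" "theta_div q rep \<Lambda> z \<noteq> 0"
      using z unfolding sector_0_eq[OF assms(1)] by auto
    have "F analytic_on {z}"
      using assms(3) by (rule holomorphic_on_imp_analytic_at) (use z' R' in auto)
    moreover have "theta_div q rep \<Lambda> analytic_on {z}"
      using assms(1) z'(1) by (rule theta_div_analytic)
    moreover have "g s j analytic_on {z}" if "s \<in># \<Lambda>" "j < count \<Lambda> s" for s j
      unfolding g_def using off[OF z] rep that z' by (intro pole_series_analytic sum_b) auto
    then have "G analytic_on {z}"
      unfolding G_def by (intro analytic_intros) auto
    ultimately show ?thesis unfolding H0_def using z' by (intro analytic_intros) auto
  qed
  define H where "H = remove_sings H0"
  have H_an: "H analytic_on {z0}" if z0: "0 < norm z0" "norm z0 < R'" for z0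
  proof -
    have "z0 \<noteq> 0" using z0 by auto
    then have ev: "\<forall>\<^sub>F w in at z0. w \<in> sector \<Lambda> 0 R'"
      using z0 by (intro sector_eventually[OF assms(1)]) auto
    have "\<exists>B. \<forall>\<^sub>F w in at z0. norm (H0 w) \<le> B"
    proof (cases "theta_div q rep \<Lambda> z0 = 0")
      case False
      then have "H0 analytic_on {z0}"
        using z0 by (intro H0_an) (auto simp: sector_0_eq[OF assms(1)])
      then have "isCont (\<lambda>w. norm (H0 w)) z0"
        by (intro continuous_intros analytic_at_imp_isCont)
      then have "(\<lambda>w. norm (H0 w)) \<midarrow>z0\<rightarrow> norm (H0 z0)" by (simp add: isCont_def)
      then have "\<forall>\<^sub>F w in at z0. norm (H0 w) < norm (H0 z0) + 1"
        by (rule order_tendstoD) simp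
      then show ?thesis by (intro exI[of _ "norm (H0 z0) + 1"]) (auto elim: eventually_mono)
    next
      case True
      then obtain s where s: "s \<in># \<Lambda>" "z0 \<in> s"
        using spiral_notin_imp_theta[OF assms(1) \<open>z0 \<noteq> 0\<close>] by blast
      define l where "l = rep s"
      define c where "c = count \<Lambda> s"
      have l: "l \<noteq> 0" "s = spiral q l" using rep[OF s(1)] by (auto simp: l_def)
      obtain i where i: "z0 = l * q powi i" using s(2) l(2) by (auto simp: spiral_def)
      have "norm l * p powi i < norm l / p ^ N s"
        using R'(3)[OF s(1)] z0 unfolding i l_def by (simp add: norm_mult norm_power_int)
      then have pi: "p powi i < p powi (- int (N s))"
        using l(1) by (simp add: power_int_minus divide_inverse)
      have "i < - int (N s)"
      proof (rule ccontr)
        assume "\<not> i < - int (N s)"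
        then have "p powi (- int (N s)) \<le> p powi i"
          using q_gt_1 by (intro power_int_increasing) auto
        then show False using pi by simp
      qed
      define n where "n = nat (- i)"
      have n: "n \<ge> N s" "i = - int n"
        using \<open>i < - int (N s)\<close> by (auto simp: n_def)
      have zn: "z0 = l / q ^ n" using i n(2) by (simp add: power_int_minus divide_inverse)
      obtain B where B: "\<forall>\<^sub>F z in at z0.
           norm (F z / theta_div q rep \<Lambda> z - (\<Sum>j<c. b s j n / (1 - z / (l / q ^ n)) ^ (c - j))) \<le> B"
        using b_close[OF s(1) n(1)] unfolding zn l_def c_def by blast
      \<comment> \<open>\<open>G\<close> without its principal part at \<open>z0\<close>. It is
        analytic there: distinct spirals are disjoint, and in the series of \<open>s\<close> the
        coefficient belonging to \<open>z0\<close> has been set to 0.\<close>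
      define K where "K z = (\<Sum>s'\<in>set_mset \<Lambda> - {s}. \<Sum>j<count \<Lambda> s'. g s' j z)
         + (\<Sum>j<c. pole_series l ((b s j)(n := 0)) (c - j) z)" for z
      have K_an: "K analytic_on {z0}"
      proof -
        have "g s' j analytic_on {z0}" if s': "s' \<in># \<Lambda>" "s' \<noteq> s" "j < count \<Lambda> s'" for s' j
        proof -
          have "z0 \<noteq> rep s' / q ^ m" for m
          proof
            assume "z0 = rep s' / q ^ m"
            then have "z0 \<in> spiral q (rep s')" by (simp add: spiral_point)
            then have "spiral q z0 = s'" using spiral_eq rep[OF s'(1)] by metis
            moreover have "spiral q z0 = s" using spiral_eq s(2) l(2) by metis
            ultimately show False using s'(2) by simp
          qed
          then show ?thesis
            unfolding g_def using rep s' \<open>z0 \<noteq> 0\<close> by (intro pole_series_analytic sum_b) auto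
        qed
        moreover have "pole_series l ((b s j)(n := 0)) (c - j) analytic_on {z0}" if "j < c" for j
        proof (rule pole_series_analytic[OF l(1) _ \<open>z0 \<noteq> 0\<close>])
          have "summable (\<lambda>n. norm (b s j n))" using sum_b[OF s(1)] that by (simp add: c_def)
          then show "summable (\<lambda>m. norm (((b s j)(n := 0)) m))"
            by (rule summable_comparison_test'[where N = 0]) auto
          fix m assume "((b s j)(n := 0)) m \<noteq> 0"
          then have "m \<noteq> n" by (auto split: if_splits)
          show "z0 \<noteq> l / q ^ m"
          proof
            assume "z0 = l / q ^ m"
            then have "q ^ m = q ^ n" using zn l(1) by (simp add: field_simps)
            then have "p ^ m = p ^ n" by (metis norm_power)
            then show False using \<open>m \<noteq> n\<close> q_gt_1 by (simp add: power_inject_exp)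
          qed
        qed
        ultimately show ?thesis unfolding K_def by (intro analytic_intros) auto
      qed
      have "\<forall>\<^sub>F w in at z0. G w = K w + (\<Sum>j<c. b s j n / (1 - w / (l / q ^ n)) ^ (c - j))"
        using ev
      proof eventually_elim
        case (elim w)
        have "w \<noteq> 0" using elim by (simp add: sector_iff)
        have "g s j w = pole_series l ((b s j)(n := 0)) (c - j) w + b s j n / (1 - w / (l / q ^ n)) ^ (c - j)" if "j < c" for j
          unfolding g_def l_def c_def using sum_b[OF s(1)] off[OF elim s(1)] rep[OF s(1)] that \<open>w \<noteq> 0\<close>
          by (intro pole_series_split) (auto simp: c_def)
        then have "(\<Sum>j<c. g s j w) = (\<Sum>j<c. pole_series l ((b s j)(n := 0)) (c - j) w + b s j n / (1 - w / (l / q ^ n)) ^ (c - j))"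
          by (intro sum.cong) auto
        moreover have "G w = (\<Sum>j<c. g s j w) + (\<Sum>s'\<in>set_mset \<Lambda> - {s}. \<Sum>j<count \<Lambda> s'. g s' j w)"
          unfolding G_def c_def using s(1) by (intro sum.remove) auto
        ultimately show ?case by (simp add: K_def sum.distrib)
      qed
      moreover have "isCont (\<lambda>w. norm (K w)) z0"
        using K_an by (intro continuous_intros analytic_at_imp_isCont)
      then have "(\<lambda>w. norm (K w)) \<midarrow>z0\<rightarrow> norm (K z0)" by (simp add: isCont_def)
      then have "\<forall>\<^sub>F w in at z0. norm (K w) < norm (K z0) + 1"
        by (rule order_tendstoD) simp
      ultimately have "\<forall>\<^sub>F w in at z0. norm (H0 w) \<le> B + (norm (K z0) + 1)"
        using B
      proof eventually_elim
        case (elim w)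
        have "H0 w = (F w / theta_div q rep \<Lambda> w - (\<Sum>j<c. b s j n / (1 - w / (l / q ^ n)) ^ (c - j))) - K w"
          unfolding H0_def elim(1) by simp
        then have "norm (H0 w) \<le> norm (F w / theta_div q rep \<Lambda> w - (\<Sum>j<c. b s j n / (1 - w / (l / q ^ n)) ^ (c - j))) + norm (K w)"
          using norm_triangle_ineq4 by metis
        then show ?case using elim(2,3) by linarith
      qed
      then show ?thesis ..
    qed
    then obtain B where "\<forall>\<^sub>F w in at z0. norm (H0 w) \<le> B" ..
    moreover have "\<forall>\<^sub>F w in at z0. H0 analytic_on {w}"
      using ev by eventually_elim (rule H0_an)
    ultimately show ?thesis
      unfolding H_def by (intro remove_sings_bounded)
  qed
  show ?thesis
  proof (rule that[OF GA R'(1,2)])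
    show "H holomorphic_on ball 0 R' - {0}"
    proof (rule analytic_imp_holomorphic)
      show "H analytic_on ball 0 R' - {0}"
        unfolding analytic_on_analytic_at[of _ "ball 0 R' - {0}"] by (intro ballI H_an) auto
    qed
    show "\<forall>z\<in>sector \<Lambda> 0 R'. F z = theta_div q rep \<Lambda> z * (G z + H z)"
    proof
      fix z assume z: "z \<in> sector \<Lambda> 0 R'"
      then have "theta_div q rep \<Lambda> z \<noteq> 0" unfolding sector_0_eq[OF assms(1)] by simp
      moreover have "H z = H0 z"
        unfolding H_def by (rule remove_sings_at_analytic[OF H0_an[OF z]])
      ultimately show "F z = theta_div q rep \<Lambda> z * (G z + H z)" by (simp add: H0_def)
    qed
  qed
qed

end

subsection \<open>Ordered partitions\<close>

lemma germ_eqI: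
  assumes "0 < R" "\<And>z. z \<in> sector \<Lambda> 0 R \<Longrightarrow> f z = g z"
  shows "germ \<Lambda> f = germ \<Lambda> g"
proof -
  have sub: "germ \<Lambda> f \<subseteq> germ \<Lambda> g"
    if R: "0 < R" "\<And>z. z \<in> sector \<Lambda> 0 R \<Longrightarrow> f z = g z" for f g :: "complex \<Rightarrow> complex" and R
  proof
    fix h assume "h \<in> germ \<Lambda> f"
    then obtain R1 where R1: "R1 > 0" "\<forall>z\<in>sector \<Lambda> 0 R1. h z = f z"
      by (auto simp: germ_def)
    have "h z = g z" if "z \<in> sector \<Lambda> 0 (min R R1)" for z
    proof -
      have "z \<in> sector \<Lambda> 0 R" "z \<in> sector \<Lambda> 0 R1" using that by (auto simp: sector_iff)
      then show ?thesis using R(2) R1(2) by simp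
    qed
    then show "h \<in> germ \<Lambda> g"
      unfolding germ_def using R(1) R1(1) by (intro CollectI exI[of _ "min R R1"]) auto
  qed
  show ?thesis
    by (intro subset_antisym; rule sub[OF assms(1)]) (simp_all add: assms(2))
qed

lemma analytic_punctured_iff: "analytic_punctured F \<longleftrightarrow> (\<exists>R>0. F holomorphic_on ball 0 R - {0})"
  unfolding analytic_punctured_def by (simp add: analytic_on_open open_Diff)

lemma common_punctured_disc:
  assumes "finite I" "\<And>i. i \<in> I \<Longrightarrow> analytic_punctured (F i)"
  obtains R where "0 < R" "\<forall>i\<in>I. F i holomorphic_on ball 0 R - {0}"
proof -
  have "\<exists>R>0. \<forall>i\<in>I. F i holomorphic_on ball 0 R - {0}"
    using assms
  proof (induction I rule: finite_induct)
    case empty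
    show ?case by (intro exI[of _ 1]) auto
  next
    case (insert i I)
    obtain R1 where R1: "R1 > 0" "\<forall>i\<in>I. F i holomorphic_on ball 0 R1 - {0}"
      using insert by auto
    obtain R2 where R2: "R2 > 0" "F i holomorphic_on ball 0 R2 - {0}"
      using insert.prems[of i] by (auto simp: analytic_punctured_iff)
    have "F j holomorphic_on ball 0 (min R1 R2) - {0}" if "j \<in> insert i I" for j
    proof (cases "j = i")
      case True
      then show ?thesis by (auto intro: holomorphic_on_subset[OF R2(2)])
    next
      case False
      then have "F j holomorphic_on ball 0 R1 - {0}" using that R1(2) by blast
      then show ?thesis by (rule holomorphic_on_subset) auto
    qed
    then show ?case using R1 R2 by (intro exI[of _ "min R1 R2"]) auto
  qed
  then show ?thesis using that by blast
qed

lemma div_ge_empty [simp]: "m < i \<Longrightarrow> div_ge m L i = {#}"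
  by (simp add: div_ge_def)

lemma div_ge_rec: "i \<le> m \<Longrightarrow> div_ge m L i = L i + div_ge m L (i + 1)"
  by (simp add: div_ge_def sum.atLeast_Suc_atMost)

lemma div_ge_Suc: "i \<le> Suc m \<Longrightarrow> div_ge (Suc m) L i = div_ge m L i + L (Suc m)"
  by (simp add: div_ge_def)

lemma div_ge_mono:
  assumes "i \<le> i'"
  shows "div_ge m L i' \<subseteq># div_ge m L i"
  using assms
proof (induction i' rule: dec_induct)
  case (step n)
  have "div_ge m L (Suc n) \<subseteq># div_ge m L n"
    by (cases "n \<le> m") (simp_all add: div_ge_rec)
  then show ?case using step by (meson subset_mset.order_trans)
qed simp

lemma L_subset_div_ge:
  assumes "i \<in> {1..m}"
  shows "L i \<subseteq># div_ge m L 1"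
proof -
  have "L i \<subseteq># div_ge m L i" using assms by (simp add: div_ge_rec)
  also have "\<dots> \<subseteq># div_ge m L 1" using assms by (intro div_ge_mono) auto
  finally show ?thesis .
qed

lemma div_le_add_div_ge:
  assumes "i \<le> m"
  shows "div_le L i + div_ge m L (i + 1) = div_ge m L 1"
  using assms
proof (induction i)
  case (Suc i)
  then show ?case using div_ge_rec[of "Suc i" m L] by (simp add: div_le_def add_ac)
qed (simp add: div_le_def)

section \<open>Closure properties of the Gevrey conditions, and peeling off the divisors\<close>

context q_theta
begin

text \<open>The radius is at most 1 so that lowering the exponent of |z| weakens the bound;
  estimates with different exponents can then be added.\<close>

lemma gevrey_at_0E:
  assumes "gevrey_at_0 q k F" "1 \<le> k"
  obtains C a R where "0 < C" "0 < R" "R \<le> 1"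
    "\<forall>z. 0 < norm z \<and> norm z < R \<longrightarrow> norm (F z) \<le> C * norm z powr a * gauss z ^ k"
proof -
  obtain C a R where *: "0 < C" "0 < R" "\<forall>z. 0 < norm z \<and> norm z < R \<longrightarrow> norm (F z) \<le> C * norm z powr a * gauss z ^ k"
    using assms(1) unfolding gevrey_at_0_iff[OF assms(2)] by (elim exE conjE) (rule that; assumption)
  show ?thesis
    by (rule that[OF *(1), of "min R 1"]) (use *(2,3) in auto)
qed

lemma gevrey_at_0I:
  assumes "1 \<le> k" "0 < C" "0 < R"
    "\<And>z. 0 < norm z \<Longrightarrow> norm z < R \<Longrightarrow> norm (F z) \<le> C * norm z powr a * gauss z ^ k"
  shows "gevrey_at_0 q k F"
  unfolding gevrey_at_0_iff[OF assms(1)]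
  by (rule exI[of _ C], rule conjI[OF assms(2)], rule exI[of _ a], rule exI[of _ R], rule conjI[OF assms(3)])
     (intro allI impI, elim conjE, rule assms(4))

lemma gevrey_at_0_add:
  assumes "1 \<le> k" "gevrey_at_0 q k F" "gevrey_at_0 q k G"
  shows "gevrey_at_0 q k (\<lambda>z. F z + G z)"
proof -
  obtain C a R where F: "0 < C" "0 < R" "R \<le> 1"
    "\<forall>z. 0 < norm z \<and> norm z < R \<longrightarrow> norm (F z) \<le> C * norm z powr a * gauss z ^ k"
    by (rule gevrey_at_0E[OF assms(2,1)]) (rule that; assumption)
  obtain C' a' R' where G: "0 < C'" "0 < R'" "R' \<le> 1"
    "\<forall>z. 0 < norm z \<and> norm z < R' \<longrightarrow> norm (G z) \<le> C' * norm z powr a' * gauss z ^ k"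
    by (rule gevrey_at_0E[OF assms(3,1)]) (rule that; assumption)
  show ?thesis
  proof (rule gevrey_at_0I[OF assms(1), of "C + C'" "min R R'" _ "min a a'"])
    fix z :: complex assume z: "0 < norm z" "norm z < min R R'"
    have g: "0 < gauss z" using z by (intro gauss_pos) auto
    have "norm (F z) \<le> C * norm z powr a * gauss z ^ k" using F z by simp
    also have "\<dots> \<le> C * norm z powr (min a a') * gauss z ^ k"
      using F z g by (intro mult_right_mono mult_left_mono powr_mono') auto
    finally have 1: "norm (F z) \<le> C * norm z powr (min a a') * gauss z ^ k" .
    have "norm (G z) \<le> C' * norm z powr a' * gauss z ^ k" using G z by simp
    also have "\<dots> \<le> C' * norm z powr (min a a') * gauss z ^ k"
      using G F z g by (intro mult_right_mono mult_left_mono powr_mono') auto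
    finally have 2: "norm (G z) \<le> C' * norm z powr (min a a') * gauss z ^ k" .
    show "norm (F z + G z) \<le> (C + C') * norm z powr (min a a') * gauss z ^ k"
      using norm_triangle_ineq[of "F z" "G z"] 1 2 by (simp add: distrib_right)
  qed (use F G in auto)
qed

lemma gevrey_at_0_zero: "1 \<le> k \<Longrightarrow> gevrey_at_0 q k (\<lambda>z. 0)"
  by (rule gevrey_at_0I[of k 1 1 _ 0]) (auto intro: zero_le_power less_imp_le gauss_pos)

lemma gevrey_at_0_sum:
  assumes "1 \<le> k" "finite I" "\<And>i. i \<in> I \<Longrightarrow> gevrey_at_0 q k (F i)"
  shows "gevrey_at_0 q k (\<lambda>z. \<Sum>i\<in>I. F i z)"
  using assms(2,3)
  by (induction I rule: finite_induct) (auto intro: gevrey_at_0_zero gevrey_at_0_add assms(1))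

lemma gevrey_at_0_uminus: "gevrey_at_0 q k F \<Longrightarrow> gevrey_at_0 q k (\<lambda>z. - F z)"
  by (simp add: gevrey_at_0_def)

lemma gauss_ge: "0 < norm z \<Longrightarrow> norm z powr (1/2) \<le> gauss z"
  unfolding gauss_def using ln_p_pos by (simp add: powr_half_sqrt mult_le_cancel_left1)

text \<open>Near 0 \<open>gauss\<close> is bounded below by the square root of |z|, so each
  additional factor \<open>gauss\<close> costs at most half a unit in the exponent of |z|.\<close>

lemma gevrey_at_0_mono:
  assumes "1 \<le> k" "k \<le> k'" "gevrey_at_0 q k F"
  shows "gevrey_at_0 q k' F"
proof -
  obtain C a R where F: "0 < C" "0 < R" "R \<le> 1"
    "\<forall>z. 0 < norm z \<and> norm z < R \<longrightarrow> norm (F z) \<le> C * norm z powr a * gauss z ^ k"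
    by (rule gevrey_at_0E[OF assms(3,1)]) (rule that; assumption)
  define d where "d = k' - k"
  show ?thesis
  proof (rule gevrey_at_0I[of k' C R _ "a - real d / 2"])
    fix z :: complex assume z: "0 < norm z" "norm z < R"
    have g: "0 < gauss z" using z by (intro gauss_pos) auto
    have "(norm z powr (1/2)) ^ d \<le> gauss z ^ d"
      using z by (intro power_mono gauss_ge) auto
    also have "(norm z powr (1/2)) ^ d = norm z powr (real d / 2)"
      using z by (simp add: powr_power)
    finally have "norm z powr (a - real d / 2) * norm z powr (real d / 2) \<le> norm z powr (a - real d / 2) * gauss z ^ d"
      by (intro mult_left_mono) auto
    then have "norm z powr a \<le> norm z powr (a - real d / 2) * gauss z ^ d"
      by (simp add: powr_add[symmetric])
    then have "C * norm z powr a * gauss z ^ k \<le> C * (norm z powr (a - real d / 2) * gauss z ^ d) * gauss z ^ k"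
      using F g by (intro mult_right_mono mult_left_mono) auto
    also have "\<dots> = C * norm z powr (a - real d / 2) * gauss z ^ k'"
      using assms(2) by (simp add: d_def power_add[symmetric] mult.assoc)
    finally have "C * norm z powr a * gauss z ^ k \<le> C * norm z powr (a - real d / 2) * gauss z ^ k'" .
    moreover have "norm (F z) \<le> C * norm z powr a * gauss z ^ k"
      using z by (intro F(4)[rule_format]) simp
    ultimately show "norm (F z) \<le> C * norm z powr (a - real d / 2) * gauss z ^ k'" by linarith
  qed (use assms F in auto)
qed

lemma theta_div_upper:
  assumes "reps rep \<Lambda>"
  obtains C b where "0 < C" "\<forall>z. z \<noteq> 0 \<longrightarrow> norm (theta_div q rep \<Lambda> z) \<le> C * norm z powr b * gauss z ^ size \<Lambda>"
proof -
  obtain c0 C0 b where A: "0 < c0" "0 < C0"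
    "\<And>z. z \<noteq> 0 \<Longrightarrow> c0 * norm z powr b * gauss z ^ size \<Lambda> * dist_div z \<Lambda> \<le> norm (theta_div q rep \<Lambda> z) \<and>
        norm (theta_div q rep \<Lambda> z) \<le> C0 * norm z powr b * gauss z ^ size \<Lambda> * dist_div z \<Lambda>"
    using theta_div_bounds[OF assms(1)] by metis
  have "norm (theta_div q rep \<Lambda> z) \<le> C0 * norm z powr b * gauss z ^ size \<Lambda>" if "z \<noteq> 0" for z
  proof -
    have "norm (theta_div q rep \<Lambda> z) \<le> C0 * norm z powr b * gauss z ^ size \<Lambda> * dist_div z \<Lambda>"
      using A(3)[OF that] by blast
    also have "\<dots> \<le> C0 * norm z powr b * gauss z ^ size \<Lambda> * 1"
      using A(2) gauss_pos[OF that] dist_div_bounds[OF assms(1), of z] by (intro mult_left_mono) auto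
    finally show ?thesis by simp
  qed
  then show ?thesis using A(2) by (intro that) auto
qed

text \<open>The logarithm of the comparison function is a quadratic polynomial in ln |z| with
  positive leading coefficient, hence bounded below. This is the bound for the denominators
  \<open>theta_div q rep (div_le L (i - 1))\<close>.\<close>

lemma theta_div_lower:
  assumes "reps rep \<Lambda>"
  obtains c where "0 < c" "\<forall>z. z \<noteq> 0 \<longrightarrow> c * dist_div z \<Lambda> \<le> norm (theta_div q rep \<Lambda> z)"
proof (cases "\<Lambda> = {#}")
  case True
  then show ?thesis by (intro that[of 1]) auto
next
  case False
  define k where "k = size \<Lambda>"
  have k: "0 < real k" using False by (simp add: k_def nonempty_has_size)
  obtain c0 C0 b where A: "0 < c0" "0 < C0"
    "\<And>z. z \<noteq> 0 \<Longrightarrow> c0 * norm z powr b * gauss z ^ size \<Lambda> * dist_div z \<Lambda> \<le> norm (theta_div q rep \<Lambda> z) \<and>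
        norm (theta_div q rep \<Lambda> z) \<le> C0 * norm z powr b * gauss z ^ size \<Lambda> * dist_div z \<Lambda>"
    using theta_div_bounds[OF assms(1)] by metis
  \<comment> \<open>The linear coefficient in ln |z|; the summand k/2 stems from the square root in
    \<open>gauss\<close>. The exponent of \<open>c\<close> is the minimum of the quadratic
    polynomial.\<close>
  define \<beta> where "\<beta> = b + real k / 2"
  define c where "c = exp (- (\<beta>\<^sup>2 * ln p / (2 * real k)))"
  have *: "c \<le> norm z powr b * gauss z ^ k" if "z \<noteq> 0" for z
  proof -
    define x where "x = ln (norm z)"
    have g: "gauss z = exp (x / 2 + x\<^sup>2 / (2 * ln p))"
      using that by (simp add: gauss_def x_def exp_add powr_half_sqrt[symmetric] powr_def)
    have "norm z powr b * gauss z ^ k = exp (b * x + real k * (x / 2 + x\<^sup>2 / (2 * ln p)))"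
      unfolding g using that by (simp add: powr_def x_def exp_add exp_of_nat_mult)
    also have "b * x + real k * (x / 2 + x\<^sup>2 / (2 * ln p)) = (real k * x + \<beta> * ln p)\<^sup>2 / (2 * real k * ln p) - \<beta>\<^sup>2 * ln p / (2 * real k)"
      using k ln_p_pos by (simp add: \<beta>_def power2_eq_square field_simps)
    also have "exp \<dots> \<ge> c"
      unfolding c_def using k ln_p_pos by simp
    finally show ?thesis .
  qed
  have "c0 * c * dist_div z \<Lambda> \<le> norm (theta_div q rep \<Lambda> z)" if "z \<noteq> 0" for z
  proof -
    have "c0 * c * dist_div z \<Lambda> \<le> c0 * (norm z powr b * gauss z ^ k) * dist_div z \<Lambda>"
      using A(1) *[OF that] dist_div_bounds[OF assms(1), of z] by (intro mult_right_mono mult_left_mono) auto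
    also have "\<dots> \<le> norm (theta_div q rep \<Lambda> z)"
      using A(3)[OF that] by (simp add: k_def mult_ac)
    finally show ?thesis .
  qed
  then show ?thesis using A(1) by (intro that[of "c0 * c"]) (auto simp: c_def)
qed

lemma gevrey_at_0_theta_mult:
  assumes "reps rep \<Lambda>" "1 \<le> k" "gevrey_at_0 q k F"
  shows "gevrey_at_0 q (k + size \<Lambda>) (\<lambda>z. theta_div q rep \<Lambda> z * F z)"
proof -
  obtain C a R where F: "0 < C" "0 < R" "R \<le> 1"
    "\<forall>z. 0 < norm z \<and> norm z < R \<longrightarrow> norm (F z) \<le> C * norm z powr a * gauss z ^ k"
    by (rule gevrey_at_0E[OF assms(3,2)]) (rule that; assumption)
  obtain C' b where T: "0 < C'" "\<forall>z. z \<noteq> 0 \<longrightarrow> norm (theta_div q rep \<Lambda> z) \<le> C' * norm z powr b * gauss z ^ size \<Lambda>"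
    by (rule theta_div_upper[OF assms(1)]) (rule that; assumption)
  show ?thesis
  proof (rule gevrey_at_0I[of _ "C' * C" R _ "b + a"])
    fix z :: complex assume z: "0 < norm z" "norm z < R"
    have g: "0 < gauss z" using z by (intro gauss_pos) auto
    have "norm (theta_div q rep \<Lambda> z * F z) \<le> (C' * norm z powr b * gauss z ^ size \<Lambda>) * (C * norm z powr a * gauss z ^ k)"
      unfolding norm_mult using T F z g by (intro mult_mono) auto
    then show "norm (theta_div q rep \<Lambda> z * F z) \<le> C' * C * norm z powr (b + a) * gauss z ^ (k + size \<Lambda>)"
      by (simp add: powr_add power_add mult_ac)
  qed (use assms F T in auto)
qed

lemma tcoeff_growth_of_gevrey:
  assumes "F holomorphic_on ball 0 R - {0}" "0 < R" "l \<noteq> 0" "1 \<le> k" "gevrey_at_0 q k F"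
  shows "growth k (\<lambda>n. tcoeff (\<lambda>w. F (l / q ^ n * (1 + w))) j)"
proof -
  obtain C a R' where F: "0 < C" "0 < R'" "R' \<le> 1"
    "\<forall>z. 0 < norm z \<and> norm z < R' \<longrightarrow> norm (F z) \<le> C * norm z powr a * gauss z ^ k"
    by (rule gevrey_at_0E[OF assms(5,4)]) (rule that; assumption)
  show ?thesis
  proof (rule tcoeff_growth_of_bound[of F "min R R'" l C a])
    show "F holomorphic_on ball 0 (min R R') - {0}"
      by (rule holomorphic_on_subset[OF assms(1)]) auto
  qed (use F assms in auto)
qed

lemma gevrey_over_of_at_0:
  assumes "F holomorphic_on ball 0 R - {0}" "0 < R" "reps rep \<Lambda>" "1 \<le> k" "k \<le> k'" "gevrey_at_0 q k F"
  shows "gevrey_over q rep k' \<Lambda> \<Lambda>' F"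
  unfolding gevrey_over_iff[OF assms(1-3)]
proof (intro ballI allI impI)
  fix s j assume "s \<in># \<Lambda>"
  then have "rep s \<noteq> 0" using assms(3) by (auto simp: reps_def)
  then show "growth (real k') (\<lambda>n. tcoeff (\<lambda>w. F (rep s / q ^ n * (1 + w))) j)"
    using assms(5) by (intro growth_mono[OF tcoeff_growth_of_gevrey[OF assms(1,2) _ assms(4,6)]]) auto
qed

lemma scaled_analytic_eventually:
  assumes "F holomorphic_on ball 0 R - {0}" "0 < R" "l \<noteq> 0"
  obtains N where "\<forall>n\<ge>N. (\<lambda>w. F (l / q ^ n * (1 + w))) analytic_on {0}"
proof -
  obtain N where N: "\<And>n. n \<ge> N \<Longrightarrow> norm l * 2 / p ^ n < R"
    using div_power_small[OF assms(2)] by metis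
  show ?thesis
  proof (rule that[of N], intro allI impI)
    fix n assume "n \<ge> N"
    show "(\<lambda>w. F (l / q ^ n * (1 + w))) analytic_on {0}"
      using scaled_holomorphic[OF assms(1,3) N[OF \<open>n \<ge> N\<close>]] by (rule holomorphic_on_imp_analytic_at) auto
  qed
qed

lemma gevrey_over_add:
  assumes "F holomorphic_on ball 0 R - {0}" "G holomorphic_on ball 0 R - {0}" "0 < R" "reps rep \<Lambda>"
    "gevrey_over q rep k \<Lambda> \<Lambda>' F" "gevrey_over q rep k \<Lambda> \<Lambda>' G"
  shows "gevrey_over q rep k \<Lambda> \<Lambda>' (\<lambda>z. F z + G z)"
proof -
  have FG: "(\<lambda>z. F z + G z) holomorphic_on ball 0 R - {0}"
    by (intro holomorphic_intros assms)
  show ?thesis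
    unfolding gevrey_over_iff[OF FG assms(3,4)]
  proof (intro ballI allI impI)
    fix s j assume s: "s \<in># \<Lambda>" and j: "count \<Lambda>' s \<le> j \<and> j < count \<Lambda> s"
    define l where "l = rep s"
    have l: "l \<noteq> 0" using assms(4) s by (auto simp: reps_def l_def)
    obtain N where N: "\<forall>n\<ge>N. (\<lambda>w. F (l / q ^ n * (1 + w))) analytic_on {0}"
      by (rule scaled_analytic_eventually[OF assms(1,3) l]) (rule that; assumption)
    obtain M where M: "\<forall>n\<ge>M. (\<lambda>w. G (l / q ^ n * (1 + w))) analytic_on {0}"
      by (rule scaled_analytic_eventually[OF assms(2,3) l]) (rule that; assumption)
    have "growth (real k) (\<lambda>n. tcoeff (\<lambda>w. F (l / q ^ n * (1 + w))) j + tcoeff (\<lambda>w. G (l / q ^ n * (1 + w))) j)"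
      using assms(5,6) s j unfolding gevrey_over_iff[OF assms(1,3,4)] gevrey_over_iff[OF assms(2-4)] l_def
      by (intro growth_add) auto
    then show "growth (real k) (\<lambda>n. tcoeff (\<lambda>w. F (rep s / q ^ n * (1 + w)) + G (rep s / q ^ n * (1 + w))) j)"
      unfolding l_def[symmetric]
      by (rule growth_cong[where N = "max N M"]) (use N M in \<open>simp add: tcoeff_add\<close>)
  qed
qed

lemma gevrey_over_uminus:
  assumes "F holomorphic_on ball 0 R - {0}" "0 < R" "reps rep \<Lambda>" "gevrey_over q rep k \<Lambda> \<Lambda>' F"
  shows "gevrey_over q rep k \<Lambda> \<Lambda>' (\<lambda>z. - F z)"
proof -
  have F': "(\<lambda>z. - F z) holomorphic_on ball 0 R - {0}"
    by (intro holomorphic_intros assms)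
  show ?thesis
    unfolding gevrey_over_iff[OF F' assms(2,3)]
  proof (intro ballI allI impI)
    fix s j assume s: "s \<in># \<Lambda>" and j: "count \<Lambda>' s \<le> j \<and> j < count \<Lambda> s"
    define l where "l = rep s"
    have l: "l \<noteq> 0" using assms(3) s by (auto simp: reps_def l_def)
    obtain N where N: "\<forall>n\<ge>N. (\<lambda>w. F (l / q ^ n * (1 + w))) analytic_on {0}"
      by (rule scaled_analytic_eventually[OF assms(1,2) l]) (rule that; assumption)
    have "growth (real k) (\<lambda>n. (- 1) * tcoeff (\<lambda>w. F (l / q ^ n * (1 + w))) j)"
      using assms(4) s j unfolding gevrey_over_iff[OF assms(1-3)] l_def
      by (intro growth_cmult) auto
    then show "growth (real k) (\<lambda>n. tcoeff (\<lambda>w. - F (rep s / q ^ n * (1 + w))) j)"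
      unfolding l_def[symmetric]
    proof (rule growth_cong[where N = N])
      fix n assume "n \<ge> N"
      then show "tcoeff (\<lambda>w. - F (l / q ^ n * (1 + w))) j = (- 1) * tcoeff (\<lambda>w. F (l / q ^ n * (1 + w))) j"
        using tcoeff_cmult[OF N[rule_format], of n "- 1" j] by simp
    qed
  qed
qed

lemma gevrey_over_sum:
  assumes "finite I" "\<And>i. i \<in> I \<Longrightarrow> F i holomorphic_on ball 0 R - {0}" "0 < R" "reps rep \<Lambda>"
    "\<And>i. i \<in> I \<Longrightarrow> gevrey_over q rep k \<Lambda> \<Lambda>' (F i)"
  shows "gevrey_over q rep k \<Lambda> \<Lambda>' (\<lambda>z. \<Sum>i\<in>I. F i z)"
  using assms(1,2,5)
proof (induction I rule: finite_induct)
  case empty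
  have "gevrey_over q rep k \<Lambda> \<Lambda>' (\<lambda>z. 0)"
    unfolding gevrey_over_iff[OF holomorphic_on_const assms(3,4)]
    by (intro ballI allI impI) (simp add: tcoeff_def growth_zero)
  then show ?case by simp
next
  case (insert i I)
  have "(\<lambda>z. \<Sum>i\<in>I. F i z) holomorphic_on ball 0 R - {0}"
    using insert.prems by (intro holomorphic_intros) auto
  then have "gevrey_over q rep k \<Lambda> \<Lambda>' (\<lambda>z. F i z + (\<Sum>i\<in>I. F i z))"
    using insert by (intro gevrey_over_add[OF _ _ assms(3,4)]) auto
  then show ?case using insert.hyps by simp
qed

lemma theta_mult_holomorphic:
  assumes "reps rep \<Lambda>" "F holomorphic_on ball 0 R - {0}"
  shows "(\<lambda>z. theta_div q rep \<Lambda> z * F z) holomorphic_on ball 0 R - {0}"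
  by (intro holomorphic_intros assms(2) holomorphic_on_subset[OF theta_div_holomorphic[OF assms(1)]]) auto

text \<open>Below the multiplicity in \<open>B\<close> the coefficients of \<open>theta_div q rep B * F\<close> vanish; above it
  they involve only those of \<open>F\<close> below the multiplicity in \<open>A\<close>.\<close>

lemma theta_mult_gevrey_over:
  assumes "reps rep (A + B)" "0 < R" "F holomorphic_on ball 0 R - {0}" "gevrey_over q rep 0 A {#} F"
    and "\<And>s. s \<in># M \<Longrightarrow> count M s \<le> count (A + B) s" "size B \<le> k"
  shows "gevrey_over q rep k M {#} (\<lambda>z. theta_div q rep B z * F z)"
proof -
  have rA: "reps rep A" and rB: "reps rep B" using assms(1) by auto
  have "s \<in># A + B" if "s \<in># M" for s
    using assms(5)[OF that] that by (metis count_greater_zero_iff le_zero_eq not_gr_zero)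
  then have rM: "reps rep M" using assms(1) by (auto simp: reps_def)
  note hol = theta_mult_holomorphic[OF rB assms(3)]
  have theta_hol: "theta_div q rep B holomorphic_on ball 0 R - {0}"
    by (rule holomorphic_on_subset[OF theta_div_holomorphic[OF rB]]) auto
  show ?thesis
    unfolding gevrey_over_iff[OF hol assms(2) rM]
  proof (intro ballI allI impI)
    fix s j assume s: "s \<in># M" and "count {#} s \<le> j \<and> j < count M s"
    then have j: "j < count A s + count B s" using assms(5)[OF s] by simp
    define l where "l = rep s"
    have l: "l \<noteq> 0" "s = spiral q l" using rM s by (auto simp: reps_def l_def)
    obtain N where N: "\<forall>n\<ge>N. (\<lambda>w. F (l / q ^ n * (1 + w))) analytic_on {0}"
      by (rule scaled_analytic_eventually[OF assms(3,2) l(1)]) (rule that; assumption)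
    obtain M where M: "\<forall>n\<ge>M. (\<lambda>w. theta_div q rep B (l / q ^ n * (1 + w))) analytic_on {0}"
      by (rule scaled_analytic_eventually[OF theta_hol assms(2) l(1)]) (rule that; assumption)
    have "growth (real (size B)) (\<lambda>n. \<Sum>i=0..j. tcoeff (\<lambda>w. theta_div q rep B (l / q ^ n * (1 + w))) i * tcoeff (\<lambda>w. F (l / q ^ n * (1 + w))) (j - i))"
    proof (intro growth_sum)
      fix i assume i: "i \<in> {0..j}"
      show "growth (real (size B)) (\<lambda>n. tcoeff (\<lambda>w. theta_div q rep B (l / q ^ n * (1 + w))) i * tcoeff (\<lambda>w. F (l / q ^ n * (1 + w))) (j - i))"
      proof (cases "i < count B s")
        case True
        then show ?thesis
          using theta_div_tcoeff_zero[OF rB l l_def True] by (simp add: growth_zero)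
      next
        case False
        then have "j - i < count A s" using j i by auto
        moreover from this have "s \<in># A" by (metis count_greater_zero_iff gr_zeroI not_less_zero)
        ultimately have "growth 0 (\<lambda>n. tcoeff (\<lambda>w. F (l / q ^ n * (1 + w))) (j - i))"
          using assms(4) unfolding gevrey_over_iff[OF assms(3,2) rA] l_def by simp
        then show ?thesis
          using growth_mult[OF theta_div_tcoeff_growth[OF rB l(1)]] by fastforce
      qed
    qed simp
    then have "growth (real (size B)) (\<lambda>n. tcoeff (\<lambda>w. theta_div q rep B (l / q ^ n * (1 + w)) * F (l / q ^ n * (1 + w))) j)"
      by (rule growth_cong[where N = "max N M"]) (use N M in \<open>simp add: tcoeff_mult\<close>)
    then show "growth (real k) (\<lambda>n. tcoeff (\<lambda>w. theta_div q rep B (rep s / q ^ n * (1 + w)) * F (rep s / q ^ n * (1 + w))) j)"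
      unfolding l_def[symmetric] using assms(6) by (rule growth_mono[OF _ of_nat_mono])
  qed
qed

lemma eq_on_punctured_disc:
  assumes "reps rep \<Lambda>" "F holomorphic_on ball 0 R - {0}" "G holomorphic_on ball 0 R - {0}"
    "\<forall>z\<in>sector \<Lambda> 0 R. F z = G z" "0 < norm z" "norm z < R"
  shows "F z = G z"
proof (rule isCont_eqI[where f = F and g = G])
  show "isCont F z" "isCont G z"
    using assms(2,3,5,6) by (auto intro!: holomorphic_isCont[of _ "ball 0 R - {0}"] open_Diff)
  have "\<forall>\<^sub>F w in at z. w \<in> sector \<Lambda> 0 R"
    using assms(5,6) by (intro sector_eventually[OF assms(1)]) auto
  then show "\<forall>\<^sub>F w in at z. F w = G w"
    by eventually_elim (use assms(4) in blast)
qed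

text \<open>Downward induction from \<open>i = m\<close>, where the subtracted divisor is empty.
  Derivatives of order below the multiplicity in the later divisor are covered by the next
  condition, whose order is no larger.\<close>

lemma E_part_cumulative:
  assumes "F holomorphic_on ball 0 R - {0}" "0 < R" "reps rep (div_ge m L 1)"
    and "\<forall>i\<in>{1..m}. gevrey_over q rep (size (div_ge m L (i + 1))) (div_ge m L i) (div_ge m L (i + 1)) F"
    and "i \<le> m" "1 \<le> i"
  shows "gevrey_over q rep (size (div_ge m L (i + 1))) (div_ge m L i) {#} F"
  using assms(5,6)
proof (induction i rule: inc_induct)
  case base
  then have "gevrey_over q rep (size (div_ge m L (m + 1))) (div_ge m L m) (div_ge m L (m + 1)) F"
    by (intro assms(4)[rule_format]) simp
  then show ?case by simp
next
  case (step i)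
  have r: "reps rep (div_ge m L i)" "reps rep (div_ge m L (i + 1))"
    using step by (auto intro!: reps_mono[OF assms(3) div_ge_mono])
  show ?case
    unfolding gevrey_over_iff[OF assms(1,2) r(1)]
  proof (intro ballI allI impI)
    fix s j assume s: "s \<in># div_ge m L i" and "count {#} s \<le> j \<and> j < count (div_ge m L i) s"
    then have j: "j < count (div_ge m L i) s" by simp
    show "growth (real (size (div_ge m L (i + 1)))) (\<lambda>n. tcoeff (\<lambda>w. F (rep s / q ^ n * (1 + w))) j)"
    proof (cases "count (div_ge m L (i + 1)) s \<le> j")
      case True
      have "gevrey_over q rep (size (div_ge m L (i + 1))) (div_ge m L i) (div_ge m L (i + 1)) F"
        using step by (intro assms(4)[rule_format]) simp
      then show ?thesis
        using s j True unfolding gevrey_over_iff[OF assms(1,2) r(1)] by blast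
    next
      case False
      then have j': "j < count (div_ge m L (i + 1)) s" by simp
      then have "s \<in># div_ge m L (i + 1)" by (metis count_greater_zero_iff gr_zeroI not_less_zero)
      moreover have "gevrey_over q rep (size (div_ge m L (i + 1 + 1))) (div_ge m L (i + 1)) {#} F"
        using step.IH by simp
      ultimately have "growth (real (size (div_ge m L (i + 1 + 1)))) (\<lambda>n. tcoeff (\<lambda>w. F (rep s / q ^ n * (1 + w))) j)"
        using j' unfolding gevrey_over_iff[OF assms(1,2) r(2)] by simp
      moreover have "size (div_ge m L (i + 1 + 1)) \<le> size (div_ge m L (i + 1))"
        by (intro size_mset_mono div_ge_mono) simp
      ultimately show ?thesis by (rule growth_mono[OF _ of_nat_mono])
    qed
  qed
qed

text \<open>\<open>F\<close> and \<open>R\<close> are generalised because the induction hypothesis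
  is applied to the quotient \<open>H0\<close>. Here the theta factor of summand \<open>i\<close>
  includes \<open>L i\<close> itself, since \<open>G i\<close> is an asymptotic function and not yet
  its product with the theta factor of \<open>L i\<close>.\<close>

lemma decomposition:
  assumes "reps rep (div_ge m L 1)" "\<forall>i\<in>{1..m}. 1 \<le> size (L i)" "0 < R" "F holomorphic_on ball 0 R - {0}"
    and "\<forall>i\<in>{1..m}. gevrey_over q rep (size (div_ge m L (i + 1))) (div_ge m L i) {#} F"
  shows "\<exists>G H R'. (\<forall>i\<in>{1..m}. G i \<in> A_space q (L i)) \<and> 0 < R' \<and> R' \<le> R \<and> H holomorphic_on ball 0 R' - {0} \<and>
     (\<forall>z\<in>sector (div_ge m L 1) 0 R'. F z = (\<Sum>i=1..m. theta_div q rep (div_ge m L i) z * G i z) + theta_div q rep (div_ge m L 1) z * H z)"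
  using assms
proof (induction m arbitrary: F R)
  case 0
  then show ?case by (intro exI[of _ undefined] exI[of _ F] exI[of _ R]) auto
next
  case (Suc m)
  define \<Lambda>' where "\<Lambda>' = L (Suc m)"
  have ge: "div_ge (Suc m) L i = div_ge m L i + \<Lambda>'" if "i \<le> Suc m" for i
    unfolding \<Lambda>'_def using that by (rule div_ge_Suc)
  have r: "reps rep (div_ge m L i + \<Lambda>')" if "1 \<le> i" "i \<le> Suc m" for i
    using reps_mono[OF Suc.prems(1) div_ge_mono[OF that(1)]] ge[OF that(2)] by simp
  have r': "reps rep \<Lambda>'" "reps rep (div_ge m L 1)" using r[of 1] by auto
  have size': "1 \<le> size \<Lambda>'" using Suc.prems(2) by (simp add: \<Lambda>'_def)
  have "gevrey_over q rep (size (div_ge (Suc m) L (Suc m + 1))) (div_ge (Suc m) L (Suc m)) {#} F"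
    by (intro Suc.prems(5)[rule_format]) simp
  then have F0: "gevrey_over q rep 0 \<Lambda>' {#} F"
    using ge[of "Suc m"] by simp
  obtain G0 H0 R1 where G0: "G0 \<in> A_space q \<Lambda>'" "0 < R1" "R1 \<le> R" "H0 holomorphic_on ball 0 R1 - {0}"
    "\<forall>z\<in>sector \<Lambda>' 0 R1. F z = theta_div q rep \<Lambda>' z * (G0 z + H0 z)"
    by (rule decomposition_one[OF r'(1) Suc.prems(3,4) F0]) (rule that; assumption)
  \<comment> \<open>The product of the theta factor with \<open>G0\<close>, continued across the
    spirals. Its order at 0 ensures that \<open>F - E\<close> still satisfies every condition of
    order at least \<open>size \<Lambda>'\<close>.\<close>
  obtain E R2 where E: "E \<in> E0 q rep \<Lambda>'" "0 < R2" "E holomorphic_on ball 0 R2 - {0}"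
    "\<forall>z\<in>sector \<Lambda>' 0 R2. E z = theta_div q rep \<Lambda>' z * G0 z"
    by (rule A_space_imp_E0[OF r'(1) size' G0(1)]) (rule that; assumption)
  define R3 where "R3 = min R1 R2"
  have R3: "0 < R3" "R3 \<le> R1" "R3 \<le> R2" "R3 \<le> R" using G0 E by (auto simp: R3_def)
  have hol: "F holomorphic_on ball 0 R3 - {0}" "E holomorphic_on ball 0 R3 - {0}" "H0 holomorphic_on ball 0 R3 - {0}"
    using R3 by (auto intro: holomorphic_on_subset[OF Suc.prems(4)] holomorphic_on_subset[OF E(3)] holomorphic_on_subset[OF G0(4)])
  have hol_mE: "(\<lambda>z. - E z) holomorphic_on ball 0 R3 - {0}" by (intro holomorphic_intros hol)
  have hol_d: "(\<lambda>z. F z + - E z) holomorphic_on ball 0 R3 - {0}" by (intro holomorphic_intros hol)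
  have "\<forall>z\<in>sector \<Lambda>' 0 R3. F z + - E z = theta_div q rep \<Lambda>' z * H0 z"
  proof
    fix z assume z: "z \<in> sector \<Lambda>' 0 R3"
    then have "z \<in> sector \<Lambda>' 0 R1" "z \<in> sector \<Lambda>' 0 R2" using R3 by (auto simp: sector_iff)
    then show "F z + - E z = theta_div q rep \<Lambda>' z * H0 z" using G0(5) E(4) by (simp add: distrib_left)
  qed
  \<comment> \<open>The decomposition is known only off the spirals; since both sides are
    holomorphic it extends to the punctured disc, as the Taylor coefficients at spiral points
    require.\<close>
  then have quot: "F z + - E z = theta_div q rep \<Lambda>' z * H0 z" if "0 < norm z" "norm z < R3" for z
    by (rule eq_on_punctured_disc[OF r'(1) hol_d theta_mult_holomorphic[OF r'(1) hol(3)] _ that])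
  have H0_cond: "\<forall>i\<in>{1..m}. gevrey_over q rep (size (div_ge m L (i + 1))) (div_ge m L i) {#} H0"
  proof
    fix i assume i: "i \<in> {1..m}"
    have ri: "reps rep (div_ge m L i + \<Lambda>')" using i by (intro r) auto
    have "gevrey_over q rep (size (div_ge m L (i + 1)) + size \<Lambda>') (div_ge m L i + \<Lambda>') {#} F"
      using Suc.prems(5)[rule_format, of i] i ge[of i] ge[of "i + 1"] by simp
    moreover have "gevrey_at_0 q (size \<Lambda>') E" using E(1) by (simp add: E0_def)
    then have "gevrey_over q rep (size (div_ge m L (i + 1)) + size \<Lambda>') (div_ge m L i + \<Lambda>') {#} E"
      by (intro gevrey_over_of_at_0[OF hol(2) R3(1) ri size']) simp
    then have "gevrey_over q rep (size (div_ge m L (i + 1)) + size \<Lambda>') (div_ge m L i + \<Lambda>') {#} (\<lambda>z. - E z)"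
      by (rule gevrey_over_uminus[OF hol(2) R3(1) ri])
    ultimately have FE: "gevrey_over q rep (size (div_ge m L (i + 1)) + size \<Lambda>') (div_ge m L i + \<Lambda>') {#} (\<lambda>z. F z + - E z)"
      by (rule gevrey_over_add[OF hol(1) hol_mE R3(1) ri])
    show "gevrey_over q rep (size (div_ge m L (i + 1))) (div_ge m L i) {#} H0"
      by (rule quotient_gevrey_over[OF ri R3(1) hol_d hol(3) _ FE]) (rule quot)
  qed
  have sizes: "\<forall>i\<in>{1..m}. 1 \<le> size (L i)" using Suc.prems(2) by simp
  from Suc.IH[OF r'(2) sizes R3(1) hol(3) H0_cond]
  obtain G H R' where G: "\<forall>i\<in>{1..m}. G i \<in> A_space q (L i)" "0 < R'" "R' \<le> R3" "H holomorphic_on ball 0 R' - {0}"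
     "\<forall>z\<in>sector (div_ge m L 1) 0 R'. H0 z = (\<Sum>i=1..m. theta_div q rep (div_ge m L i) z * G i z) + theta_div q rep (div_ge m L 1) z * H z"
    by (elim exE conjE) (rule that; assumption)
  define G' where "G' = G(Suc m := G0)"
  show ?case
  proof (rule exI[of _ G'], rule exI[of _ H], rule exI[of _ R'], intro conjI ballI)
    show "G' i \<in> A_space q (L i)" if "i \<in> {1..Suc m}" for i
      using that G(1) G0(1) by (auto simp: G'_def \<Lambda>'_def)
    fix z assume z: "z \<in> sector (div_ge (Suc m) L 1) 0 R'"
    have s1: "sector (div_ge (Suc m) L 1) 0 R' \<subseteq> sector (div_ge m L 1) 0 R'"
      by (rule sector_mono[OF Suc.prems(1)]) (simp_all add: ge)
    have s2: "sector (div_ge (Suc m) L 1) 0 R' \<subseteq> sector \<Lambda>' 0 R1"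
      by (rule sector_mono[OF Suc.prems(1)]) (use G R3 in \<open>simp_all add: ge\<close>)
    have "F z = theta_div q rep \<Lambda>' z * (G0 z + H0 z)" using G0(5) s2 z by blast
    also have "H0 z = (\<Sum>i=1..m. theta_div q rep (div_ge m L i) z * G i z) + theta_div q rep (div_ge m L 1) z * H z"
      using G(5) s1 z by blast
    also have "theta_div q rep \<Lambda>' z * (G0 z + \<dots>) = (\<Sum>i=1..m. (theta_div q rep (div_ge m L i) z * theta_div q rep \<Lambda>' z) * G i z)
        + theta_div q rep \<Lambda>' z * G0 z + (theta_div q rep (div_ge m L 1) z * theta_div q rep \<Lambda>' z) * H z"
      by (simp add: distrib_left sum_distrib_left mult_ac)
    also have "(\<Sum>i=1..m. (theta_div q rep (div_ge m L i) z * theta_div q rep \<Lambda>' z) * G i z) = (\<Sum>i=1..m. theta_div q rep (div_ge (Suc m) L i) z * G' i z)"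
      by (intro sum.cong) (auto simp: ge theta_div_add G'_def)
    also have "theta_div q rep \<Lambda>' z * G0 z = theta_div q rep (div_ge (Suc m) L (Suc m)) z * G' (Suc m) z"
      by (simp add: ge G'_def)
    also have "theta_div q rep (div_ge m L 1) z * theta_div q rep \<Lambda>' z = theta_div q rep (div_ge (Suc m) L 1) z"
      by (simp add: ge theta_div_add)
    finally show "F z = (\<Sum>i=1..Suc m. theta_div q rep (div_ge (Suc m) L i) z * G' i z) + theta_div q rep (div_ge (Suc m) L 1) z * H z"
      by simp
  qed (use G R3 in auto)
qed

end

lemma common_sector:
  assumes "finite I" "\<And>i. i \<in> I \<Longrightarrow> \<exists>R>0. \<forall>z\<in>sector (\<Lambda> i) 0 R. Q i z"
  obtains R where "0 < R" "\<forall>i\<in>I. \<forall>z\<in>sector (\<Lambda> i) 0 R. Q i z"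
proof -
  have "\<exists>R>0. \<forall>i\<in>I. \<forall>z\<in>sector (\<Lambda> i) 0 R. Q i z"
    using assms
  proof (induction I rule: finite_induct)
    case empty
    show ?case by (intro exI[of _ 1]) auto
  next
    case (insert i I)
    obtain R1 where R1: "R1 > 0" "\<forall>i\<in>I. \<forall>z\<in>sector (\<Lambda> i) 0 R1. Q i z"
      using insert by auto
    obtain R2 where R2: "R2 > 0" "\<forall>z\<in>sector (\<Lambda> i) 0 R2. Q i z"
      using insert.prems[of i] by auto
    have sub: "sector M 0 (min R1 R2) \<subseteq> sector M 0 R1" "sector M 0 (min R1 R2) \<subseteq> sector M 0 R2" for M
      by (auto simp: sector_iff)
    show ?case
    proof (intro exI[of _ "min R1 R2"] conjI ballI)
      fix j z assume "j \<in> insert i I" "z \<in> sector (\<Lambda> j) 0 (min R1 R2)"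
      then show "Q j z" using R1(2) R2(2) sub[of "\<Lambda> j"] by blast
    qed (use R1 R2 in simp)
  qed
  then show ?thesis using that by blast
qed

lemma gevrey_over_weaken: "gevrey_over q rep k \<Lambda> {#} F \<Longrightarrow> gevrey_over q rep k \<Lambda> \<Lambda>' F"
  by (simp add: gevrey_over_def)

context q_theta
begin

text \<open>All relevant coefficients vanish together with those of the theta factor. This serves
  the summands whose theta factor already contains the divisor under consideration, and the
  remainder term.\<close>

lemma theta_mult_gevrey_over_zero:
  assumes "reps rep B" "0 < R" "F holomorphic_on ball 0 R - {0}" "\<And>s. s \<in># M \<Longrightarrow> count M s \<le> count B s"
  shows "gevrey_over q rep k M {#} (\<lambda>z. theta_div q rep B z * F z)"
proof -
  have "s \<in># B" if "s \<in># M" for s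
    using assms(4)[OF that] that by (metis count_greater_zero_iff le_zero_eq not_gr_zero)
  then have rM: "reps rep M" using assms(1) by (auto simp: reps_def)
  have theta_hol: "theta_div q rep B holomorphic_on ball 0 R - {0}"
    by (rule holomorphic_on_subset[OF theta_div_holomorphic[OF assms(1)]]) auto
  show ?thesis
    unfolding gevrey_over_iff[OF theta_mult_holomorphic[OF assms(1,3)] assms(2) rM]
  proof (intro ballI allI impI)
    fix s j assume s: "s \<in># M" and "count {#} s \<le> j \<and> j < count M s"
    then have j: "j < count B s" using assms(4)[OF s] by simp
    define l where "l = rep s"
    have l: "l \<noteq> 0" "s = spiral q l" using rM s by (auto simp: reps_def l_def)
    obtain N where N: "\<forall>n\<ge>N. (\<lambda>w. F (l / q ^ n * (1 + w))) analytic_on {0}"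
      by (rule scaled_analytic_eventually[OF assms(3,2) l(1)]) (rule that; assumption)
    obtain N' where N': "\<forall>n\<ge>N'. (\<lambda>w. theta_div q rep B (l / q ^ n * (1 + w))) analytic_on {0}"
      by (rule scaled_analytic_eventually[OF theta_hol assms(2) l(1)]) (rule that; assumption)
    have "growth (real k) (\<lambda>n. tcoeff (\<lambda>w. theta_div q rep B (l / q ^ n * (1 + w)) * F (l / q ^ n * (1 + w))) j)"
    proof (rule growth_cong[OF growth_zero, where N = "max N N'"])
      fix n assume n: "n \<ge> max N N'"
      have "tcoeff (\<lambda>w. theta_div q rep B (l / q ^ n * (1 + w))) i = 0" if "i \<le> j" for i
        using that j by (intro theta_div_tcoeff_zero[OF assms(1) l l_def]) simp
      then show "tcoeff (\<lambda>w. theta_div q rep B (l / q ^ n * (1 + w)) * F (l / q ^ n * (1 + w))) j = 0"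
        using N N' n by (simp add: tcoeff_mult)
    qed
    then show "growth (real k) (\<lambda>n. tcoeff (\<lambda>w. theta_div q rep B (rep s / q ^ n * (1 + w)) * F (rep s / q ^ n * (1 + w))) j)"
      unfolding l_def .
  qed
qed

lemma E0_add:
  assumes "reps rep \<Lambda>" "1 \<le> size \<Lambda>" "F \<in> E0 q rep \<Lambda>" "G \<in> E0 q rep \<Lambda>"
  shows "(\<lambda>z. F z + G z) \<in> E0 q rep \<Lambda>"
proof -
  define FG where "FG i = (if i then F else G)" for i
  have an: "analytic_punctured (FG i)" for i
    using assms(3,4) by (auto simp: E0_def FG_def)
  obtain R where R: "0 < R" "\<forall>i\<in>UNIV. FG i holomorphic_on ball 0 R - {0}"
    by (rule common_punctured_disc[of UNIV FG, OF finite an]) (rule that; assumption)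
  have h: "F holomorphic_on ball 0 R - {0}" "G holomorphic_on ball 0 R - {0}"
    using R(2)[rule_format, of True] R(2)[rule_format, of False] by (simp_all add: FG_def)
  have "(\<lambda>z. F z + G z) holomorphic_on ball 0 R - {0}"
    by (intro holomorphic_intros h)
  then have "analytic_punctured (\<lambda>z. F z + G z)"
    using R(1) by (auto simp: analytic_punctured_iff)
  moreover have "gevrey_over q rep 0 \<Lambda> {#} (\<lambda>z. F z + G z)"
    using assms by (intro gevrey_over_add[OF h R(1)]) (auto simp: E0_def)
  moreover have "gevrey_at_0 q (size \<Lambda>) (\<lambda>z. F z + G z)"
    using assms by (intro gevrey_at_0_add) (auto simp: E0_def)
  ultimately show ?thesis by (simp add: E0_def)
qed

text \<open>A pole of \<open>H\<close> at 0 only changes the power of |z| in the bound, which the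
  order at 0 does not see; so the remainder term can be absorbed.\<close>

lemma theta_mult_pole_E0:
  assumes "reps rep \<Lambda>" "1 \<le> size \<Lambda>" "0 < R" "H holomorphic_on ball 0 R - {0}"
    "\<forall>z. 0 < norm z \<and> norm z < R \<longrightarrow> norm (z ^ n * H z) \<le> B"
  shows "(\<lambda>z. theta_div q rep \<Lambda> z * H z) \<in> E0 q rep \<Lambda>"
proof -
  obtain C b where T: "0 < C" "\<forall>z. z \<noteq> 0 \<longrightarrow> norm (theta_div q rep \<Lambda> z) \<le> C * norm z powr b * gauss z ^ size \<Lambda>"
    by (rule theta_div_upper[OF assms(1)]) (rule that; assumption)
  have "gevrey_at_0 q (size \<Lambda>) (\<lambda>z. theta_div q rep \<Lambda> z * H z)"
  proof (rule gevrey_at_0I[OF assms(2), of "C * (\<bar>B\<bar> + 1)" R _ "b - real n"])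
    fix z :: complex assume z: "0 < norm z" "norm z < R"
    have g: "0 < gauss z" using z by (intro gauss_pos) auto
    have "norm z ^ n * norm (H z) \<le> B" using assms(5) z by (simp add: norm_mult norm_power)
    then have "norm z ^ n * norm (H z) \<le> \<bar>B\<bar> + 1" by linarith
    moreover have "norm z ^ n = norm z powr (real n)" using z by (simp add: powr_realpow)
    ultimately have "norm (H z) \<le> (\<bar>B\<bar> + 1) * norm z powr (- real n)"
      using z by (simp add: powr_minus field_simps)
    then have "norm (theta_div q rep \<Lambda> z * H z) \<le> (C * norm z powr b * gauss z ^ size \<Lambda>) * ((\<bar>B\<bar> + 1) * norm z powr (- real n))"
      unfolding norm_mult using T z g by (intro mult_mono) auto
    also have "\<dots> = C * (\<bar>B\<bar> + 1) * (norm z powr b * norm z powr (- real n)) * gauss z ^ size \<Lambda>"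
      by (simp only: mult_ac)
    also have "norm z powr b * norm z powr (- real n) = norm z powr (b - real n)"
      by (simp add: powr_add[symmetric])
    finally show "norm (theta_div q rep \<Lambda> z * H z) \<le> C * (\<bar>B\<bar> + 1) * norm z powr (b - real n) * gauss z ^ size \<Lambda>" .
  qed (use assms T in auto)
  moreover have "gevrey_over q rep 0 \<Lambda> {#} (\<lambda>z. theta_div q rep \<Lambda> z * H z)"
    by (rule theta_mult_gevrey_over_zero[OF assms(1,3,4)]) simp
  moreover have "analytic_punctured (\<lambda>z. theta_div q rep \<Lambda> z * H z)"
    using theta_mult_holomorphic[OF assms(1,4)] assms(3) by (auto simp: analytic_punctured_iff)
  ultimately show ?thesis by (simp add: E0_def)
qed

end

section \<open>Both equalities for a fixed ordered partition\<close>

locale q_partition = q_theta +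
  fixes rep :: "complex set \<Rightarrow> complex" and m :: nat and L :: "nat \<Rightarrow> complex set multiset"
    and \<Lambda> :: "complex set multiset"
  assumes m: "1 \<le> m" and size_L: "\<And>i. i \<in> {1..m} \<Longrightarrow> 1 \<le> size (L i)"
    and \<Lambda>_eq: "\<Lambda> = div_ge m L 1" and reps_\<Lambda>: "reps rep \<Lambda>"
begin

abbreviation "\<theta> \<equiv> theta_div q rep"

lemma reps_ge: "1 \<le> i \<Longrightarrow> reps rep (div_ge m L i)"
  using reps_\<Lambda> unfolding \<Lambda>_eq by (rule reps_mono) (rule div_ge_mono)

lemma reps_L: "i \<in> {1..m} \<Longrightarrow> reps rep (L i)"
  using reps_\<Lambda> unfolding \<Lambda>_eq by (rule reps_mono) (rule L_subset_div_ge)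

lemma L_subset: "i \<in> {1..m} \<Longrightarrow> L i \<subseteq># \<Lambda>"
  unfolding \<Lambda>_eq by (rule L_subset_div_ge)

lemma sector_L: "i \<in> {1..m} \<Longrightarrow> sector \<Lambda> \<epsilon> R \<subseteq> sector (L i) \<epsilon> R"
  by (rule sector_mono[OF reps_\<Lambda> L_subset order_refl order_refl])

lemma le_ge:
  assumes "i \<in> {1..m}"
  shows "div_le L (i - 1) + div_ge m L i = \<Lambda>"
proof -
  have "i - 1 \<le> m" "i - 1 + 1 = i" using assms by auto
  then show ?thesis using div_le_add_div_ge[of "i - 1" m L] unfolding \<Lambda>_eq by metis
qed

lemma reps_le: "i \<in> {1..m} \<Longrightarrow> reps rep (div_le L (i - 1))"
  using reps_\<Lambda> le_ge reps_add by metis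

lemma size_ge_pos: "i \<in> {1..m} \<Longrightarrow> 1 \<le> size (div_ge m L i)"
  using size_L[of i] by (simp add: div_ge_rec)

lemma size_\<Lambda>_pos: "1 \<le> size \<Lambda>"
  using size_ge_pos[of 1] m by (simp add: \<Lambda>_eq)

lemma theta_ge: "i \<in> {1..m} \<Longrightarrow> \<theta> (div_ge m L i) z = \<theta> (L i) z * \<theta> (div_ge m L (i + 1)) z"
  by (simp add: div_ge_rec theta_div_add)

lemma term_gevrey_at_0:
  assumes "i \<in> {1..m}" "F \<in> E0 q rep (L i)"
  shows "gevrey_at_0 q (size (div_ge m L i)) (\<lambda>z. \<theta> (div_ge m L (i + 1)) z * F z)"
proof -
  have "gevrey_at_0 q (size (L i)) F" using assms(2) by (simp add: E0_def)
  then have "gevrey_at_0 q (size (L i) + size (div_ge m L (i + 1))) (\<lambda>z. \<theta> (div_ge m L (i + 1)) z * F z)"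
    using assms(1) by (intro gevrey_at_0_theta_mult reps_ge size_L) auto
  then show ?thesis using assms(1) by (simp add: div_ge_rec)
qed

lemma sum_gevrey_at_0:
  assumes "\<forall>i\<in>{1..m}. F i \<in> E0 q rep (L i)"
  shows "gevrey_at_0 q (size \<Lambda>) (\<lambda>z. \<Sum>i=1..m. \<theta> (div_ge m L (i + 1)) z * F i z)"
proof (rule gevrey_at_0_sum[OF size_\<Lambda>_pos])
  fix i assume i: "i \<in> {1..m}"
  then have "size (div_ge m L i) \<le> size \<Lambda>"
    unfolding \<Lambda>_eq by (intro size_mset_mono div_ge_mono) simp
  then show "gevrey_at_0 q (size \<Lambda>) (\<lambda>z. \<theta> (div_ge m L (i + 1)) z * F i z)"
    using i assms by (intro gevrey_at_0_mono[OF size_ge_pos _ term_gevrey_at_0]) auto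
qed simp

lemma sum_in_E_part:
  assumes "\<forall>i\<in>{1..m}. F i \<in> E0 q rep (L i)"
  shows "(\<lambda>z. \<Sum>i=1..m. \<theta> (div_ge m L (i + 1)) z * F i z) \<in> E_part q rep m L \<Lambda>"
proof -
  obtain R where R: "0 < R" "\<forall>i\<in>{1..m}. F i holomorphic_on ball 0 R - {0}"
    by (rule common_punctured_disc[of "{1..m}" F]) (use assms in \<open>auto simp: E0_def\<close>)
  have hol: "(\<lambda>z. \<theta> (div_ge m L (i + 1)) z * F i z) holomorphic_on ball 0 R - {0}" if "i \<in> {1..m}" for i
    using that R(2) by (intro theta_mult_holomorphic reps_ge) auto
  have "analytic_punctured (\<lambda>z. \<Sum>i=1..m. \<theta> (div_ge m L (i + 1)) z * F i z)"
    unfolding analytic_punctured_iff using R(1) by (intro exI[of _ R] conjI holomorphic_on_sum hol)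
  moreover have "gevrey_over q rep (size (div_ge m L (l + 1))) (div_ge m L l) (div_ge m L (l + 1))
       (\<lambda>z. \<Sum>i=1..m. \<theta> (div_ge m L (i + 1)) z * F i z)" if l: "l \<in> {1..m}" for l
  proof (rule gevrey_over_sum[OF _ hol R(1)])
    show "reps rep (div_ge m L l)" using l by (intro reps_ge) simp
    fix i assume i: "i \<in> {1..m}"
    have Fi: "F i \<in> E0 q rep (L i)" "F i holomorphic_on ball 0 R - {0}" using assms R(2) i by auto
    \<comment> \<open>For \<open>i < l\<close> the theta factor contains
      \<open>div_ge m L l\<close>, so the coefficients vanish. For \<open>i = l\<close> those of
      \<open>F i\<close> have order 0 and the theta factor supplies exactly the permitted order. For
      \<open>l < i\<close> the summand has order \<open>size (div_ge m L i)\<close> at 0, which does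
      not exceed it.\<close>
    consider "i < l" | "i = l" | "l < i" by linarith
    then show "gevrey_over q rep (size (div_ge m L (l + 1))) (div_ge m L l) (div_ge m L (l + 1))
        (\<lambda>z. \<theta> (div_ge m L (i + 1)) z * F i z)"
    proof cases
      case 1
      then have "div_ge m L l \<subseteq># div_ge m L (i + 1)" by (intro div_ge_mono) simp
      then show ?thesis
        by (intro gevrey_over_weaken[OF theta_mult_gevrey_over_zero[OF reps_ge R(1) Fi(2)]] mset_subset_eq_count) simp
    next
      case 2
      have "reps rep (L i + div_ge m L (i + 1))" using i reps_ge[of i] by (simp add: div_ge_rec)
      moreover have "gevrey_over q rep 0 (L i) {#} (F i)" using Fi(1) by (simp add: E0_def)
      ultimately show ?thesis
        using 2 i by (intro gevrey_over_weaken[OF theta_mult_gevrey_over[where A = "L i", OF _ R(1) Fi(2)]]) (simp_all add: div_ge_rec)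
    next
      case 3
      then have "size (div_ge m L i) \<le> size (div_ge m L (l + 1))"
        by (intro size_mset_mono div_ge_mono) simp
      then show ?thesis
        using l i by (intro gevrey_over_of_at_0[OF hol[OF i] R(1) reps_ge size_ge_pos _ term_gevrey_at_0[OF i Fi(1)]]) auto
    qed
  qed simp
  ultimately show ?thesis
    using sum_gevrey_at_0[OF assms] by (simp add: E_part_def)
qed

lemma A_family_imp_E0:
  assumes "\<forall>i\<in>{1..m}. f i \<in> A_space q (L i)"
  obtains E R where "\<forall>i\<in>{1..m}. E i \<in> E0 q rep (L i)" "0 < R"
    "\<forall>i\<in>{1..m}. \<forall>z\<in>sector (L i) 0 R. E i z = \<theta> (L i) z * f i z"
proof -
  have "\<forall>i\<in>{1..m}. \<exists>E. E \<in> E0 q rep (L i) \<and> (\<exists>R>0. \<forall>z\<in>sector (L i) 0 R. E z = \<theta> (L i) z * f i z)"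
  proof
    fix i assume i: "i \<in> {1..m}"
    obtain E R where "E \<in> E0 q rep (L i)" "0 < R" "E holomorphic_on ball 0 R - {0}"
      "\<forall>z\<in>sector (L i) 0 R. E z = \<theta> (L i) z * f i z"
      by (rule A_space_imp_E0[OF reps_L[OF i] size_L[OF i] assms[rule_format, OF i]]) (rule that; assumption)
    then show "\<exists>E. E \<in> E0 q rep (L i) \<and> (\<exists>R>0. \<forall>z\<in>sector (L i) 0 R. E z = \<theta> (L i) z * f i z)"
      by blast
  qed
  then obtain E where E: "\<forall>i\<in>{1..m}. E i \<in> E0 q rep (L i) \<and> (\<exists>R>0. \<forall>z\<in>sector (L i) 0 R. E i z = \<theta> (L i) z * f i z)"
    by (rule bchoice[THEN exE]) (rule that)
  obtain R where R: "0 < R" "\<forall>i\<in>{1..m}. \<forall>z\<in>sector (L i) 0 R. E i z = \<theta> (L i) z * f i z"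
    by (rule common_sector[of "{1..m}" L "\<lambda>i z. E i z = \<theta> (L i) z * f i z"])
       (use E in \<open>auto intro: that\<close>)
  show ?thesis
    by (rule that[OF _ R]) (use E in simp)
qed

text \<open>\<open>F\<close> and the sum of the \<open>E i\<close> terms have order
  \<open>size \<Lambda>\<close> at 0, and off the spirals the theta product is bounded below by the
  same power of \<open>gauss\<close>. So the remainder is bounded there by a power of |z|, and
  \<open>bounded_from_sector\<close> applies after multiplication by \<open>z ^ n\<close>. The first
  equality is read off from \<open>E\<close>, the second from \<open>G\<close>.\<close>

lemma E_part_decomposition:
  assumes "F \<in> E_part q rep m L \<Lambda>"
  obtains G E H R n B where "\<forall>i\<in>{1..m}. G i \<in> A_space q (L i)" "\<forall>i\<in>{1..m}. E i \<in> E0 q rep (L i)" "0 < R" "R \<le> 1"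
    "\<forall>i\<in>{1..m}. \<forall>z\<in>sector (L i) 0 R. E i z = \<theta> (L i) z * G i z"
    "H holomorphic_on ball 0 R - {0}"
    "\<forall>z. 0 < norm z \<and> norm z < R \<longrightarrow>
       F z = (\<Sum>i=1..m. \<theta> (div_ge m L (i + 1)) z * E i z) + \<theta> \<Lambda> z * H z"
    "\<forall>z. 0 < norm z \<and> norm z < R \<longrightarrow> norm (z ^ n * H z) \<le> B"
proof -
  obtain R0 where R0: "0 < R0" "F holomorphic_on ball 0 R0 - {0}"
    using assms by (auto simp: E_part_def analytic_punctured_iff)
  have "\<forall>i\<in>{1..m}. gevrey_over q rep (size (div_ge m L (i + 1))) (div_ge m L i) (div_ge m L (i + 1)) F"
    using assms by (simp add: E_part_def)
  then have cum: "\<forall>i\<in>{1..m}. gevrey_over q rep (size (div_ge m L (i + 1))) (div_ge m L i) {#} F"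
    by (intro ballI E_part_cumulative[OF R0(2,1)]) (use reps_ge in auto)
  have "\<forall>i\<in>{1..m}. 1 \<le> size (L i)" using size_L by blast
  from decomposition[OF reps_ge[of 1, OF order_refl] this R0 cum]
  obtain G H R1 where G: "\<forall>i\<in>{1..m}. G i \<in> A_space q (L i)" "0 < R1" "R1 \<le> R0" "H holomorphic_on ball 0 R1 - {0}"
    and eq: "\<forall>z\<in>sector (div_ge m L 1) 0 R1. F z = (\<Sum>i=1..m. \<theta> (div_ge m L i) z * G i z) + \<theta> (div_ge m L 1) z * H z"
    by (elim exE conjE) (rule that; assumption)
  obtain E R2 where E1: "\<forall>i\<in>{1..m}. E i \<in> E0 q rep (L i)"
    and R2: "0 < R2" "\<forall>i\<in>{1..m}. \<forall>z\<in>sector (L i) 0 R2. E i z = \<theta> (L i) z * G i z"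
    by (rule A_family_imp_E0[OF G(1)]) (rule that; assumption)
  obtain R3 where R3: "0 < R3" "\<forall>i\<in>{1..m}. E i holomorphic_on ball 0 R3 - {0}"
    by (rule common_punctured_disc[of "{1..m}" E]) (use E1 in \<open>auto simp: E0_def\<close>)
  define S where "S z = (\<Sum>i=1..m. \<theta> (div_ge m L (i + 1)) z * E i z)" for z
  define R4 where "R4 = min R1 (min R2 R3)"
  have R4: "0 < R4" "R4 \<le> R0" "R4 \<le> R1" "R4 \<le> R2" "R4 \<le> R3" using G R2 R3 by (auto simp: R4_def)
  have F4: "F holomorphic_on ball 0 R4 - {0}" "H holomorphic_on ball 0 R4 - {0}"
    using R4 by (auto intro: holomorphic_on_subset[OF R0(2)] holomorphic_on_subset[OF G(4)])
  have E4: "E i holomorphic_on ball 0 R4 - {0}" if "i \<in> {1..m}" for i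
    using R4 R3(2)[rule_format, OF that] by (auto intro: holomorphic_on_subset)
  have S4: "S holomorphic_on ball 0 R4 - {0}"
    unfolding S_def by (intro holomorphic_on_sum theta_mult_holomorphic reps_ge E4) auto
  have SH4: "(\<lambda>z. S z + \<theta> \<Lambda> z * H z) holomorphic_on ball 0 R4 - {0}"
    by (intro holomorphic_on_add S4 theta_mult_holomorphic[OF reps_\<Lambda>] F4)
  have "\<forall>z\<in>sector \<Lambda> 0 R4. F z = S z + \<theta> \<Lambda> z * H z"
  proof
    fix z assume z: "z \<in> sector \<Lambda> 0 R4"
    have "\<theta> (div_ge m L i) z * G i z = \<theta> (div_ge m L (i + 1)) z * E i z" if i: "i \<in> {1..m}" for i
    proof -
      have "z \<in> sector (L i) 0 R4" using sector_L[OF i] z by blast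
      then have "z \<in> sector (L i) 0 R2" using R4 by (simp add: sector_iff)
      then show ?thesis using R2(2) i by (simp add: theta_ge)
    qed
    moreover have "z \<in> sector (div_ge m L 1) 0 R1" using z R4 by (simp add: \<Lambda>_eq sector_iff)
    ultimately show "F z = S z + \<theta> \<Lambda> z * H z"
      using eq by (simp add: S_def \<Lambda>_eq)
  qed
  then have F_eq: "F z = S z + \<theta> \<Lambda> z * H z" if "0 < norm z" "norm z < R4" for z
    by (rule eq_on_punctured_disc[OF reps_\<Lambda> F4(1) SH4 _ that])
  have "gevrey_at_0 q (size \<Lambda>) (\<lambda>z. F z + - S z)"
    using assms sum_gevrey_at_0[OF E1, folded S_def]
    by (intro gevrey_at_0_add gevrey_at_0_uminus size_\<Lambda>_pos) (simp_all add: E_part_def)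
  then obtain C a R5 where R5: "0 < C" "0 < R5" "R5 \<le> 1"
    "\<forall>z. 0 < norm z \<and> norm z < R5 \<longrightarrow> norm (F z + - S z) \<le> C * norm z powr a * gauss z ^ size \<Lambda>"
    by (rule gevrey_at_0E[OF _ size_\<Lambda>_pos]) (rule that; assumption)
  obtain c C' b where th: "0 < c" "0 < C'"
    "\<And>z. z \<noteq> 0 \<Longrightarrow> c * norm z powr b * gauss z ^ size \<Lambda> * dist_div z \<Lambda> \<le> norm (\<theta> \<Lambda> z) \<and>
        norm (\<theta> \<Lambda> z) \<le> C' * norm z powr b * gauss z ^ size \<Lambda> * dist_div z \<Lambda>"
    using theta_div_bounds[OF reps_\<Lambda>] by metis
  \<comment> \<open>After the cancellation of \<open>gauss\<close> the exponent \<open>a - b\<close>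
    is left; \<open>z ^ n\<close> makes it nonnegative, and |z| < 1 then gives boundedness.\<close>
  define n where "n = nat \<lceil>b - a\<rceil>"
  have n: "b - a \<le> real n" by (simp add: n_def) linarith
  obtain \<epsilon> where \<epsilon>: "0 < \<epsilon>"
    "\<And>H B R. H holomorphic_on ball 0 R - {0} \<Longrightarrow> 0 < R \<Longrightarrow> (\<And>z. z \<in> sector \<Lambda> \<epsilon> R \<Longrightarrow> norm (H z) \<le> B) \<Longrightarrow>
       \<exists>R'>0. \<forall>z. 0 < norm z \<and> norm z < R' \<longrightarrow> norm (H z) \<le> B"
    using bounded_from_sector[OF reps_\<Lambda>] by blast
  define R6 where "R6 = min R4 R5"
  have R6: "0 < R6" "R6 \<le> R4" "R6 \<le> R5" "R6 \<le> 1" using R4 R5 by (auto simp: R6_def)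
  define B where "B = C / (c * \<epsilon>)"
  have H6: "H holomorphic_on ball 0 R6 - {0}"
    using R6 by (auto intro: holomorphic_on_subset[OF F4(2)])
  have "\<exists>R'>0. \<forall>z. 0 < norm z \<and> norm z < R' \<longrightarrow> norm (z ^ n * H z) \<le> B"
  proof (rule \<epsilon>(2)[OF _ R6(1)])
    show "(\<lambda>z. z ^ n * H z) holomorphic_on ball 0 R6 - {0}"
      by (intro holomorphic_intros H6)
    fix z assume "z \<in> sector \<Lambda> \<epsilon> R6"
    then have z: "0 < norm z" "norm z < R6" "\<epsilon> < dist_div z \<Lambda>" "z \<noteq> 0" by (auto simp: sector_iff)
    define g where "g = gauss z ^ size \<Lambda>"
    have g: "0 < g" unfolding g_def using gauss_pos[OF z(4)] by simp
    have "\<theta> \<Lambda> z * H z = F z + - S z" using F_eq[of z] z R6 by simp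
    then have "norm (\<theta> \<Lambda> z) * norm (H z) = norm (F z + - S z)" by (metis norm_mult)
    also have "\<dots> \<le> C * norm z powr a * g"
      unfolding g_def using z R6 by (intro R5(4)[rule_format]) simp
    finally have 1: "norm (\<theta> \<Lambda> z) * norm (H z) \<le> C * norm z powr a * g" .
    have "c * norm z powr b * g * \<epsilon> \<le> c * norm z powr b * g * dist_div z \<Lambda>"
      using z g th(1) by (intro mult_left_mono) auto
    also have "\<dots> \<le> norm (\<theta> \<Lambda> z)" unfolding g_def using th(3)[OF z(4)] by blast
    finally have "c * norm z powr b * g * \<epsilon> * norm (H z) \<le> norm (\<theta> \<Lambda> z) * norm (H z)"
      by (intro mult_right_mono) auto
    with 1 have "c * norm z powr b * g * \<epsilon> * norm (H z) \<le> C * norm z powr a * g" by linarith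
    then have "g * (norm z powr b * norm (H z) * (c * \<epsilon>)) \<le> g * (C * norm z powr a)" by (simp add: mult_ac)
    then have "norm z powr b * norm (H z) * (c * \<epsilon>) \<le> C * norm z powr a"
      using g by (simp only: mult_le_cancel_left_pos)
    then have 2: "norm z powr b * norm (H z) \<le> B * norm z powr a"
      using th(1) \<epsilon>(1) by (simp add: B_def field_simps)
    have "norm z powr (- b) * (norm z powr b * norm (H z)) \<le> norm z powr (- b) * (B * norm z powr a)"
      using 2 by (intro mult_left_mono) auto
    also have "norm z powr (- b) * (norm z powr b * norm (H z)) = norm (H z)"
      using z by (simp add: powr_minus field_simps)
    finally have "norm (H z) \<le> B * norm z powr (a - b)" by (simp add: powr_diff powr_minus field_simps)
    then have "norm z ^ n * norm (H z) \<le> norm z powr real n * (B * norm z powr (a - b))"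
      using z by (simp add: powr_realpow mult_left_mono)
    also have "\<dots> = B * norm z powr (real n - (b - a))"
      by (simp add: powr_add[symmetric] algebra_simps)
    also have "\<dots> \<le> B * 1"
    proof (intro mult_left_mono)
      show "norm z powr (real n - (b - a)) \<le> 1" using z R6 n by (intro powr_le1) auto
      show "0 \<le> B" using R5 th \<epsilon> by (simp add: B_def)
    qed
    finally show "norm (z ^ n * H z) \<le> B" by (simp add: norm_mult norm_power)
  qed
  then obtain R7 where R7: "0 < R7" "\<forall>z. 0 < norm z \<and> norm z < R7 \<longrightarrow> norm (z ^ n * H z) \<le> B" by blast
  define R where "R = min R6 R7"
  have R: "0 < R" "R \<le> R6" "R \<le> R7" "R \<le> 1" "R \<le> R4" "R \<le> R2" using R6 R7 R4 by (auto simp: R_def)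
  show ?thesis
  proof (rule that[OF G(1) E1 R(1,4), of H n B])
    show "\<forall>i\<in>{1..m}. \<forall>z\<in>sector (L i) 0 R. E i z = \<theta> (L i) z * G i z"
      using R2(2) R by (auto simp: sector_iff)
    show "H holomorphic_on ball 0 R - {0}"
      using R by (auto intro: holomorphic_on_subset[OF H6])
    show "\<forall>z. 0 < norm z \<and> norm z < R \<longrightarrow>
       F z = (\<Sum>i=1..m. \<theta> (div_ge m L (i + 1)) z * E i z) + \<theta> \<Lambda> z * H z"
      using F_eq R unfolding S_def by simp
    show "\<forall>z. 0 < norm z \<and> norm z < R \<longrightarrow> norm (z ^ n * H z) \<le> B"
      using R7 R by simp
  qed
qed

lemma E_part_eq:
  "germ {#} ` E_part q rep m L \<Lambda> =
     germ {#} ` {\<lambda>z. \<Sum>i=1..m. \<theta> (div_ge m L (i + 1)) z * F i z | F.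
                         \<forall>i\<in>{1..m}. F i \<in> E0 q rep (L i)}"
proof (intro equalityI subsetI)
  fix X assume "X \<in> germ {#} ` E_part q rep m L \<Lambda>"
  then obtain F where F: "X = germ {#} F" "F \<in> E_part q rep m L \<Lambda>" by blast
  obtain G E H R n B where D: "\<forall>i\<in>{1..m}. G i \<in> A_space q (L i)" "\<forall>i\<in>{1..m}. E i \<in> E0 q rep (L i)" "0 < R" "R \<le> 1"
    "\<forall>i\<in>{1..m}. \<forall>z\<in>sector (L i) 0 R. E i z = \<theta> (L i) z * G i z"
    "H holomorphic_on ball 0 R - {0}"
    "\<forall>z. 0 < norm z \<and> norm z < R \<longrightarrow>
       F z = (\<Sum>i=1..m. \<theta> (div_ge m L (i + 1)) z * E i z) + \<theta> \<Lambda> z * H z"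
    "\<forall>z. 0 < norm z \<and> norm z < R \<longrightarrow> norm (z ^ n * H z) \<le> B"
    by (rule E_part_decomposition[OF F(2)]) (rule that; assumption)
  have m1: "1 \<in> {1..m}" using m by simp
  \<comment> \<open>The theta factors of \<open>L 1\<close> and of \<open>div_ge m L 2\<close>
    multiply to that of \<Lambda>, so the remainder term is of the form of the first
    summand.\<close>
  define E' where "E' i = (if i = 1 then (\<lambda>z. E 1 z + \<theta> (L 1) z * H z) else E i)" for i
  have "E' i \<in> E0 q rep (L i)" if "i \<in> {1..m}" for i
    using E0_add[OF reps_L[OF m1] size_L[OF m1] D(2)[rule_format, OF m1] theta_mult_pole_E0[OF reps_L[OF m1] size_L[OF m1] D(3,6,8)]]
      D(2) that by (simp add: E'_def)
  moreover have "germ {#} F = germ {#} (\<lambda>z. \<Sum>i=1..m. \<theta> (div_ge m L (i + 1)) z * E' i z)"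
  proof (rule germ_eqI[OF D(3)])
    fix z assume z: "z \<in> sector {#} 0 R"
    have "(\<Sum>i=1..m. \<theta> (div_ge m L (i + 1)) z * E' i z)
        = (\<Sum>i=1..m. \<theta> (div_ge m L (i + 1)) z * E i z + (if i = 1 then \<theta> \<Lambda> z * H z else 0))"
      using theta_ge[OF m1, of z] by (intro sum.cong) (auto simp: E'_def distrib_left \<Lambda>_eq)
    also have "\<dots> = (\<Sum>i=1..m. \<theta> (div_ge m L (i + 1)) z * E i z) + \<theta> \<Lambda> z * H z"
      using m by (simp add: sum.distrib)
    also have "\<dots> = F z" using D(7) z by (simp add: sector_iff)
    finally show "F z = (\<Sum>i=1..m. \<theta> (div_ge m L (i + 1)) z * E' i z)" by simp
  qed
  ultimately show "X \<in> germ {#} ` {\<lambda>z. \<Sum>i=1..m. \<theta> (div_ge m L (i + 1)) z * F i z | F.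
                         \<forall>i\<in>{1..m}. F i \<in> E0 q rep (L i)}"
    unfolding F(1) by blast
next
  fix X assume "X \<in> germ {#} ` {\<lambda>z. \<Sum>i=1..m. \<theta> (div_ge m L (i + 1)) z * F i z | F.
                         \<forall>i\<in>{1..m}. F i \<in> E0 q rep (L i)}"
  then obtain F where "X = germ {#} (\<lambda>z. \<Sum>i=1..m. \<theta> (div_ge m L (i + 1)) z * F i z)"
    "\<forall>i\<in>{1..m}. F i \<in> E0 q rep (L i)"
    by blast
  then show "X \<in> germ {#} ` E_part q rep m L \<Lambda>" using sum_in_E_part by blast
qed

lemma theta_quotient:
  assumes "i \<in> {1..m}" "\<theta> \<Lambda> z \<noteq> 0"
  shows "1 / \<theta> \<Lambda> z * (\<theta> (div_ge m L i) z * x) = 1 / \<theta> (div_le L (i - 1)) z * x"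
proof -
  have "\<theta> \<Lambda> z = \<theta> (div_le L (i - 1)) z * \<theta> (div_ge m L i) z"
    using le_ge[OF assms(1)] theta_div_add by metis
  then show ?thesis using assms(2) by simp
qed

text \<open>Of the two factors of the distance one pays for \<open>f i\<close> near the spirals of
  \<open>L i\<close>, the other for the theta denominator, by
  \<open>theta_div_lower\<close>.\<close>

lemma A_sum_bounded:
  assumes "\<forall>i\<in>{1..m}. f i \<in> A_space q (L i)"
  obtains R C where "0 < R" "\<forall>z\<in>sector \<Lambda> 0 R.
      norm (\<Sum>i=1..m. 1 / \<theta> (div_le L (i - 1)) z * f i z) * dist_div z \<Lambda> ^ 2 \<le> C"
    "\<forall>i\<in>{1..m}. f i holomorphic_on sector \<Lambda> 0 R"
proof -
  have "\<forall>i\<in>{1..m}. \<exists>C. \<exists>R>0. (\<forall>z\<in>sector \<Lambda> 0 R. norm (1 / \<theta> (div_le L (i - 1)) z * f i z) * dist_div z \<Lambda> ^ 2 \<le> C)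
      \<and> f i holomorphic_on sector \<Lambda> 0 R"
  proof
    fix i assume i: "i \<in> {1..m}"
    obtain R C A a where f: "0 < R" "R \<le> 1" "1 \<le> C" "1 \<le> A" "f i holomorphic_on sector (L i) 0 R"
      "\<forall>N. \<forall>z\<in>sector (L i) 0 R. norm (f i z - (\<Sum>n<N. a n * z ^ n)) * dist_div z (L i)
         \<le> C * A ^ N * p powr ((real N)\<^sup>2 / (2 * real (size (L i)))) * norm z ^ N"
      by (rule A_spaceE[OF reps_L[OF i] assms[rule_format, OF i]]) (rule that; assumption)
    obtain c where c: "0 < c" "\<forall>z. z \<noteq> 0 \<longrightarrow> c * dist_div z (div_le L (i - 1)) \<le> norm (\<theta> (div_le L (i - 1)) z)"
      by (rule theta_div_lower[OF reps_le[OF i]]) (rule that; assumption)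
    have "norm (1 / \<theta> (div_le L (i - 1)) z * f i z) * dist_div z \<Lambda> ^ 2 \<le> C / c" if z: "z \<in> sector \<Lambda> 0 R" for z
    proof -
      define d where "d = dist_div z \<Lambda>"
      define t where "t = norm (\<theta> (div_le L (i - 1)) z)"
      have z': "z \<noteq> 0" "0 < d" using z by (auto simp: sector_iff d_def)
      have "d \<le> dist_div z (div_le L (i - 1))"
        unfolding d_def by (rule dist_div_mono[OF reps_\<Lambda>]) (metis le_ge[OF i] mset_subset_eq_add_left)
      then have "c * d \<le> c * dist_div z (div_le L (i - 1))" using c by simp
      also have "\<dots> \<le> t" unfolding t_def using c z' by blast
      finally have t: "c * d \<le> t" .
      have "0 < c * d" using c z' by simp
      then have "t > 0" using t by linarith
      have "d \<le> dist_div z (L i)"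
        unfolding d_def by (rule dist_div_mono[OF reps_\<Lambda> L_subset[OF i]])
      then have "norm (f i z) * d \<le> norm (f i z) * dist_div z (L i)" by (intro mult_left_mono) auto
      also have "\<dots> \<le> C" using f(6)[rule_format, of z 0] sector_L[OF i] z by auto
      finally have fd: "norm (f i z) * d \<le> C" .
      have "d / t \<le> 1 / c" using t c \<open>t > 0\<close> by (simp add: field_simps)
      then have "(norm (f i z) * d) * (d / t) \<le> C * (1 / c)"
        using fd z' \<open>t > 0\<close> f(3) by (intro mult_mono) auto
      then show ?thesis by (simp add: norm_mult norm_divide t_def d_def power2_eq_square mult_ac)
    qed
    moreover have "f i holomorphic_on sector \<Lambda> 0 R"
      using f(5) sector_L[OF i] by (rule holomorphic_on_subset)
    ultimately show "\<exists>C. \<exists>R>0. (\<forall>z\<in>sector \<Lambda> 0 R. norm (1 / \<theta> (div_le L (i - 1)) z * f i z) * dist_div z \<Lambda> ^ 2 \<le> C)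
      \<and> f i holomorphic_on sector \<Lambda> 0 R"
      using f(1) by blast
  qed
  then obtain C where C: "\<forall>i\<in>{1..m}. \<exists>R>0. (\<forall>z\<in>sector \<Lambda> 0 R. norm (1 / \<theta> (div_le L (i - 1)) z * f i z) * dist_div z \<Lambda> ^ 2 \<le> C i)
      \<and> f i holomorphic_on sector \<Lambda> 0 R"
    by (rule bchoice[THEN exE]) (rule that)
  \<comment> \<open>Holomorphy is phrased as analyticity at each point, so that it can be part of
    the pointwise predicate for which a common radius is chosen.\<close>
  obtain R where R: "0 < R" "\<forall>i\<in>{1..m}. \<forall>z\<in>sector \<Lambda> 0 R.
      norm (1 / \<theta> (div_le L (i - 1)) z * f i z) * dist_div z \<Lambda> ^ 2 \<le> C i \<and> f i analytic_on {z}"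
  proof (rule common_sector[of "{1..m}" "\<lambda>_. \<Lambda>" "\<lambda>i z. norm (1 / \<theta> (div_le L (i - 1)) z * f i z) * dist_div z \<Lambda> ^ 2 \<le> C i \<and> f i analytic_on {z}"])
    fix i assume "i \<in> {1..m}"
    then obtain R where "R > 0" "\<forall>z\<in>sector \<Lambda> 0 R. norm (1 / \<theta> (div_le L (i - 1)) z * f i z) * dist_div z \<Lambda> ^ 2 \<le> C i"
      "f i holomorphic_on sector \<Lambda> 0 R"
      using C by blast
    then show "\<exists>R>0. \<forall>z\<in>sector \<Lambda> 0 R. norm (1 / \<theta> (div_le L (i - 1)) z * f i z) * dist_div z \<Lambda> ^ 2 \<le> C i \<and> f i analytic_on {z}"
      using sector_holomorphic_analytic[OF reps_\<Lambda>] by blast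
  qed (simp_all add: that)
  show ?thesis
  proof (rule that[OF R(1), of "\<Sum>i=1..m. C i"])
    show "\<forall>z\<in>sector \<Lambda> 0 R. norm (\<Sum>i=1..m. 1 / \<theta> (div_le L (i - 1)) z * f i z) * dist_div z \<Lambda> ^ 2 \<le> (\<Sum>i=1..m. C i)"
    proof
      fix z assume z: "z \<in> sector \<Lambda> 0 R"
      have "norm (\<Sum>i=1..m. 1 / \<theta> (div_le L (i - 1)) z * f i z) * dist_div z \<Lambda> ^ 2
        \<le> (\<Sum>i=1..m. norm (1 / \<theta> (div_le L (i - 1)) z * f i z)) * dist_div z \<Lambda> ^ 2"
        by (intro mult_right_mono norm_sum) auto
      also have "\<dots> = (\<Sum>i=1..m. norm (1 / \<theta> (div_le L (i - 1)) z * f i z) * dist_div z \<Lambda> ^ 2)"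
        by (rule sum_distrib_right)
      also have "\<dots> \<le> (\<Sum>i=1..m. C i)"
        using R(2) z by (intro sum_mono) blast
      finally show "norm (\<Sum>i=1..m. 1 / \<theta> (div_le L (i - 1)) z * f i z) * dist_div z \<Lambda> ^ 2 \<le> (\<Sum>i=1..m. C i)" .
    qed
    show "\<forall>i\<in>{1..m}. f i holomorphic_on sector \<Lambda> 0 R"
    proof
      fix i assume i: "i \<in> {1..m}"
      have "f i analytic_on sector \<Lambda> 0 R"
        unfolding analytic_on_analytic_at[of _ "sector \<Lambda> 0 R"] using R(2) i by blast
      then show "f i holomorphic_on sector \<Lambda> 0 R" by (rule analytic_imp_holomorphic)
    qed
  qed
qed

lemma O_part_eq:
  "germ \<Lambda> ` O_part q rep m L \<Lambda> =
     germ \<Lambda> ` {\<lambda>z. \<Sum>i=1..m. 1 / \<theta> (div_le L (i - 1)) z * f i z | f.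
                        \<forall>i\<in>{1..m}. f i \<in> A_space q (L i)}"
proof (intro equalityI subsetI)
  fix X assume "X \<in> germ \<Lambda> ` O_part q rep m L \<Lambda>"
  then obtain F where F: "X = germ \<Lambda> (\<lambda>z. 1 / \<theta> \<Lambda> z * F z)" "F \<in> E_part q rep m L \<Lambda>"
    "(\<lambda>z. 1 / \<theta> \<Lambda> z * F z) \<in> B_space \<Lambda>"
    unfolding O_part_def by blast
  obtain G E H R n B where D: "\<forall>i\<in>{1..m}. G i \<in> A_space q (L i)" "\<forall>i\<in>{1..m}. E i \<in> E0 q rep (L i)" "0 < R" "R \<le> 1"
    "\<forall>i\<in>{1..m}. \<forall>z\<in>sector (L i) 0 R. E i z = \<theta> (L i) z * G i z"
    "H holomorphic_on ball 0 R - {0}"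
    "\<forall>z. 0 < norm z \<and> norm z < R \<longrightarrow>
       F z = (\<Sum>i=1..m. \<theta> (div_ge m L (i + 1)) z * E i z) + \<theta> \<Lambda> z * H z"
    "\<forall>z. 0 < norm z \<and> norm z < R \<longrightarrow> norm (z ^ n * H z) \<le> B"
    by (rule E_part_decomposition[OF F(2)]) (rule that; assumption)
  have m1: "1 \<in> {1..m}" using m by simp
  define S where "S z = (\<Sum>i=1..m. 1 / \<theta> (div_le L (i - 1)) z * G i z)" for z
  have eq: "1 / \<theta> \<Lambda> z * F z = S z + H z" if z: "z \<in> sector \<Lambda> 0 R" for z
  proof -
    have nz: "\<theta> \<Lambda> z \<noteq> 0" and z': "0 < norm z \<and> norm z < R"
      using z unfolding sector_0_eq[OF reps_\<Lambda>] by auto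
    have t: "1 / \<theta> \<Lambda> z * (\<theta> (div_ge m L (i + 1)) z * E i z) = 1 / \<theta> (div_le L (i - 1)) z * G i z"
      if i: "i \<in> {1..m}" for i
    proof -
      have "E i z = \<theta> (L i) z * G i z" using D(5) i sector_L[OF i] z by blast
      then show ?thesis using theta_quotient[OF i nz, of "G i z"] theta_ge[OF i, of z] by (simp add: mult_ac)
    qed
    have "1 / \<theta> \<Lambda> z * F z = (\<Sum>i=1..m. 1 / \<theta> \<Lambda> z * (\<theta> (div_ge m L (i + 1)) z * E i z)) + H z"
      unfolding D(7)[rule_format, OF z'] using nz by (simp add: distrib_left sum_distrib_left)
    also have "(\<Sum>i=1..m. 1 / \<theta> \<Lambda> z * (\<theta> (div_ge m L (i + 1)) z * E i z)) = S z"
      unfolding S_def by (intro sum.cong refl t)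
    finally show ?thesis .
  qed
  obtain \<epsilon> where \<epsilon>: "0 < \<epsilon>"
    "\<And>H B R. H holomorphic_on ball 0 R - {0} \<Longrightarrow> 0 < R \<Longrightarrow> (\<And>z. z \<in> sector \<Lambda> \<epsilon> R \<Longrightarrow> norm (H z) \<le> B) \<Longrightarrow>
       \<exists>R'>0. \<forall>z. 0 < norm z \<and> norm z < R' \<longrightarrow> norm (H z) \<le> B"
    using bounded_from_sector[OF reps_\<Lambda>] by blast
  obtain R1 where R1: "0 < R1" "\<And>e r. 0 < e \<Longrightarrow> 0 < r \<Longrightarrow> r < R1 \<Longrightarrow> bounded ((\<lambda>z. 1 / \<theta> \<Lambda> z * F z) ` sector \<Lambda> e r)"
    using F(3) unfolding B_space_def by blast
  \<comment> \<open>\<open>B_space\<close> gives bounds only for radii strictly below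
    \<open>R1\<close>; hence half of it.\<close>
  have "bounded ((\<lambda>z. 1 / \<theta> \<Lambda> z * F z) ` sector \<Lambda> \<epsilon> (R1 / 2))"
    using R1(1) by (intro R1(2) \<epsilon>(1)) auto
  then obtain K where K: "\<And>z. z \<in> sector \<Lambda> \<epsilon> (R1 / 2) \<Longrightarrow> norm (1 / \<theta> \<Lambda> z * F z) \<le> K"
    unfolding bounded_iff by blast
  obtain R2 C where R2: "0 < R2" "\<forall>z\<in>sector \<Lambda> 0 R2. norm (S z) * dist_div z \<Lambda> ^ 2 \<le> C"
    "\<forall>i\<in>{1..m}. G i holomorphic_on sector \<Lambda> 0 R2"
    by (rule A_sum_bounded[OF D(1), folded S_def]) (rule that; assumption)
  define R3 where "R3 = min (R1 / 2) (min R2 R)"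
  have R3: "0 < R3" "R3 \<le> R1 / 2" "R3 \<le> R2" "R3 \<le> R" using R1 R2 D by (auto simp: R3_def)
  \<comment> \<open>Where the distance exceeds \<epsilon>, both the quotient of \<open>F\<close> by
    the theta product and \<open>S\<close> are bounded, hence so is their difference
    \<open>H\<close>; the maximum modulus principle fills in the rest of the disc.\<close>
  have "\<exists>R'>0. \<forall>z. 0 < norm z \<and> norm z < R' \<longrightarrow> norm (H z) \<le> K + C / \<epsilon>\<^sup>2"
  proof (rule \<epsilon>(2)[OF _ R3(1)])
    show "H holomorphic_on ball 0 R3 - {0}"
      using R3 by (auto intro: holomorphic_on_subset[OF D(6)])
    fix z assume z: "z \<in> sector \<Lambda> \<epsilon> R3"
    then have zs: "z \<in> sector \<Lambda> \<epsilon> (R1 / 2)" "z \<in> sector \<Lambda> 0 R2" "z \<in> sector \<Lambda> 0 R" "\<epsilon> < dist_div z \<Lambda>"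
      using R3 \<epsilon>(1) by (auto simp: sector_iff)
    have "norm (S z) * \<epsilon>\<^sup>2 \<le> norm (S z) * dist_div z \<Lambda> ^ 2"
      using zs(4) \<epsilon>(1) by (intro mult_left_mono power_mono) auto
    also have "\<dots> \<le> C" using R2(2) zs(2) by blast
    finally have "norm (S z) \<le> C / \<epsilon>\<^sup>2" using \<epsilon>(1) by (simp add: field_simps)
    moreover have "H z = 1 / \<theta> \<Lambda> z * F z - S z" using eq[OF zs(3)] by simp
    then have "norm (H z) \<le> norm (1 / \<theta> \<Lambda> z * F z) + norm (S z)"
      using norm_triangle_ineq4 by metis
    ultimately show "norm (H z) \<le> K + C / \<epsilon>\<^sup>2" using K[OF zs(1)] by linarith
  qed
  then obtain R4 where R4: "0 < R4" "\<forall>z. 0 < norm z \<and> norm z < R4 \<longrightarrow> norm (H z) \<le> K + C / \<epsilon>\<^sup>2" by blast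
  \<comment> \<open>\<open>div_le L 0\<close> is the null divisor, so the summand
    \<open>i = 1\<close> has denominator 1 and can take up \<open>H\<close> unchanged.\<close>
  have "H \<in> A_space q (L 1)"
  proof (rule A_space_bounded_punctured[OF reps_L[OF m1], of "min R R4"])
    show "H holomorphic_on ball 0 (min R R4) - {0}"
      by (rule holomorphic_on_subset[OF D(6)]) auto
    show "norm (H z) \<le> K + C / \<epsilon>\<^sup>2" if "0 < norm z" "norm z < min R R4" for z
      using that by (intro R4(2)[rule_format]) simp
  qed (use D R4 in simp)
  then have "(\<lambda>z. G 1 z + H z) \<in> A_space q (L 1)"
    by (rule A_space_add[OF reps_L[OF m1] D(1)[rule_format, OF m1]])
  moreover define f where "f i = (if i = 1 then (\<lambda>z. G 1 z + H z) else G i)" for i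
  ultimately have "\<forall>i\<in>{1..m}. f i \<in> A_space q (L i)"
    using D(1) by simp
  moreover have "germ \<Lambda> (\<lambda>z. 1 / \<theta> \<Lambda> z * F z)
      = germ \<Lambda> (\<lambda>z. \<Sum>i=1..m. 1 / \<theta> (div_le L (i - 1)) z * f i z)"
  proof (rule germ_eqI[OF D(3)])
    fix z assume z: "z \<in> sector \<Lambda> 0 R"
    have "(\<Sum>i=1..m. 1 / \<theta> (div_le L (i - 1)) z * f i z)
       = (\<Sum>i=1..m. 1 / \<theta> (div_le L (i - 1)) z * G i z + (if i = 1 then H z else 0))"
      by (intro sum.cong) (auto simp: f_def distrib_left div_le_def)
    also have "\<dots> = S z + H z" using m by (simp add: sum.distrib S_def)
    finally show "1 / \<theta> \<Lambda> z * F z = (\<Sum>i=1..m. 1 / \<theta> (div_le L (i - 1)) z * f i z)"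
      using eq[OF z] by simp
  qed
  ultimately show "X \<in> germ \<Lambda> ` {\<lambda>z. \<Sum>i=1..m. 1 / \<theta> (div_le L (i - 1)) z * f i z | f.
                        \<forall>i\<in>{1..m}. f i \<in> A_space q (L i)}"
    unfolding F(1) by blast
next
  fix X assume "X \<in> germ \<Lambda> ` {\<lambda>z. \<Sum>i=1..m. 1 / \<theta> (div_le L (i - 1)) z * f i z | f.
                        \<forall>i\<in>{1..m}. f i \<in> A_space q (L i)}"
  then obtain f where f: "X = germ \<Lambda> (\<lambda>z. \<Sum>i=1..m. 1 / \<theta> (div_le L (i - 1)) z * f i z)"
    "\<forall>i\<in>{1..m}. f i \<in> A_space q (L i)" by blast
  obtain E R1 where E1: "\<forall>i\<in>{1..m}. E i \<in> E0 q rep (L i)"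
    and R1: "0 < R1" "\<forall>i\<in>{1..m}. \<forall>z\<in>sector (L i) 0 R1. E i z = \<theta> (L i) z * f i z"
    by (rule A_family_imp_E0[OF f(2)]) (rule that; assumption)
  define F where "F z = (\<Sum>i=1..m. \<theta> (div_ge m L (i + 1)) z * E i z)" for z
  have F: "F \<in> E_part q rep m L \<Lambda>"
    unfolding F_def by (rule sum_in_E_part[OF E1])
  define S where "S z = (\<Sum>i=1..m. 1 / \<theta> (div_le L (i - 1)) z * f i z)" for z
  have eq: "1 / \<theta> \<Lambda> z * F z = S z" if z: "z \<in> sector \<Lambda> 0 R1" for z
  proof -
    have nz: "\<theta> \<Lambda> z \<noteq> 0"
      using z unfolding sector_0_eq[OF reps_\<Lambda>] by auto
    have t: "1 / \<theta> \<Lambda> z * (\<theta> (div_ge m L (i + 1)) z * E i z) = 1 / \<theta> (div_le L (i - 1)) z * f i z"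
      if i: "i \<in> {1..m}" for i
    proof -
      have "E i z = \<theta> (L i) z * f i z" using R1(2) i sector_L[OF i] z by blast
      then show ?thesis using theta_quotient[OF i nz, of "f i z"] theta_ge[OF i, of z] by (simp add: mult_ac)
    qed
    then show ?thesis
      unfolding F_def S_def sum_distrib_left by (intro sum.cong refl)
  qed
  obtain R2 C where R2: "0 < R2" "\<forall>z\<in>sector \<Lambda> 0 R2. norm (S z) * dist_div z \<Lambda> ^ 2 \<le> C"
    "\<forall>i\<in>{1..m}. f i holomorphic_on sector \<Lambda> 0 R2"
    by (rule A_sum_bounded[OF f(2), folded S_def]) (rule that; assumption)
  define R where "R = min R1 R2"
  have R: "0 < R" "R \<le> R1" "R \<le> R2" using R1 R2 by (auto simp: R_def)
  have sub: "sector \<Lambda> 0 R \<subseteq> sector \<Lambda> 0 R1" "sector \<Lambda> 0 R \<subseteq> sector \<Lambda> 0 R2"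
    using R by (auto simp: sector_iff)
  have "(\<lambda>z. 1 / \<theta> \<Lambda> z * F z) \<in> B_space \<Lambda>"
    unfolding B_space_def
  proof (intro CollectI exI[of _ R] conjI allI impI R(1))
    have "S holomorphic_on sector \<Lambda> 0 R"
      unfolding S_def
    proof (intro holomorphic_on_sum holomorphic_on_mult holomorphic_on_divide holomorphic_on_const)
      fix i assume i: "i \<in> {1..m}"
      show "f i holomorphic_on sector \<Lambda> 0 R"
        using R2(3) i sub(2) holomorphic_on_subset by blast
      have "sector \<Lambda> 0 R \<subseteq> - {0}" by (auto simp: sector_iff)
      then show "\<theta> (div_le L (i - 1)) holomorphic_on sector \<Lambda> 0 R"
        by (rule holomorphic_on_subset[OF theta_div_holomorphic[OF reps_le[OF i]]])
      fix z assume "z \<in> sector \<Lambda> 0 R"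
      then have "\<theta> \<Lambda> z \<noteq> 0" unfolding sector_0_eq[OF reps_\<Lambda>] by simp
      then show "\<theta> (div_le L (i - 1)) z \<noteq> 0"
        unfolding le_ge[OF i, symmetric] theta_div_add by simp
    qed
    then have "(\<lambda>z. 1 / \<theta> \<Lambda> z * F z) holomorphic_on sector \<Lambda> 0 R"
      by (rule holomorphic_transform) (use eq sub(1) in \<open>auto simp: subset_iff\<close>)
    then show "(\<lambda>z. 1 / \<theta> \<Lambda> z * F z) analytic_on sector \<Lambda> 0 R"
      by (simp add: analytic_on_open open_sector_0[OF reps_\<Lambda>])
    fix e r :: real assume er: "0 < e \<and> 0 < r \<and> r < R"
    show "bounded ((\<lambda>z. 1 / \<theta> \<Lambda> z * F z) ` sector \<Lambda> e r)"
    proof (rule boundedI)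
      fix y assume "y \<in> (\<lambda>z. 1 / \<theta> \<Lambda> z * F z) ` sector \<Lambda> e r"
      then obtain z where z: "y = 1 / \<theta> \<Lambda> z * F z" "z \<in> sector \<Lambda> e r" by blast
      then have zs: "z \<in> sector \<Lambda> 0 R1" "z \<in> sector \<Lambda> 0 R2" "e < dist_div z \<Lambda>"
        using er R by (auto simp: sector_iff)
      have "norm (S z) * e\<^sup>2 \<le> norm (S z) * dist_div z \<Lambda> ^ 2"
        using zs(3) er by (intro mult_left_mono power_mono) auto
      also have "\<dots> \<le> C" using R2(2) zs(2) by blast
      finally have "norm (S z) \<le> C / e\<^sup>2" using er by (simp add: field_simps)
      then show "norm y \<le> C / e\<^sup>2" unfolding z(1) eq[OF zs(1)] .
    qed
  qed
  then have "(\<lambda>z. 1 / \<theta> \<Lambda> z * F z) \<in> O_part q rep m L \<Lambda>"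
    unfolding O_part_def using F by blast
  moreover have "X = germ \<Lambda> (\<lambda>z. 1 / \<theta> \<Lambda> z * F z)"
    unfolding f(1) S_def[symmetric] by (rule germ_eqI[OF R1(1)]) (simp only: eq)
  ultimately show "X \<in> germ \<Lambda> ` O_part q rep m L \<Lambda>" by blast
qed

end

theorem theorem5p4p3:
  fixes q :: complex and m :: nat and L :: "nat \<Rightarrow> complex set multiset"
    and \<Lambda> :: "complex set multiset" and rep :: "complex set \<Rightarrow> complex"
  assumes "norm q > 1"
    and "ordered_partition q m L \<Lambda>"
    and "\<And>s. s \<in># \<Lambda> \<Longrightarrow> rep s \<in> s"
  shows "germ {#} ` E_part q rep m L \<Lambda> =
           germ {#} ` {\<lambda>z. \<Sum>i=1..m. theta_div q rep (div_ge m L (i + 1)) z * F i z | F.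
                         \<forall>i\<in>{1..m}. F i \<in> E0 q rep (L i)}
       \<and> germ \<Lambda> ` O_part q rep m L \<Lambda> =
           germ \<Lambda> ` {\<lambda>z. \<Sum>i=1..m. 1 / theta_div q rep (div_le L (i - 1)) z * f i z | f.
                        \<forall>i\<in>{1..m}. f i \<in> A_space q (L i)}"
proof -
  interpret q_theta q using assms(1) by unfold_locales
  have part: "1 \<le> m" "\<And>i. i \<in> {1..m} \<Longrightarrow> q_divisor q (L i) \<and> 1 \<le> size (L i)" "\<Lambda> = (\<Sum>i=1..m. L i)"
    using assms(2) unfolding ordered_partition_def by auto
  have "q_divisor q \<Lambda>"
    using part(2) unfolding part(3) q_divisor_def by (fastforce simp: set_mset_sum)
  then have "reps rep \<Lambda>" using assms(3) by (rule repsI)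
  then interpret q_partition q rep m L \<Lambda>
    using part by unfold_locales (auto simp: div_ge_def)
  show ?thesis using E_part_eq O_part_eq by blast
qed

end
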